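(* Let $(M,g)$ be a smooth Riemannian manifold that is diffeomorphic to $\mathbb{R}^n$ and admits an action by isometries of a Bieberbach group $\Gamma$. Let $N$ be the Nash dimension of the quotient manifold $M/\Gamma$. Then there exists an isometric embedding $u:(M,g)\to\mathbb{R}^{N+2n}$ such that $u(M)$ is a bounded subset of $\mathbb{R}^{N+2n}$.
   Context: Everything is $C^\infty$-smooth. Euclidean spaces carry their standard flat metrics. An isometric embedding $u:(M,g)\to\mathbb{R}^D$ is a smooth embedding such that the pullback of the Euclidean metric under $u$ equals $g$. A Bieberbach group $\Gamma$ is a group isomorphic to a torsion-free discrete cocompact subgroup of the isometry group of a Euclidean space. Its action on $(M,g)$ is by isometries, free, properly discontinuous and cocompact, so that $M/\Gamma$ is a compact smooth manifold. The Nash dimension $N(X)$ of a smooth manifold $X$ is the smallest integer $N$ such that, for every Riemannian metric $h$ on $X$, the Riemannian manifold $(X,h)$ can be isometrically embedded into $\mathbb{R}^N$. *)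

theory Defs
  imports "HOL-Analysis.Analysis" "HOL-Algebra.Group_Action"
begin

section \<open>Smooth functions on Euclidean space\<close>

text \<open>
  Points of the \<open>n\<close>-dimensional \<^const>\<open>Euclidean_space\<close> are functions \<open>nat \<Rightarrow> real\<close> that vanish
  from index \<open>n\<close> on.  So dimensions are numbers that one can quantify over, and dimension \<open>0\<close>
  is not excluded.
\<close>

abbreviation Rn :: "nat \<Rightarrow> (nat \<Rightarrow> real) set" where
  "Rn n \<equiv> topspace (Euclidean_space n)"

definition euclid_dist :: "nat \<Rightarrow> (nat \<Rightarrow> real) \<Rightarrow> (nat \<Rightarrow> real) \<Rightarrow> real" where
  "euclid_dist n x y = L2_set (\<lambda>i. x i - y i) {..<n}"

definition euclid_bounded :: "nat \<Rightarrow> (nat \<Rightarrow> real) set \<Rightarrow> bool" where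
  "euclid_bounded n S \<longleftrightarrow> S \<subseteq> Rn n \<and> (\<exists>B. \<forall>x\<in>S. euclid_dist n (\<lambda>i. 0) x \<le> B)"

definition partial_deriv :: "nat \<Rightarrow> ((nat \<Rightarrow> real) \<Rightarrow> real) \<Rightarrow> (nat \<Rightarrow> real) \<Rightarrow> real" where
  "partial_deriv i f x = deriv (\<lambda>t. f (x(i := t))) (x i)"

text \<open>
  Continuous differentiability of order \<open>k\<close> on a set \<open>U\<close> that is open in \<open>Euclidean_space n\<close>.
  Only the values of \<open>f\<close> on \<open>U\<close> matter.
\<close>

fun C_on :: "nat \<Rightarrow> nat \<Rightarrow> (nat \<Rightarrow> real) set \<Rightarrow> ((nat \<Rightarrow> real) \<Rightarrow> real) \<Rightarrow> bool" where
  "C_on n 0 U f \<longleftrightarrow> continuous_on U f"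
| "C_on n (Suc k) U f \<longleftrightarrow> continuous_on U f \<and>
     (\<forall>i<n. (\<forall>x\<in>U. (\<lambda>t. f (x(i := t))) differentiable (at (x i))) \<and>
            C_on n k U (partial_deriv i f))"

definition smooth_on :: "nat \<Rightarrow> (nat \<Rightarrow> real) set \<Rightarrow> ((nat \<Rightarrow> real) \<Rightarrow> real) \<Rightarrow> bool" where
  "smooth_on n U f \<longleftrightarrow> (\<forall>k. C_on n k U f)"


section \<open>Smooth manifolds and smooth maps\<close>

text \<open>A chart is a pair of its domain and its coordinate map, which is relevant only on the domain.\<close>

type_synonym 'a chart = "'a set \<times> ('a \<Rightarrow> nat \<Rightarrow> real)"

record 'a manifold =
  mdim :: nat
  mtop :: "'a topology"
  atlas :: "'a chart set"

definition chart_inv :: "'a chart \<Rightarrow> (nat \<Rightarrow> real) \<Rightarrow> 'a" where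
  "chart_inv c = inv_into (fst c) (snd c)"

definition is_chart :: "nat \<Rightarrow> 'a topology \<Rightarrow> 'a chart \<Rightarrow> bool" where
  "is_chart n X c \<longleftrightarrow>
     openin X (fst c) \<and> openin (Euclidean_space n) (snd c ` fst c) \<and>
     homeomorphic_map (subtopology X (fst c))
       (subtopology (Euclidean_space n) (snd c ` fst c)) (snd c)"

definition smooth_manifold :: "'a manifold \<Rightarrow> bool" where
  "smooth_manifold M \<longleftrightarrow>
     Hausdorff_space (mtop M) \<and> second_countable (mtop M) \<and>
     (\<forall>c\<in>atlas M. is_chart (mdim M) (mtop M) c) \<and>
     (\<Union>c\<in>atlas M. fst c) = topspace (mtop M) \<and>
     (\<forall>c\<in>atlas M. \<forall>d\<in>atlas M. \<forall>i<mdim M.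
        smooth_on (mdim M) (snd c ` (fst c \<inter> fst d)) (\<lambda>y. snd d (chart_inv c y) i))"

definition smooth_map :: "'a manifold \<Rightarrow> 'b manifold \<Rightarrow> ('a \<Rightarrow> 'b) \<Rightarrow> bool" where
  "smooth_map M N f \<longleftrightarrow>
     continuous_map (mtop M) (mtop N) f \<and>
     (\<forall>c\<in>atlas M. \<forall>d\<in>atlas N. \<forall>a<mdim N.
        smooth_on (mdim M) (snd c ` (fst c \<inter> f -` fst d)) (\<lambda>y. snd d (f (chart_inv c y)) a))"

definition diffeomorphism :: "'a manifold \<Rightarrow> 'b manifold \<Rightarrow> ('a \<Rightarrow> 'b) \<Rightarrow> bool" where
  "diffeomorphism M N f \<longleftrightarrow>
     bij_betw f (topspace (mtop M)) (topspace (mtop N)) \<and>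
     smooth_map M N f \<and> smooth_map N M (inv_into (topspace (mtop M)) f)"

text \<open>
  The entry \<open>(a, i)\<close> of the Jacobian matrix at \<open>p\<close> of the differential of \<open>f\<close>, with respect to
  a chart \<open>c\<close> around \<open>p\<close> and a chart \<open>d\<close> around \<open>f p\<close>.
\<close>

definition jacobian_entry :: "'a chart \<Rightarrow> 'b chart \<Rightarrow> ('a \<Rightarrow> 'b) \<Rightarrow> 'a \<Rightarrow> nat \<Rightarrow> nat \<Rightarrow> real" where
  "jacobian_entry c d f p a i = partial_deriv i (\<lambda>y. snd d (f (chart_inv c y)) a) (snd c p)"

definition immersion :: "'a manifold \<Rightarrow> 'b manifold \<Rightarrow> ('a \<Rightarrow> 'b) \<Rightarrow> bool" where
  "immersion M N f \<longleftrightarrow> smooth_map M N f \<and>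
     (\<forall>c\<in>atlas M. \<forall>d\<in>atlas N. \<forall>p\<in>fst c \<inter> f -` fst d. \<forall>v::nat \<Rightarrow> real.
        (\<forall>a<mdim N. (\<Sum>i<mdim M. jacobian_entry c d f p a i * v i) = 0) \<longrightarrow> (\<forall>i<mdim M. v i = 0))"

definition smooth_embedding :: "'a manifold \<Rightarrow> 'b manifold \<Rightarrow> ('a \<Rightarrow> 'b) \<Rightarrow> bool" where
  "smooth_embedding M N f \<longleftrightarrow> immersion M N f \<and> embedding_map (mtop M) (mtop N) f"

definition euclid :: "nat \<Rightarrow> (nat \<Rightarrow> real) manifold" where
  "euclid n = \<lparr>mdim = n, mtop = Euclidean_space n, atlas = {(Rn n, \<lambda>x. x)}\<rparr>"


section \<open>Riemannian metrics\<close>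

text \<open>
  A covariant 2-tensor field is given by its components: \<open>g c p i j\<close> is the value at \<open>p\<close> on the
  \<open>i\<close>-th and \<open>j\<close>-th coordinate vectors of the chart \<open>c\<close>.
\<close>

type_synonym 'a tensor2 = "'a chart \<Rightarrow> 'a \<Rightarrow> nat \<Rightarrow> nat \<Rightarrow> real"

text \<open>
  The pullback of the tensor field \<open>h\<close> on \<open>N\<close> along \<open>f\<close> equals the tensor field \<open>g\<close> on \<open>M\<close>.
  For \<open>f\<close> the identity and \<open>h = g\<close>, this is the transformation law under a change of charts.
\<close>

definition pullback_eq ::
  "'a manifold \<Rightarrow> 'a tensor2 \<Rightarrow> 'b manifold \<Rightarrow> 'b tensor2 \<Rightarrow> ('a \<Rightarrow> 'b) \<Rightarrow> bool" where
  "pullback_eq M g N h f \<longleftrightarrow>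
     (\<forall>c\<in>atlas M. \<forall>d\<in>atlas N. \<forall>p\<in>fst c \<inter> f -` fst d. \<forall>i<mdim M. \<forall>j<mdim M.
        g c p i j =
          (\<Sum>a<mdim N. \<Sum>b<mdim N. jacobian_entry c d f p a i * jacobian_entry c d f p b j * h d (f p) a b))"

definition riemannian_metric :: "'a manifold \<Rightarrow> 'a tensor2 \<Rightarrow> bool" where
  "riemannian_metric M g \<longleftrightarrow>
     pullback_eq M g M g (\<lambda>p. p) \<and>
     (\<forall>c\<in>atlas M. \<forall>i<mdim M. \<forall>j<mdim M.
        smooth_on (mdim M) (snd c ` fst c) (\<lambda>y. g c (chart_inv c y) i j)) \<and>
     (\<forall>c\<in>atlas M. \<forall>p\<in>fst c. \<forall>i<mdim M. \<forall>j<mdim M. g c p i j = g c p j i) \<and>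
     (\<forall>c\<in>atlas M. \<forall>p\<in>fst c. \<forall>v::nat \<Rightarrow> real.
        (\<exists>i<mdim M. v i \<noteq> 0) \<longrightarrow> (\<Sum>i<mdim M. \<Sum>j<mdim M. g c p i j * v i * v j) > 0)"

definition flat_metric :: "(nat \<Rightarrow> real) tensor2" where
  "flat_metric c p i j = (if i = j then 1 else 0)"

definition isometry :: "'a manifold \<Rightarrow> 'a tensor2 \<Rightarrow> ('a \<Rightarrow> 'a) \<Rightarrow> bool" where
  "isometry M g f \<longleftrightarrow> diffeomorphism M M f \<and> pullback_eq M g M g f"

definition isometric_embedding ::
  "'a manifold \<Rightarrow> 'a tensor2 \<Rightarrow> nat \<Rightarrow> ('a \<Rightarrow> nat \<Rightarrow> real) \<Rightarrow> bool" where
  "isometric_embedding M g D u \<longleftrightarrow>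
     smooth_embedding M (euclid D) u \<and> pullback_eq M g (euclid D) flat_metric u"

text \<open>
  \<open>N\<close> is the Nash dimension of \<open>X\<close>.  This is a relation, so that the existence of such a number
  (which is Nash's embedding theorem) is not built into the definition.
\<close>

definition nash_dimension :: "'a manifold \<Rightarrow> nat \<Rightarrow> bool" where
  "nash_dimension X N \<longleftrightarrow>
     (\<forall>h. riemannian_metric X h \<longrightarrow> (\<exists>u. isometric_embedding X h N u)) \<and>
     (\<forall>N'. (\<forall>h. riemannian_metric X h \<longrightarrow> (\<exists>u. isometric_embedding X h N' u)) \<longrightarrow> N \<le> N')"


section \<open>Group actions and quotients\<close>

definition orbit_topology ::
  "('g, 'b) monoid_scheme \<Rightarrow> 'a topology \<Rightarrow> ('g \<Rightarrow> 'a \<Rightarrow> 'a) \<Rightarrow> 'a set topology" where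
  "orbit_topology G X act =
     topology (\<lambda>W. W \<subseteq> orbits G (topspace X) act \<and> openin X {x \<in> topspace X. orbit G act x \<in> W})"

lemma openin_orbit_topology:
  "openin (orbit_topology G X act) W \<longleftrightarrow>
     W \<subseteq> orbits G (topspace X) act \<and> openin X {x \<in> topspace X. orbit G act x \<in> W}"
proof -
  have "istopology (\<lambda>W. W \<subseteq> orbits G (topspace X) act \<and> openin X {x \<in> topspace X. orbit G act x \<in> W})"
    (is "istopology ?P")
    unfolding istopology_def
  proof (intro conjI allI impI)
    fix S T assume "?P S" "?P T"
    moreover have "{x \<in> topspace X. orbit G act x \<in> S \<inter> T} =
        {x \<in> topspace X. orbit G act x \<in> S} \<inter> {x \<in> topspace X. orbit G act x \<in> T}"
      by blast
    ultimately show "S \<inter> T \<subseteq> orbits G (topspace X) act"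
      and "openin X {x \<in> topspace X. orbit G act x \<in> S \<inter> T}"
      by auto
  next
    fix K assume K: "\<forall>S\<in>K. ?P S"
    then show "\<Union>K \<subseteq> orbits G (topspace X) act"
      by blast
    have "{x \<in> topspace X. orbit G act x \<in> \<Union>K} = (\<Union>S\<in>K. {x \<in> topspace X. orbit G act x \<in> S})"
      by blast
    with K show "openin X {x \<in> topspace X. orbit G act x \<in> \<Union>K}"
      by auto
  qed
  then show ?thesis
    by (simp add: orbit_topology_def topology_inverse')
qed

lemma topspace_orbit_topology: "topspace (orbit_topology G X act) = orbits G (topspace X) act"
proof
  show "topspace (orbit_topology G X act) \<subseteq> orbits G (topspace X) act"
    using openin_orbit_topology openin_topspace by metis
  have "{x \<in> topspace X. orbit G act x \<in> orbits G (topspace X) act} = topspace X"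
    by (auto simp: orbits_def)
  then have "openin (orbit_topology G X act) (orbits G (topspace X) act)"
    by (simp add: openin_orbit_topology)
  then show "orbits G (topspace X) act \<subseteq> topspace (orbit_topology G X act)"
    by (rule openin_subset)
qed

lemma quotient_map_orbit: "quotient_map X (orbit_topology G X act) (orbit G act)"
  unfolding quotient_map_def
  by (auto simp: topspace_orbit_topology openin_orbit_topology orbits_def)

definition free_action :: "('g, 'b) monoid_scheme \<Rightarrow> 'a set \<Rightarrow> ('g \<Rightarrow> 'a \<Rightarrow> 'a) \<Rightarrow> bool" where
  "free_action G S act \<longleftrightarrow> (\<forall>\<gamma>\<in>carrier G. \<forall>x\<in>S. act \<gamma> x = x \<longrightarrow> \<gamma> = \<one>\<^bsub>G\<^esub>)"

definition properly_discontinuous ::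
  "('g, 'b) monoid_scheme \<Rightarrow> 'a topology \<Rightarrow> ('g \<Rightarrow> 'a \<Rightarrow> 'a) \<Rightarrow> bool" where
  "properly_discontinuous G X act \<longleftrightarrow>
     (\<forall>K. compactin X K \<longrightarrow> finite {\<gamma> \<in> carrier G. act \<gamma> ` K \<inter> K \<noteq> {}})"

definition cocompact ::
  "('g, 'b) monoid_scheme \<Rightarrow> 'a topology \<Rightarrow> ('g \<Rightarrow> 'a \<Rightarrow> 'a) \<Rightarrow> bool" where
  "cocompact G X act \<longleftrightarrow> compact_space (orbit_topology G X act)"

text \<open>
  The charts of the quotient are the restrictions of charts of \<open>M\<close> to open sets \<open>V\<close> on which the
  projection to the orbit space is injective, transported along the projection.
\<close>

definition quotient_manifold ::
  "'a manifold \<Rightarrow> ('g, 'b) monoid_scheme \<Rightarrow> ('g \<Rightarrow> 'a \<Rightarrow> 'a) \<Rightarrow> 'a set manifold" where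
  "quotient_manifold M G act =
     \<lparr>mdim = mdim M,
      mtop = orbit_topology G (mtop M) act,
      atlas = {(orbit G act ` V, \<lambda>q. snd c (inv_into V (orbit G act) q)) | c V.
                 c \<in> atlas M \<and> openin (mtop M) V \<and> V \<subseteq> fst c \<and> inj_on (orbit G act) V}\<rparr>"


section \<open>Bieberbach groups\<close>

definition euclid_isom_group :: "nat \<Rightarrow> ((nat \<Rightarrow> real) \<Rightarrow> nat \<Rightarrow> real) monoid" where
  "euclid_isom_group m = (BijGroup (Rn m))
     \<lparr>carrier := {f \<in> Bij (Rn m).
        \<forall>x\<in>Rn m. \<forall>y\<in>Rn m. euclid_dist m (f x) (f y) = euclid_dist m x y}\<rparr>"

definition torsion_free :: "('g, 'b) monoid_scheme \<Rightarrow> bool" where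
  "torsion_free G \<longleftrightarrow>
     (\<forall>x\<in>carrier G. \<forall>k::nat. k > 0 \<and> x [^]\<^bsub>G\<^esub> k = \<one>\<^bsub>G\<^esub> \<longrightarrow> x = \<one>\<^bsub>G\<^esub>)"

text \<open>
  \<^const>\<open>discrete\<close> refers to the product topology on functions, that is, to pointwise convergence.
  On isometry groups of Euclidean spaces this is the usual (compact-open) topology; outside
  \<open>Rn m\<close> all the functions concerned are constantly \<^const>\<open>undefined\<close>.
\<close>

definition bieberbach_group :: "('g, 'b) monoid_scheme \<Rightarrow> bool" where
  "bieberbach_group G \<longleftrightarrow> group G \<and>
     (\<exists>m H. subgroup H (euclid_isom_group m) \<and>
            torsion_free ((euclid_isom_group m)\<lparr>carrier := H\<rparr>) \<and>
            discrete H \<and>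
            cocompact ((euclid_isom_group m)\<lparr>carrier := H\<rparr>) (Euclidean_space m) (\<lambda>h. h) \<and>
            G \<cong> (euclid_isom_group m)\<lparr>carrier := H\<rparr>)"

end

theory Submission
  imports Defs "HOL-Homology.Brouwer_Degree"
begin

text \<open>
  A Bieberbach group \<open>\<Gamma>\<close> acts on some \<open>\<real>\<^sup>m\<close> by isometries, freely, properly discontinuously and cocompactly.
  Isometries of \<open>\<real>\<^sup>m\<close> are affine, so averaging an orbit with weights coming from a bump function on \<open>M\<close>
  gives a smooth equivariant map \<open>\<phi> : M \<rightarrow> \<real>\<^sup>m\<close>.  By cocompactness, \<open>h = g - \<epsilon>\<^sup>2 \<phi>\<^sup>* flat\<close> is still a Riemannian
  metric for small \<open>\<epsilon>\<close>.  It is \<open>\<Gamma>\<close>-invariant, hence descends to \<open>M/\<Gamma>\<close>, where it is induced by some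
  \<open>v : M/\<Gamma> \<rightarrow> \<real>\<^sup>N\<close>.  A product of \<open>m\<close> copies of a bounded spiral of unit speed is a bounded isometric embedding
  \<open>\<psi> : \<real>\<^sup>m \<rightarrow> \<real>\<^bsup>2m\<^esup>\<close>, so \<open>(v \<circ> \<pi>, \<epsilon> \<psi> \<circ> \<phi>)\<close> is a bounded isometric immersion of \<open>(M, g)\<close>.  It is an embedding:
  \<open>v\<close> determines a point up to \<open>\<Gamma>\<close>, and \<open>\<phi>\<close> separates the points of an orbit uniformly.

  It remains to see that \<open>m \<le> n\<close>.  Since \<open>M\<close> is contractible, uniformly because of the cocompact action, one can map
  \<open>\<real>\<^sup>m\<close> back to \<open>M\<close> by iterated coning over a partition of unity, in such a way that the composition with
  \<open>\<phi>\<close> is at bounded distance from the identity of \<open>\<real>\<^sup>m\<close>.  Spheres are not contractible, so this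
  composition is surjective, whereas for \<open>n < m\<close> the locally Lipschitz map \<open>\<phi>\<close> cannot cover a cube.
\<close>

section \<open>Calculus on open subsets of Euclidean space\<close>

text \<open>Each Euclidean direction costs two coordinates because a unit-speed map from the real
  line to a line is unbounded, whereas a plane has room for a bounded injective unit-speed curve.
  Such a curve accumulates somewhere, so its image is not closed; for an embedding a continuous left
  inverse is enough, and the strictly increasing radius supplies it. Invariance of the subtracted
  tensor rests on orthogonality: \<open>\<phi>\<close> intertwines \<open>act\<close> with Euclidean
  motions, and their linear parts drop out of the sum of squares of the derivatives. The main
  obstacle is that \<open>m\<close> comes from the abstract group and \<open>n\<close> from
  \<open>M\<close>, and the only link between them is that the group acts on both spaces. The
  comparison is therefore coarse: the action on \<open>M\<close>, read in global coordinates, is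
  used only as a continuous one, and every bound is obtained on a finite piece around the identity
  of the group and then translated. The two ends of the argument are elementary, non-contractibility
  of spheres and a count of grid points, and the calculus works with one coordinate at a
  time.\<close>

lemma openin_Euclidean_space: "openin (Euclidean_space n) U \<longleftrightarrow> (\<exists>T. open T \<and> U = Rn n \<inter> T)"
  by (simp add: Euclidean_space_def euclidean_product_topology openin_open)

lemma continuous_on_coord: "continuous_on U (\<lambda>x::nat \<Rightarrow> real. x j)"
  by (rule continuous_on_subset[OF continuous_on_product_coordinates]) simp

lemma mem_Rn: "x \<in> Rn n \<longleftrightarrow> (\<forall>i\<ge>n. x i = 0)"
  by (simp add: topspace_Euclidean_space)

lemma openin_Euclidean_space_box:
  assumes "\<forall>i<n. open (X i)"
  shows "openin (Euclidean_space n) {y \<in> Rn n. \<forall>i<n. y i \<in> X i}"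
proof -
  have "open ((\<lambda>y::nat \<Rightarrow> real. y i) -` X i)" if "i < n" for i
    using that assms by (intro open_vimage continuous_on_coord) auto
  then have "open (\<Inter>i\<in>{..<n}. (\<lambda>y::nat \<Rightarrow> real. y i) -` X i)"
    by (intro open_INT) auto
  moreover have "{y \<in> Rn n. \<forall>i<n. y i \<in> X i} = Rn n \<inter> (\<Inter>i\<in>{..<n}. (\<lambda>y. y i) -` X i)"
    by auto
  ultimately show ?thesis
    unfolding openin_Euclidean_space by blast
qed

text \<open>On \<open>Rn n\<close> the coordinates from \<open>n\<close> on are frozen at 0, so only
  the first \<open>n\<close> sides of a product neighbourhood constrain a point. This trades the
  product topology for concrete cubes.\<close>

lemma openin_Euclidean_space_iff:
  "openin (Euclidean_space n) U \<longleftrightarrow>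
     U \<subseteq> Rn n \<and> (\<forall>x\<in>U. \<exists>\<delta>>0. \<forall>y\<in>Rn n. (\<forall>i<n. \<bar>y i - x i\<bar> < \<delta>) \<longrightarrow> y \<in> U)"
proof (intro iffI conjI ballI)
  assume U: "openin (Euclidean_space n) U"
  then show "U \<subseteq> Rn n" by (rule openin_subset)
  fix x assume x: "x \<in> U"
  obtain T where T: "open T" "U = Rn n \<inter> T"
    using U unfolding openin_Euclidean_space by blast
  have "openin (product_topology (\<lambda>i. euclidean) UNIV) T"
    using T(1) by (simp add: euclidean_product_topology)
  moreover have "x \<in> T" using T(2) x by blast
  ultimately have "\<exists>X. x \<in> (\<Pi>\<^sub>E i\<in>UNIV. X i) \<and> (\<forall>i. openin euclidean (X i)) \<and>
      finite {i. X i \<noteq> topspace euclidean} \<and> (\<Pi>\<^sub>E i\<in>UNIV. X i) \<subseteq> T"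
    by (rule product_topology_open_contains_basis)
  then obtain X where X: "x \<in> (\<Pi>\<^sub>E i\<in>UNIV. X i)" "\<And>i. open (X i)" "(\<Pi>\<^sub>E i\<in>UNIV. X i) \<subseteq> T"
    by (elim exE conjE) (simp only: open_openin)
  have "\<exists>d>0. \<forall>t. \<bar>t - x i\<bar> < d \<longrightarrow> t \<in> X i" for i
  proof -
    have "x i \<in> X i" using X(1) by (rule PiE_mem) simp
    then obtain e where "e > 0" "\<forall>y. dist y (x i) < e \<longrightarrow> y \<in> X i"
      using X(2)[of i] unfolding open_dist by blast
    then show ?thesis unfolding dist_real_def by blast
  qed
  then have "\<forall>i. \<exists>d>0. \<forall>t. \<bar>t - x i\<bar> < d \<longrightarrow> t \<in> X i" by blast
  from choice[OF this] obtain d where d: "\<And>i. d i > 0" "\<And>i t. \<bar>t - x i\<bar> < d i \<Longrightarrow> t \<in> X i" by blast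
  \<comment> \<open>The 1 keeps the minimum meaningful when \<open>n = 0\<close>.\<close>
  define \<delta> where "\<delta> = Min (insert 1 (d ` {..<n}))"
  have "\<delta> > 0" using d by (auto simp: \<delta>_def)
  moreover have "y \<in> U" if y: "y \<in> Rn n" "\<forall>i<n. \<bar>y i - x i\<bar> < \<delta>" for y
  proof -
    have "y i \<in> X i" for i
    proof (cases "i < n")
      case True
      then have "\<delta> \<le> d i" by (auto simp: \<delta>_def)
      moreover have "\<bar>y i - x i\<bar> < \<delta>" using y True by blast
      ultimately have "\<bar>y i - x i\<bar> < d i" by linarith
      then show ?thesis by (rule d(2))
    next
      case False
      then have "y i = x i" using y(1) T(2) x by (simp add: mem_Rn)
      then show ?thesis using d(1)[of i] d(2)[of "y i" i] by simp
    qed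
    then have "y \<in> (\<Pi>\<^sub>E i\<in>UNIV. X i)" by (simp add: PiE_UNIV_domain)
    then show ?thesis using X(3) T(2) y(1) by blast
  qed
  ultimately show "\<exists>\<delta>>0. \<forall>y\<in>Rn n. (\<forall>i<n. \<bar>y i - x i\<bar> < \<delta>) \<longrightarrow> y \<in> U" by blast
next
  assume U: "U \<subseteq> Rn n \<and> (\<forall>x\<in>U. \<exists>\<delta>>0. \<forall>y\<in>Rn n. (\<forall>i<n. \<bar>y i - x i\<bar> < \<delta>) \<longrightarrow> y \<in> U)"
  show "openin (Euclidean_space n) U"
  proof (subst openin_subopen, intro ballI)
    fix x assume x: "x \<in> U"
    then obtain \<delta> where \<delta>: "\<delta> > 0" "\<forall>y\<in>Rn n. (\<forall>i<n. \<bar>y i - x i\<bar> < \<delta>) \<longrightarrow> y \<in> U" using U by blast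
    have "openin (Euclidean_space n) {y \<in> Rn n. \<forall>i<n. y i \<in> {x i - \<delta><..<x i + \<delta>}}"
      by (rule openin_Euclidean_space_box) auto
    moreover have "x \<in> {y \<in> Rn n. \<forall>i<n. y i \<in> {x i - \<delta><..<x i + \<delta>}}" using \<delta> x U by auto
    moreover have "{y \<in> Rn n. \<forall>i<n. y i \<in> {x i - \<delta><..<x i + \<delta>}} \<subseteq> U"
      using \<delta> by (fastforce simp: abs_less_iff)
    ultimately show "\<exists>T. openin (Euclidean_space n) T \<and> x \<in> T \<and> T \<subseteq> U" by blast
  qed
qed

lemma continuous_on_Euclidean_boxD:
  fixes f :: "(nat \<Rightarrow> real) \<Rightarrow> real"
  assumes "continuous_on U f" "openin (Euclidean_space n) U" "x \<in> U" "e > 0"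
  shows "\<exists>\<delta>>0. \<forall>y\<in>Rn n. (\<forall>i<n. \<bar>y i - x i\<bar> < \<delta>) \<longrightarrow> y \<in> U \<and> \<bar>f y - f x\<bar> < e"
proof -
  obtain A where A: "open A" "x \<in> A" "\<forall>y\<in>U. y \<in> A \<longrightarrow> f y \<in> ball (f x) e"
    using assms(1,3,4) unfolding continuous_on_topological
    by (metis centre_in_ball open_ball)
  have "openin (Euclidean_space n) (U \<inter> A)"
    using assms(2) A(1) unfolding openin_Euclidean_space by (auto simp: Int_assoc intro: open_Int)
  then obtain \<delta> where "\<delta> > 0" "\<forall>y\<in>Rn n. (\<forall>i<n. \<bar>y i - x i\<bar> < \<delta>) \<longrightarrow> y \<in> U \<inter> A"
    using assms A unfolding openin_Euclidean_space_iff by (metis IntI)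
  then show ?thesis using A(3) by (intro exI[of _ \<delta>]) (auto simp: dist_real_def abs_minus_commute)
qed

lemma continuous_on_Euclidean_local:
  fixes f :: "(nat \<Rightarrow> real) \<Rightarrow> real"
  assumes "\<And>x. x \<in> U \<Longrightarrow> \<exists>V. openin (Euclidean_space n) V \<and> x \<in> V \<and> continuous_on V f"
    and "openin (Euclidean_space n) U"
  shows "continuous_on U f"
  unfolding continuous_on_topological
proof (intro ballI allI impI)
  fix x B assume *: "x \<in> U" "open (B :: real set)" "f x \<in> B"
  obtain V where V: "openin (Euclidean_space n) V" "x \<in> V" "continuous_on V f"
    using assms * by blast
  obtain A where A: "open A" "x \<in> A" "\<forall>y\<in>V. y \<in> A \<longrightarrow> f y \<in> B"
    using V * unfolding continuous_on_topological by blast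
  obtain T where T: "open T" "V = Rn n \<inter> T"
    using V unfolding openin_Euclidean_space by blast
  have "U \<subseteq> Rn n" using assms(2) by (rule openin_subset)
  then show "\<exists>A. open A \<and> x \<in> A \<and> (\<forall>y\<in>U. y \<in> A \<longrightarrow> f y \<in> B)"
    using A T V by (intro exI[of _ "A \<inter> T"]) auto
qed

lemma eventually_upd_mem:
  assumes "openin (Euclidean_space n) U" "x \<in> U" "i < n"
  shows "eventually (\<lambda>t. x(i := t) \<in> U) (nhds (x i))"
proof -
  obtain \<delta> where \<delta>: "\<delta> > 0" "\<forall>y\<in>Rn n. (\<forall>i<n. \<bar>y i - x i\<bar> < \<delta>) \<longrightarrow> y \<in> U"
    using assms unfolding openin_Euclidean_space_iff by metis
  have "x \<in> Rn n" using assms openin_subset by blast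
  then have "x(i := t) \<in> U" if "dist t (x i) < \<delta>" for t
    using \<delta> that assms by (auto simp: mem_Rn dist_real_def)
  then show ?thesis using \<delta>(1) unfolding eventually_nhds_metric by blast
qed

lemma DERIV_upd_cong:
  assumes "openin (Euclidean_space n) U" "x \<in> U" "i < n" "\<And>x. x \<in> U \<Longrightarrow> f x = g x"
  shows "DERIV (\<lambda>t. f (x(i := t))) (x i) :> d \<longleftrightarrow> DERIV (\<lambda>t. g (x(i := t))) (x i) :> d"
  by (rule DERIV_cong_ev) (auto intro: eventually_mono[OF eventually_upd_mem[OF assms(1-3)]] assms(4))

lemma partial_deriv_eqI: "DERIV (\<lambda>t. f (x(i := t))) (x i) :> d \<Longrightarrow> partial_deriv i f x = d"
  unfolding partial_deriv_def by (rule DERIV_imp_deriv)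

lemma partial_deriv_cong:
  assumes "openin (Euclidean_space n) U" "x \<in> U" "i < n" "\<And>x. x \<in> U \<Longrightarrow> f x = g x"
  shows "partial_deriv i f x = partial_deriv i g x"
  unfolding partial_deriv_def
  by (rule deriv_cong_ev) (auto intro: eventually_mono[OF eventually_upd_mem[OF assms(1-3)]] assms(4))

lemma C_on_imp_continuous: "C_on n k U f \<Longrightarrow> continuous_on U f"
  by (cases k) auto

lemma C_on_DERIV:
  assumes "C_on n (Suc k) U f" "x \<in> U" "i < n"
  shows "DERIV (\<lambda>t. f (x(i := t))) (x i) :> partial_deriv i f x"
proof -
  have "(\<lambda>t. f (x(i := t))) differentiable (at (x i))" using assms by auto
  then show ?thesis
    unfolding partial_deriv_def using DERIV_deriv_iff_real_differentiable by blast
qed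

lemma C_on_cong:
  assumes "openin (Euclidean_space n) U" "\<And>x. x \<in> U \<Longrightarrow> f x = g x" "C_on n k U f"
  shows "C_on n k U g"
  using assms(2,3)
proof (induction k arbitrary: f g)
  case 0
  then show ?case by (auto cong: continuous_on_cong)
next
  case (Suc k)
  have "continuous_on U g" using Suc.prems C_on_imp_continuous continuous_on_cong by metis
  moreover have "(\<lambda>t. g (x(i := t))) differentiable (at (x i))" if "i < n" "x \<in> U" for i x
    unfolding real_differentiable_def
    using DERIV_upd_cong[OF assms(1) that(2,1) Suc.prems(1), THEN iffD1, OF _ C_on_DERIV[OF Suc.prems(2) that(2,1)]]
    by blast
  moreover have "C_on n k U (partial_deriv i g)" if "i < n" for i
  proof (rule Suc.IH)
    show "C_on n k U (partial_deriv i f)" using Suc.prems that by auto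
    show "partial_deriv i f x = partial_deriv i g x" if "x \<in> U" for x
      by (rule partial_deriv_cong[OF assms(1) that \<open>i < n\<close>]) (use Suc.prems in auto)
  qed
  ultimately show ?case by auto
qed

text \<open>Derivatives are unique, so on an open set any explicit family \<open>f'\<close> of
  coordinate derivatives may stand in for \<open>partial_deriv\<close>. The closure rules below use
  it to state their derivatives as formulas.\<close>

lemma C_on_SucI:
  assumes "openin (Euclidean_space n) U" "continuous_on U f"
    and "\<And>i. i < n \<Longrightarrow> C_on n k U (f' i)"
    and "\<And>i x. i < n \<Longrightarrow> x \<in> U \<Longrightarrow> DERIV (\<lambda>t. f (x(i := t))) (x i) :> f' i x"
  shows "C_on n (Suc k) U f"
proof -
  have "C_on n k U (partial_deriv i f)" if "i < n" for i
    by (rule C_on_cong[OF assms(1) _ assms(3)[OF that]])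
      (use assms(4)[OF that] in \<open>simp add: partial_deriv_eqI[symmetric]\<close>)
  moreover have "(\<lambda>t. f (x(i := t))) differentiable (at (x i))" if "i < n" "x \<in> U" for i x
    unfolding real_differentiable_def using assms(4)[OF that] by blast
  ultimately show ?thesis using assms(2) by auto
qed

lemma C_on_Suc_imp: "C_on n (Suc k) U f \<Longrightarrow> C_on n k U f"
proof (induction k arbitrary: f)
  case 0
  then show ?case by (auto dest: C_on_imp_continuous)
next
  case (Suc k)
  have "C_on n k U (partial_deriv i f)" if "i < n" for i
    by (rule Suc.IH) (use Suc.prems that in auto)
  then show ?case using Suc.prems by auto
qed

lemma C_on_subset: "C_on n k U f \<Longrightarrow> V \<subseteq> U \<Longrightarrow> C_on n k V f"
proof (induction k arbitrary: f)
  case 0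
  then show ?case by (auto intro: continuous_on_subset)
next
  case (Suc k)
  then show ?case by (auto intro: continuous_on_subset)
qed

lemma C_on_local:
  assumes "openin (Euclidean_space n) U"
    and "\<And>x. x \<in> U \<Longrightarrow> \<exists>V. openin (Euclidean_space n) V \<and> x \<in> V \<and> C_on n k V f"
  shows "C_on n k U f"
  using assms(2)
proof (induction k arbitrary: f)
  case 0
  then show ?case using continuous_on_Euclidean_local[OF _ assms(1)] by simp
next
  case (Suc k)
  have "continuous_on U f"
    using continuous_on_Euclidean_local[OF _ assms(1)] Suc.prems C_on_imp_continuous by metis
  moreover have "C_on n k U (partial_deriv i f)" if "i < n" for i
    by (rule Suc.IH) (use Suc.prems that in fastforce)
  moreover have "(\<lambda>t. f (x(i := t))) differentiable (at (x i))" if "i < n" "x \<in> U" for i x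
    using Suc.prems[OF that(2)] that by auto
  ultimately show ?case by auto
qed

lemma C_on_const: "C_on n k U (\<lambda>x. c)"
proof (induction k arbitrary: c)
  case (Suc k)
  have "partial_deriv i (\<lambda>x. c) = (\<lambda>x. 0)" for i by (auto simp: partial_deriv_def)
  then show ?case using Suc by auto
qed auto

lemma C_on_add:
  assumes "openin (Euclidean_space n) U" "C_on n k U f" "C_on n k U g"
  shows "C_on n k U (\<lambda>x. f x + g x)"
  using assms(2,3)
proof (induction k arbitrary: f g)
  case 0
  then show ?case by (auto intro: continuous_intros)
next
  case (Suc k)
  show ?case
  proof (rule C_on_SucI[OF assms(1), where f' = "\<lambda>i x. partial_deriv i f x + partial_deriv i g x"])
    show "continuous_on U (\<lambda>x. f x + g x)" using Suc.prems by (auto intro: continuous_intros)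
    show "C_on n k U (\<lambda>x. partial_deriv i f x + partial_deriv i g x)" if "i < n" for i
      by (rule Suc.IH) (use Suc.prems that in auto)
    show "DERIV (\<lambda>t. f (x(i := t)) + g (x(i := t))) (x i) :> partial_deriv i f x + partial_deriv i g x"
      if "i < n" "x \<in> U" for i x
      by (rule DERIV_add[OF C_on_DERIV[OF Suc.prems(1) that(2,1)] C_on_DERIV[OF Suc.prems(2) that(2,1)]])
  qed
qed

lemma C_on_mult:
  assumes "openin (Euclidean_space n) U" "C_on n k U f" "C_on n k U g"
  shows "C_on n k U (\<lambda>x. f x * g x)"
  using assms(2,3)
proof (induction k arbitrary: f g)
  case 0
  then show ?case by (auto intro: continuous_intros)
next
  case (Suc k)
  show ?case
  proof (rule C_on_SucI[OF assms(1), where f' = "\<lambda>i x. f x * partial_deriv i g x + partial_deriv i f x * g x"])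
    show "continuous_on U (\<lambda>x. f x * g x)" using Suc.prems by (auto intro: continuous_intros)
    show "C_on n k U (\<lambda>x. f x * partial_deriv i g x + partial_deriv i f x * g x)" if "i < n" for i
    proof -
      have "C_on n k U (partial_deriv i f)" "C_on n k U (partial_deriv i g)" using Suc.prems that by auto
      then show ?thesis
        using Suc.prems[THEN C_on_Suc_imp] by (intro C_on_add assms(1) Suc.IH)
    qed
    show "DERIV (\<lambda>t. f (x(i := t)) * g (x(i := t))) (x i) :> f x * partial_deriv i g x + partial_deriv i f x * g x"
      if "i < n" "x \<in> U" for i x
      using DERIV_mult'[OF C_on_DERIV[OF Suc.prems(1) that(2,1)] C_on_DERIV[OF Suc.prems(2) that(2,1)]]
      unfolding fun_upd_triv .
  qed
qed

lemma C_on_sum: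
  assumes "openin (Euclidean_space n) U" "\<And>a. a \<in> A \<Longrightarrow> C_on n k U (f a)"
  shows "C_on n k U (\<lambda>x. \<Sum>a\<in>A. f a x)"
  using assms(2)
proof (induction A rule: infinite_finite_induct)
  case (insert a A)
  have "C_on n k U (\<lambda>x. f a x + (\<Sum>a\<in>A. f a x))" using insert by (intro C_on_add assms(1)) auto
  then show ?case using insert by simp
qed (auto simp: C_on_const)

text \<open>\<open>D\<close> is the whole sequence of derivatives of \<open>D 0\<close>. The chain
  rule leads from \<open>D j\<close> to \<open>D (Suc j)\<close>, so the induction on
  \<open>k\<close> has to be general in \<open>j\<close>.\<close>

lemma C_on_compose_real:
  assumes "openin (Euclidean_space n) U" "C_on n k U f"
    and "\<And>j t. t \<in> f ` U \<Longrightarrow> DERIV (D j) t :> D (Suc j) t"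
  shows "C_on n k U (\<lambda>x. D j (f x))"
  using assms(2)
proof (induction k arbitrary: j)
  case 0
  have "continuous_on (f ` U) (D j)"
    by (intro continuous_at_imp_continuous_on ballI DERIV_isCont[OF assms(3)])
  with 0 show ?case using continuous_on_compose[of U f "D j"] by (auto simp: o_def)
next
  case (Suc k)
  have "continuous_on (f ` U) (D j)"
    by (intro continuous_at_imp_continuous_on ballI DERIV_isCont[OF assms(3)])
  then have "continuous_on U (\<lambda>x. D j (f x))"
    using continuous_on_compose[of U f "D j"] Suc.prems by (auto simp: o_def)
  then show ?case
  proof (rule C_on_SucI[OF assms(1), where f' = "\<lambda>i x. D (Suc j) (f x) * partial_deriv i f x"])
    show "C_on n k U (\<lambda>x. D (Suc j) (f x) * partial_deriv i f x)" if "i < n" for i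
      by (intro C_on_mult assms(1) Suc.IH C_on_Suc_imp[OF Suc.prems]) (use Suc.prems that in auto)
    show "DERIV (\<lambda>t. D j (f (x(i := t)))) (x i) :> D (Suc j) (f x) * partial_deriv i f x"
      if "i < n" "x \<in> U" for i x
      by (rule DERIV_chain2[OF _ C_on_DERIV[OF Suc.prems that(2,1)]]) (use assms(3) that in simp)
  qed
qed

text \<open>For functions known only through a smooth derivative, without a closed form for the
  higher ones: the radius and the angle of the spiral below.\<close>

lemma C_on_compose_antiderivative:
  assumes "openin (Euclidean_space n) U" "C_on n (Suc k) U f" "C_on n k U (\<lambda>x. q (f x))"
    and "\<And>t. t \<in> f ` U \<Longrightarrow> DERIV Q t :> q t"
  shows "C_on n (Suc k) U (\<lambda>x. Q (f x))"
proof -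
  have "continuous_on (f ` U) Q"
    by (intro continuous_at_imp_continuous_on ballI DERIV_isCont[OF assms(4)])
  then have "continuous_on U (\<lambda>x. Q (f x))"
    using continuous_on_compose[of U f Q] assms(2) by (auto simp: o_def)
  then show ?thesis
  proof (rule C_on_SucI[OF assms(1), where f' = "\<lambda>i x. q (f x) * partial_deriv i f x"])
    show "C_on n k U (\<lambda>x. q (f x) * partial_deriv i f x)" if "i < n" for i
      using that assms by (intro C_on_mult) auto
    show "DERIV (\<lambda>t. Q (f (x(i := t)))) (x i) :> q (f x) * partial_deriv i f x"
      if "i < n" "x \<in> U" for i x
      by (rule DERIV_chain2[OF _ C_on_DERIV[OF assms(2) that(2,1)]]) (use assms(4) that in simp)
  qed
qed

text \<open>Corner number \<open>a\<close> of the staircase path from \<open>x\<close> to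
  \<open>y\<close>, which changes one coordinate at a time. It reduces statements about several
  variables to the mean value theorem in one variable.\<close>

definition mix :: "nat \<Rightarrow> (nat \<Rightarrow> real) \<Rightarrow> (nat \<Rightarrow> real) \<Rightarrow> nat \<Rightarrow> real" where
  "mix a x y j = (if j < a then y j else x j)"

lemma mix_0: "mix 0 x y = x" by (auto simp: mix_def)

lemma mix_full: "x \<in> Rn n \<Longrightarrow> y \<in> Rn n \<Longrightarrow> mix n x y = y" by (auto simp: mix_def mem_Rn)

lemma mix_Suc: "mix (Suc a) x y = (mix a x y)(a := y a)" by (auto simp: mix_def)

lemma mix_telescope:
  fixes f :: "(nat \<Rightarrow> real) \<Rightarrow> real"
  assumes "x \<in> Rn n" "y \<in> Rn n"
  shows "f y - f x = (\<Sum>a<n. f ((mix a x y)(a := y a)) - f ((mix a x y)(a := x a)))"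
proof -
  have "(mix a x y)(a := x a) = mix a x y" for a by (auto simp: mix_def)
  then have "(\<Sum>a<n. f ((mix a x y)(a := y a)) - f ((mix a x y)(a := x a))) = (\<Sum>a<n. f (mix (Suc a) x y) - f (mix a x y))"
    by (simp add: mix_Suc)
  also have "\<dots> = f (mix n x y) - f (mix 0 x y)" by (rule sum_lessThan_telescope[of "\<lambda>a. f (mix a x y)"])
  finally show ?thesis using mix_full[OF assms] mix_0[of x y] by simp
qed

lemma mix_MVT:
  assumes "C_on n (Suc k) U f" "a < n"
    and "\<And>t. min (x a) (y a) \<le> t \<Longrightarrow> t \<le> max (x a) (y a) \<Longrightarrow> (mix a x y)(a := t) \<in> U"
  obtains t where "min (x a) (y a) \<le> t" "t \<le> max (x a) (y a)"
    "f ((mix a x y)(a := y a)) - f ((mix a x y)(a := x a)) = (y a - x a) * partial_deriv a f ((mix a x y)(a := t))"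
proof -
  let ?F = "\<lambda>t. f ((mix a x y)(a := t))" and ?F' = "\<lambda>t. partial_deriv a f ((mix a x y)(a := t))"
  have D: "DERIV ?F t :> ?F' t" if "min (x a) (y a) \<le> t" "t \<le> max (x a) (y a)" for t
    using C_on_DERIV[OF assms(1) assms(3)[OF that] assms(2)] by simp
  consider "x a = y a" | "x a < y a" | "y a < x a" by linarith
  then show ?thesis
  proof cases
    case 1
    then show ?thesis using that[of "x a"] by simp
  next
    case 2
    obtain t where "t > x a" "t < y a" "?F (y a) - ?F (x a) = (y a - x a) * ?F' t"
      using MVT2[OF 2, of ?F ?F'] D 2 by force
    then show ?thesis using that[of t] 2 by simp
  next
    case 3
    obtain t where "t > y a" "t < x a" "?F (x a) - ?F (y a) = (x a - y a) * ?F' t"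
      using MVT2[OF 3, of ?F ?F'] D 3 by force
    then show ?thesis using that[of t] 3 by (simp add: algebra_simps)
  qed
qed

text \<open>Differentiability in the form of Caratheodory: the coefficients \<open>q a\<close> are
  difference quotients along the staircase, and the mean value theorem makes each one close to the
  partial derivative. The chain rule then follows from limits of real quotients alone.\<close>

lemma C1_Caratheodory:
  assumes "C_on n (Suc k) U f" "openin (Euclidean_space n) U" "x \<in> U"
  obtains q where
    "\<And>y. y \<in> Rn n \<Longrightarrow> f y - f x = (\<Sum>a<n. q a y * (y a - x a))"
    "\<And>a e. a < n \<Longrightarrow> e > 0 \<Longrightarrow>
       \<exists>\<delta>>0. \<forall>y\<in>Rn n. (\<forall>i<n. \<bar>y i - x i\<bar> < \<delta>) \<longrightarrow> \<bar>q a y - partial_deriv a f x\<bar> < e"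
proof
  \<comment> \<open>A step of length zero contributes nothing to the telescoping sum, so the value
    there is free; the partial derivative is the choice that makes \<open>q a\<close> continuous at
    \<open>x\<close>.\<close>
  define q where "q a y = (if y a = x a then partial_deriv a f x
     else (f ((mix a x y)(a := y a)) - f ((mix a x y)(a := x a))) / (y a - x a))" for a y
  have x: "x \<in> Rn n" using assms openin_subset by blast
  show "f y - f x = (\<Sum>a<n. q a y * (y a - x a))" if "y \<in> Rn n" for y
    unfolding mix_telescope[OF x that, of f] by (rule sum.cong) (auto simp: q_def)
  show "\<exists>\<delta>>0. \<forall>y\<in>Rn n. (\<forall>i<n. \<bar>y i - x i\<bar> < \<delta>) \<longrightarrow> \<bar>q a y - partial_deriv a f x\<bar> < e"
    if a: "a < n" and e: "e > 0" for a e
  proof -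
    have "continuous_on U (partial_deriv a f)" using assms(1) a by (auto dest: C_on_imp_continuous)
    from continuous_on_Euclidean_boxD[OF this assms(2,3) e]
    obtain \<delta> where \<delta>: "\<delta> > 0" "\<And>y. y \<in> Rn n \<Longrightarrow> (\<forall>i<n. \<bar>y i - x i\<bar> < \<delta>) \<Longrightarrow> y \<in> U \<and> \<bar>partial_deriv a f y - partial_deriv a f x\<bar> < e"
      by blast
    have "\<bar>q a y - partial_deriv a f x\<bar> < e" if y: "y \<in> Rn n" "\<forall>i<n. \<bar>y i - x i\<bar> < \<delta>" for y
    proof (cases "y a = x a")
      case True
      then show ?thesis using e by (simp add: q_def)
    next
      case False
      have in_box: "(mix a x y)(a := t) \<in> Rn n \<and> (\<forall>i<n. \<bar>((mix a x y)(a := t)) i - x i\<bar> < \<delta>)"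
        if "min (x a) (y a) \<le> t" "t \<le> max (x a) (y a)" for t
      proof -
        have "\<bar>t - x a\<bar> < \<delta>" using y(2)[rule_format, OF a] that by linarith
        then show ?thesis using x y \<delta>(1) a by (auto simp: mem_Rn mix_def)
      qed
      obtain t where t: "min (x a) (y a) \<le> t" "t \<le> max (x a) (y a)"
        "f ((mix a x y)(a := y a)) - f ((mix a x y)(a := x a)) = (y a - x a) * partial_deriv a f ((mix a x y)(a := t))"
        using mix_MVT[OF assms(1) a, of x y] in_box \<delta>(2) by metis
      then have "q a y = partial_deriv a f ((mix a x y)(a := t))" using False by (simp add: q_def)
      then show ?thesis using \<delta>(2) in_box[OF t(1,2)] by metis
    qed
    then show ?thesis using \<delta>(1) by blast
  qed
qed

lemma C1_curve_chain:
  assumes "C_on n (Suc k) U f" "openin (Euclidean_space n) U" "c t0 \<in> U"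
    and c: "eventually (\<lambda>t. c t \<in> Rn n) (nhds t0)"
    and D: "\<And>a. a < n \<Longrightarrow> DERIV (\<lambda>t. c t a) t0 :> D a"
  shows "DERIV (\<lambda>t. f (c t)) t0 :> (\<Sum>a<n. partial_deriv a f (c t0) * D a)"
proof -
  obtain q where q: "\<And>y. y \<in> Rn n \<Longrightarrow> f y - f (c t0) = (\<Sum>a<n. q a y * (y a - c t0 a))"
    "\<And>a e. a < n \<Longrightarrow> e > 0 \<Longrightarrow>
       \<exists>\<delta>>0. \<forall>y\<in>Rn n. (\<forall>i<n. \<bar>y i - c t0 i\<bar> < \<delta>) \<longrightarrow> \<bar>q a y - partial_deriv a f (c t0)\<bar> < e"
    by (rule C1_Caratheodory[OF assms(1-3)]) blast
  have ev: "eventually (\<lambda>t. c t \<in> Rn n) (at t0)"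
    using c by (auto simp: eventually_at_filter elim: eventually_mono)
  have "((\<lambda>t. q a (c t)) \<longlongrightarrow> partial_deriv a f (c t0)) (at t0)" if a: "a < n" for a
  proof (rule tendstoI)
    fix e :: real assume "e > 0"
    then obtain \<delta> where \<delta>: "\<delta> > 0" "\<forall>y\<in>Rn n. (\<forall>i<n. \<bar>y i - c t0 i\<bar> < \<delta>) \<longrightarrow> \<bar>q a y - partial_deriv a f (c t0)\<bar> < e"
      using q(2) a by blast
    have "eventually (\<lambda>t. \<bar>c t i - c t0 i\<bar> < \<delta>) (at t0)" if "i < n" for i
    proof -
      have "((\<lambda>t. c t i) \<longlongrightarrow> c t0 i) (at t0)" using DERIV_isCont[OF D[OF that]] by (simp add: isCont_def)
      from tendstoD[OF this \<delta>(1)] show ?thesis by (simp add: dist_real_def)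
    qed
    then have "eventually (\<lambda>t. \<forall>i\<in>{..<n}. \<bar>c t i - c t0 i\<bar> < \<delta>) (at t0)"
      by (intro eventually_ball_finite) auto
    with ev show "eventually (\<lambda>t. dist (q a (c t)) (partial_deriv a f (c t0)) < e) (at t0)"
      by eventually_elim (use \<delta> in \<open>auto simp: dist_real_def\<close>)
  qed
  moreover have "((\<lambda>t. (c t a - c t0 a) / (t - t0)) \<longlongrightarrow> D a) (at t0)" if "a < n" for a
    using D[OF that] by (simp add: has_field_derivative_iff)
  ultimately have "((\<lambda>t. \<Sum>a<n. q a (c t) * ((c t a - c t0 a) / (t - t0))) \<longlongrightarrow> (\<Sum>a<n. partial_deriv a f (c t0) * D a)) (at t0)"
    by (intro tendsto_sum tendsto_mult) auto
  moreover have "eventually (\<lambda>t. (\<Sum>a<n. q a (c t) * ((c t a - c t0 a) / (t - t0))) = (f (c t) - f (c t0)) / (t - t0)) (at t0)"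
    using ev by eventually_elim (simp add: q(1) sum_divide_distrib)
  ultimately show ?thesis
    unfolding has_field_derivative_iff by (rule Lim_transform_eventually)
qed

lemma C1_compose_DERIV:
  assumes "C_on k (Suc l) V h" "openin (Euclidean_space k) V" "openin (Euclidean_space n) U"
    and "x \<in> U" "i < n" "f x \<in> V" "\<And>x. x \<in> U \<Longrightarrow> f x \<in> Rn k"
    and "\<And>a. a < k \<Longrightarrow> C_on n (Suc j) U (\<lambda>x. f x a)"
  shows "DERIV (\<lambda>t. h (f (x(i := t)))) (x i) :> (\<Sum>a<k. partial_deriv a h (f x) * partial_deriv i (\<lambda>x. f x a) x)"
proof -
  have "eventually (\<lambda>t. f (x(i := t)) \<in> Rn k) (nhds (x i))"
    using eventually_upd_mem[OF assms(3-5)] by eventually_elim (use assms in blast)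
  from C1_curve_chain[where c = "\<lambda>t. f (x(i := t))", OF assms(1,2) _ this C_on_DERIV[OF assms(8) assms(4,5)]]
  show ?thesis using assms by simp
qed

text \<open>The derivative is a sum of products with factors \<open>partial_deriv a h (f x)\<close>.
  The induction hypothesis applies to them with \<open>h\<close> replaced by its partial derivative
  and \<open>f\<close> unchanged, hence the generalisation over \<open>h\<close>.\<close>

lemma C_on_compose:
  assumes "openin (Euclidean_space k) V" "openin (Euclidean_space n) U"
    and "\<And>x. x \<in> U \<Longrightarrow> f x \<in> V"
    and "C_on k l V h" "\<And>a. a < k \<Longrightarrow> C_on n l U (\<lambda>x. f x a)"
  shows "C_on n l U (\<lambda>x. h (f x))"
  using assms(4,5)
proof (induction l arbitrary: h)
  case 0
  have V: "V \<subseteq> Rn k" using assms(1) openin_subset by blast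
  \<comment> \<open>Continuity in the product topology concerns all coordinates, also those from
    \<open>k\<close> on; these vanish because \<open>f x\<close> lies in
    \<open>Rn k\<close>.\<close>
  have "continuous_on U (\<lambda>x. f x a)" for a
  proof (cases "a < k")
    case True
    then show ?thesis using 0 by simp
  next
    case False
    then have "f x a = 0" if "x \<in> U" for x using assms(3)[OF that] V by (auto simp: mem_Rn)
    then show ?thesis using continuous_on_cong[of U U "\<lambda>x. f x a" "\<lambda>x. 0"] by simp
  qed
  then have "continuous_on U f" by (rule continuous_on_coordinatewise_then_product)
  then show ?case using continuous_on_compose2[of V h U f] 0 assms(3) by auto
next
  case (Suc l)
  have cf: "C_on k l V h" "\<And>a. a < k \<Longrightarrow> C_on n l U (\<lambda>x. f x a)"
    using Suc.prems C_on_Suc_imp by blast+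
  have "continuous_on U (\<lambda>x. h (f x))" using Suc.IH[OF cf] C_on_imp_continuous by blast
  then show ?case
  proof (rule C_on_SucI[OF assms(2), where f' = "\<lambda>i x. \<Sum>a<k. partial_deriv a h (f x) * partial_deriv i (\<lambda>x. f x a) x"])
    fix i assume i: "i < n"
    show "C_on n l U (\<lambda>x. \<Sum>a<k. partial_deriv a h (f x) * partial_deriv i (\<lambda>x. f x a) x)"
    proof (rule C_on_sum[OF assms(2)], rule C_on_mult[OF assms(2)])
      fix a assume a: "a \<in> {..<k}"
      then have "C_on k l V (partial_deriv a h)" using Suc.prems(1) by simp
      then show "C_on n l U (\<lambda>x. partial_deriv a h (f x))" by (rule Suc.IH) (rule cf(2))
      show "C_on n l U (partial_deriv i (\<lambda>x. f x a))" using Suc.prems(2)[of a] a i by simp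
    qed
    fix x assume x: "x \<in> U"
    show "DERIV (\<lambda>t. h (f (x(i := t)))) (x i) :> (\<Sum>a<k. partial_deriv a h (f x) * partial_deriv i (\<lambda>x. f x a) x)"
    proof (rule C1_compose_DERIV[OF Suc.prems(1) assms(1,2) x i])
      show "f x \<in> V" using assms(3) x by blast
      show "f x \<in> Rn k" if "x \<in> U" for x using assms(3)[OF that] openin_subset[OF assms(1)] by blast
    qed (rule Suc.prems(2))
  qed
qed

lemma partial_deriv_compose:
  assumes "smooth_on k V h" "openin (Euclidean_space k) V" "openin (Euclidean_space n) U"
    and "x \<in> U" "i < n" "f x \<in> V" "\<And>x. x \<in> U \<Longrightarrow> f x \<in> Rn k"
    and "\<And>a. a < k \<Longrightarrow> smooth_on n U (\<lambda>x. f x a)"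
  shows "partial_deriv i (\<lambda>x. h (f x)) x = (\<Sum>a<k. partial_deriv a h (f x) * partial_deriv i (\<lambda>x. f x a) x)"
proof (rule partial_deriv_eqI, rule C1_compose_DERIV[where l = 0 and j = 0 and f = f])
  show "C_on k (Suc 0) V h" using assms(1) unfolding smooth_on_def by blast
  show "C_on n (Suc 0) U (\<lambda>x. f x a)" if "a < k" for a using assms(8)[OF that] unfolding smooth_on_def by blast
qed (use assms in auto)

lemma smooth_on_DERIV:
  "smooth_on n U f \<Longrightarrow> x \<in> U \<Longrightarrow> i < n \<Longrightarrow> DERIV (\<lambda>t. f (x(i := t))) (x i) :> partial_deriv i f x"
  unfolding smooth_on_def using C_on_DERIV by blast

lemma smooth_on_partial:
  assumes "smooth_on n U f" "i < n"
  shows "smooth_on n U (partial_deriv i f)"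
  unfolding smooth_on_def
proof
  fix k
  have *: "\<forall>k. C_on n k U f" "i < n" using assms by (auto simp only: smooth_on_def)
  then have "C_on n (Suc k) U f" by blast
  then show "C_on n k U (partial_deriv i f)" using *(2) by simp
qed

lemma smooth_on_local:
  assumes "openin (Euclidean_space k) U"
    and "\<And>x. x \<in> U \<Longrightarrow> \<exists>V g. openin (Euclidean_space k) V \<and> x \<in> V \<and> smooth_on k V g \<and> (\<forall>y\<in>V. f y = g y)"
  shows "smooth_on k U f"
  unfolding smooth_on_def
proof
  fix l
  show "C_on k l U f"
  proof (rule C_on_local[OF assms(1)])
    fix x assume "x \<in> U"
    then obtain V g where V: "openin (Euclidean_space k) V" "x \<in> V" "smooth_on k V g" "\<forall>y\<in>V. f y = g y"
      using assms(2) by blast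
    have "C_on k l V f"
      by (rule C_on_cong[OF V(1), of g]) (use V(3,4) in \<open>auto simp only: smooth_on_def\<close>)
    then show "\<exists>V. openin (Euclidean_space k) V \<and> x \<in> V \<and> C_on k l V f" using V by blast
  qed
qed

lemma smooth_on_subset: "smooth_on k U f \<Longrightarrow> V \<subseteq> U \<Longrightarrow> smooth_on k V f"
  unfolding smooth_on_def using C_on_subset by blast

lemma smooth_on_compose:
  assumes "openin (Euclidean_space k) V" "openin (Euclidean_space n) U"
    and "\<And>x. x \<in> U \<Longrightarrow> f x \<in> V"
    and "smooth_on k V h" "\<And>a. a < k \<Longrightarrow> smooth_on n U (\<lambda>x. f x a)"
  shows "smooth_on n U (\<lambda>x. h (f x))"
  unfolding smooth_on_def
  by (intro allI, rule C_on_compose[OF assms(1-3)]) (use assms(4,5) in \<open>auto simp only: smooth_on_def\<close>)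

lemma smooth_on_compose_antiderivative:
  assumes "openin (Euclidean_space n) U" "smooth_on n U f" "smooth_on n U (\<lambda>x. q (f x))"
    and "\<And>t. t \<in> f ` U \<Longrightarrow> DERIV Q t :> q t"
  shows "smooth_on n U (\<lambda>x. Q (f x))"
  unfolding smooth_on_def
proof
  fix k
  have "C_on n (Suc k) U (\<lambda>x. Q (f x))"
    using assms(2,3) by (intro C_on_compose_antiderivative[OF assms(1) _ _ assms(4)]) (auto simp only: smooth_on_def)
  then show "C_on n k U (\<lambda>x. Q (f x))" by (rule C_on_Suc_imp)
qed

lemma compact_Euclidean_box: "compact {x \<in> Rn n. \<forall>i<n. \<bar>x i\<bar> \<le> r}"
proof -
  have "{x \<in> Rn n. \<forall>i<n. \<bar>x i\<bar> \<le> r} = (\<Pi>\<^sub>E (i::nat)\<in>UNIV. if i < n then {-r..r} else {0::real})" (is "_ = ?K")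
  proof (rule Set.set_eqI)
    fix x :: "nat \<Rightarrow> real"
    have "x \<in> ?K \<longleftrightarrow> (\<forall>i. x i \<in> (if i < n then {-r..r} else {0::real}))"
      by (simp only: PiE_UNIV_domain Pi_iff ball_UNIV)
    also have "\<dots> \<longleftrightarrow> (\<forall>i. (i < n \<longrightarrow> \<bar>x i\<bar> \<le> r) \<and> (i \<ge> n \<longrightarrow> x i = 0))"
      by (intro all_cong1) (auto simp: abs_le_iff)
    finally show "x \<in> {x \<in> Rn n. \<forall>i<n. \<bar>x i\<bar> \<le> r} \<longleftrightarrow> x \<in> ?K" unfolding mem_Rn mem_Collect_eq by blast
  qed
  moreover have "compactin (powertop_real UNIV) ?K" by (subst compactin_PiE) auto
  ultimately show ?thesis by (simp add: euclidean_product_topology)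
qed

text \<open>The staircase between two points of a box stays in the box, so the maxima of the partial
  derivatives over this compact set add up to a Lipschitz constant for the maximum norm.\<close>

lemma C1_Lipschitz:
  assumes "C_on n (Suc k) (Rn n) f"
  obtains L where "L \<ge> 0" "\<And>x y d. x \<in> Rn n \<Longrightarrow> y \<in> Rn n \<Longrightarrow> (\<forall>i<n. \<bar>x i\<bar> \<le> r) \<Longrightarrow> (\<forall>i<n. \<bar>y i\<bar> \<le> r) \<Longrightarrow>
     (\<forall>i<n. \<bar>y i - x i\<bar> \<le> d) \<Longrightarrow> \<bar>f y - f x\<bar> \<le> L * d"
proof -
  define K where "K = {x \<in> Rn n. \<forall>i<n. \<bar>x i\<bar> \<le> r}"
  have K: "x \<in> K \<longleftrightarrow> x \<in> Rn n \<and> (\<forall>i<n. \<bar>x i\<bar> \<le> r)" for x by (simp only: K_def mem_Collect_eq)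
  have "compact K" unfolding K_def by (rule compact_Euclidean_box)
  have "\<exists>B. \<forall>x\<in>K. \<bar>partial_deriv a f x\<bar> \<le> B" if "a < n" for a
  proof -
    have "continuous_on K (partial_deriv a f)"
      by (rule continuous_on_subset[of "Rn n"]) (use assms that C_on_imp_continuous K in auto)
    then have "compact (partial_deriv a f ` K)" using \<open>compact K\<close> compact_continuous_image by blast
    then show ?thesis using compact_imp_bounded bounded_iff by (metis image_eqI real_norm_def)
  qed
  then obtain B where B: "\<And>a x. a < n \<Longrightarrow> x \<in> K \<Longrightarrow> \<bar>partial_deriv a f x\<bar> \<le> B a" by metis
  show ?thesis
  proof (rule that[of "\<Sum>a<n. \<bar>B a\<bar>"])
    show "0 \<le> (\<Sum>a<n. \<bar>B a\<bar>)" by (simp add: sum_nonneg)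
    fix x y d assume x: "x \<in> Rn n" "\<forall>i<n. \<bar>x i\<bar> \<le> r" and y: "y \<in> Rn n" "\<forall>i<n. \<bar>y i\<bar> \<le> r"
      and d: "\<forall>i<n. \<bar>y i - x i\<bar> \<le> d"
    have "\<bar>f ((mix a x y)(a := y a)) - f ((mix a x y)(a := x a))\<bar> \<le> \<bar>B a\<bar> * d" if a: "a < n" for a
    proof -
      have inK: "(mix a x y)(a := t) \<in> K" if "min (x a) (y a) \<le> t" "t \<le> max (x a) (y a)" for t
      proof -
        have "\<bar>t\<bar> \<le> r" using that x(2)[rule_format, OF a] y(2)[rule_format, OF a] by linarith
        then show ?thesis using x y a unfolding K by (auto simp: mem_Rn mix_def)
      qed
      obtain t where t: "min (x a) (y a) \<le> t" "t \<le> max (x a) (y a)"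
        "f ((mix a x y)(a := y a)) - f ((mix a x y)(a := x a)) = (y a - x a) * partial_deriv a f ((mix a x y)(a := t))"
        using mix_MVT[OF assms a, of x y] inK K by metis
      have "\<bar>y a - x a\<bar> * \<bar>partial_deriv a f ((mix a x y)(a := t))\<bar> \<le> d * \<bar>B a\<bar>"
        using d a B[OF a inK[OF t(1,2)]] by (intro mult_mono) (auto simp: order_trans[OF abs_ge_zero])
      then show ?thesis using t(3) by (simp add: abs_mult mult.commute)
    qed
    then have "\<bar>f y - f x\<bar> \<le> (\<Sum>a<n. \<bar>B a\<bar> * d)"
      unfolding mix_telescope[OF x(1) y(1), of f] by (intro order_trans[OF sum_abs] sum_mono) auto
    then show "\<bar>f y - f x\<bar> \<le> (\<Sum>a<n. \<bar>B a\<bar>) * d" by (simp add: sum_distrib_right)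
  qed
qed

section \<open>A bump function and a bounded spiral\<close>

text \<open>The classical function that is flat at 0. It is nonzero exactly for
  \<open>t > 0\<close>, so weights built from it are nonzero exactly on open sublevel sets.\<close>

definition bump :: "real \<Rightarrow> real" where
  "bump t = (if t > 0 then exp (- (1 / t)) else 0)"

lemma poly_exp_tendsto_0: "((\<lambda>s. poly p s * exp (- s)) \<longlongrightarrow> (0::real)) at_top"
proof -
  have "((\<lambda>s. \<Sum>i\<le>degree p. Polynomial.coeff p i * (s ^ i / exp s)) \<longlongrightarrow> (\<Sum>i\<le>degree p. Polynomial.coeff p i * 0)) at_top"
    by (intro tendsto_sum tendsto_mult tendsto_const tendsto_power_div_exp_0)
  moreover have "(\<Sum>i\<le>degree p. Polynomial.coeff p i * (s ^ i / exp s)) = poly p s * exp (- s)" for s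
    by (simp add: poly_altdef sum_distrib_right exp_minus divide_inverse mult.assoc)
  ultimately show ?thesis by simp
qed

text \<open>The functions \<open>p (1 / t) exp (- 1 / t)\<close>, extended by 0, are closed under
  differentiation: in the variable \<open>s = 1 / t\<close>, the derivative replaces
  \<open>p\<close> by \<open>s^2 (p - p')\<close>. So one lemma covers all orders.\<close>

lemma bump_derivative_aux:
  fixes p :: "real poly"
  defines "f \<equiv> \<lambda>p t. if t > 0 then poly p (1 / t) * exp (- (1 / t)) else (0::real)"
  shows "DERIV (f p) t :> f ([:0, 0, 1:] * (p - pderiv p)) t"
proof -
  consider "t > 0" | "t < 0" | "t = 0" by linarith
  then show ?thesis
  proof cases
    case 1
    have "DERIV (\<lambda>t. poly p (1 / t) * exp (- (1 / t))) t :>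
        poly (pderiv p) (1 / t) * (- (1 / t\<^sup>2)) * exp (- (1 / t)) + exp (- (1 / t)) * (1 / t\<^sup>2) * poly p (1 / t)"
      using 1 by (auto intro!: derivative_eq_intros DERIV_chain2[OF poly_DERIV] simp: power2_eq_square divide_inverse)
    also have "poly (pderiv p) (1 / t) * (- (1 / t\<^sup>2)) * exp (- (1 / t)) + exp (- (1 / t)) * (1 / t\<^sup>2) * poly p (1 / t)
        = f ([:0, 0, 1:] * (p - pderiv p)) t"
      using 1 by (simp add: f_def power2_eq_square algebra_simps)
    finally have *: "DERIV (\<lambda>t. poly p (1 / t) * exp (- (1 / t))) t :> f ([:0, 0, 1:] * (p - pderiv p)) t" .
    have "eventually (\<lambda>t. t > 0) (nhds t)" using 1 by (intro eventually_nhds_in_open[of "{0<..}", simplified]) auto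
    then have "eventually (\<lambda>t. f p t = poly p (1 / t) * exp (- (1 / t))) (nhds t)"
      by eventually_elim (simp add: f_def)
    from DERIV_cong_ev[OF refl this refl] * show ?thesis by blast
  next
    case 2
    have "eventually (\<lambda>t. t < 0) (nhds t)" using 2 by (intro eventually_nhds_in_open[of "{..<0}", simplified]) auto
    then have ev: "eventually (\<lambda>t. f p t = 0) (nhds t)"
      by eventually_elim (simp add: f_def)
    have "DERIV (\<lambda>t. 0) t :> f ([:0, 0, 1:] * (p - pderiv p)) t" using 2 by (simp add: f_def)
    with DERIV_cong_ev[OF refl ev refl] show ?thesis by blast
  next
    case 3
    \<comment> \<open>This is the difference quotient at 0 from the right: division by
      \<open>t\<close> multiplies the polynomial in \<open>1 / t\<close> by its variable, and the
      exponential still wins.\<close>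
    have "((\<lambda>t. poly ([:0,1:] * p) (inverse t) * exp (- inverse t)) \<longlongrightarrow> 0) (at_right 0)"
      using filterlim_compose[OF poly_exp_tendsto_0 filterlim_inverse_at_top_right] .
    moreover have "eventually (\<lambda>t. poly ([:0,1:] * p) (inverse t) * exp (- inverse t) = (f p t - f p 0) / (t - 0)) (at_right 0)"
      by (auto simp: eventually_at_filter f_def divide_inverse mult_ac)
    ultimately have r: "((\<lambda>t. (f p t - f p 0) / (t - 0)) \<longlongrightarrow> 0) (at_right 0)"
      by (rule Lim_transform_eventually)
    have "eventually (\<lambda>t. 0 = (f p t - f p 0) / (t - 0)) (at_left 0)"
      by (auto simp: eventually_at_filter f_def)
    then have l: "((\<lambda>t. (f p t - f p 0) / (t - 0)) \<longlongrightarrow> 0) (at_left 0)"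
      by (rule Lim_transform_eventually[OF tendsto_const])
    have "((\<lambda>t. (f p t - f p 0) / (t - 0)) \<longlongrightarrow> 0) (at 0)" using l r by (simp add: filterlim_split_at)
    moreover have "f ([:0, 0, 1:] * (p - pderiv p)) 0 = 0" by (simp add: f_def)
    ultimately show ?thesis unfolding has_field_derivative_iff 3 by simp
  qed
qed

lemma smooth_on_bump:
  assumes "openin (Euclidean_space n) U" "smooth_on n U f"
  shows "smooth_on n U (\<lambda>x. bump (f x))"
proof -
  define P :: "nat \<Rightarrow> real poly" where "P = rec_nat 1 (\<lambda>_ p. [:0, 0, 1:] * (p - pderiv p))"
  define D where "D j = (\<lambda>t. if t > 0 then poly (P j) (1 / t) * exp (- (1 / t)) else (0::real))" for j
  have "DERIV (D j) t :> D (Suc j) t" for j t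
  proof -
    have "P (Suc j) = [:0, 0, 1:] * (P j - pderiv (P j))" by (simp add: P_def)
    then show ?thesis using bump_derivative_aux[of "P j" t] unfolding D_def by (simp only:)
  qed
  then have "C_on n k U (\<lambda>x. D 0 (f x))" for k
    using assms(2)
    by - (rule C_on_compose_real[where D = D and f = f, OF assms(1)], auto simp only: smooth_on_def)
  moreover have "D 0 = bump" by (auto simp: D_def P_def bump_def)
  ultimately show ?thesis by (simp add: smooth_on_def)
qed

lemma smooth_on_inverse:
  assumes "openin (Euclidean_space n) U" "smooth_on n U f" "\<And>x. x \<in> U \<Longrightarrow> f x \<noteq> 0"
  shows "smooth_on n U (\<lambda>x. inverse (f x))"
proof -
  define D where "D j = (\<lambda>t. (-1) ^ j * fact j * inverse t ^ Suc j :: real)" for j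
  have "DERIV (D j) t :> D (Suc j) t" if "t \<noteq> 0" for j t
  proof -
    have "DERIV (\<lambda>t. (-1) ^ j * fact j * inverse t ^ Suc j) t :>
        (-1) ^ j * fact j * (real (Suc j) * (- (inverse t ^ Suc (Suc 0)) * inverse t ^ (Suc j - Suc 0)))"
      by (intro DERIV_cmult DERIV_power DERIV_inverse that)
    moreover have "(-1) ^ j * fact j * (real (Suc j) * (- (inverse t ^ Suc (Suc 0)) * inverse t ^ (Suc j - Suc 0))) = D (Suc j) t"
      by (simp add: D_def algebra_simps)
    ultimately show ?thesis unfolding D_def by metis
  qed
  then have "C_on n k U (\<lambda>x. D 0 (f x))" for k
    using assms(2,3)
    by - (rule C_on_compose_real[where D = D and f = f, OF assms(1)], auto simp only: smooth_on_def)
  then show ?thesis by (simp add: smooth_on_def D_def)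
qed

lemma smooth_on_exp:
  assumes "openin (Euclidean_space n) U" "smooth_on n U f"
  shows "smooth_on n U (\<lambda>x. exp (f x))"
  unfolding smooth_on_def
  by (intro allI C_on_compose_real[where D = "\<lambda>_. exp" and f = f, OF assms(1)] DERIV_exp)
    (use assms(2) in \<open>auto simp only: smooth_on_def\<close>)

lemma smooth_on_cos:
  assumes "openin (Euclidean_space n) U" "smooth_on n U f"
  shows "smooth_on n U (\<lambda>x. cos (f x))"
proof -
  define D where "D j = (\<lambda>t. cos (t + real j * (pi / 2)))" for j
  have "DERIV (D j) t :> D (Suc j) t" for j t
  proof -
    have "t + real (Suc j) * (pi / 2) = (t + real j * (pi / 2)) + pi / 2" by (simp add: algebra_simps)
    then have "D (Suc j) t = - sin (t + real j * (pi / 2))"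
      unfolding D_def using cos_add[of "t + real j * (pi / 2)" "pi / 2"] by (simp only: cos_pi_half sin_pi_half mult_zero_right diff_0 mult_1_right)
    moreover have "DERIV (D j) t :> - sin (t + real j * (pi / 2))"
      unfolding D_def by (auto intro!: derivative_eq_intros)
    ultimately show ?thesis by (simp only:)
  qed
  then have "C_on n k U (\<lambda>x. D 0 (f x))" for k
    using assms(2)
    by - (rule C_on_compose_real[where D = D and f = f, OF assms(1)], auto simp only: smooth_on_def)
  then show ?thesis by (simp add: smooth_on_def D_def)
qed

lemma smooth_on_const: "smooth_on n U (\<lambda>x. c)"
  by (simp add: smooth_on_def C_on_const)

lemma smooth_on_add:
  "openin (Euclidean_space n) U \<Longrightarrow> smooth_on n U f \<Longrightarrow> smooth_on n U g \<Longrightarrow> smooth_on n U (\<lambda>x. f x + g x)"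
  by (simp add: smooth_on_def C_on_add)

lemma smooth_on_mult:
  "openin (Euclidean_space n) U \<Longrightarrow> smooth_on n U f \<Longrightarrow> smooth_on n U g \<Longrightarrow> smooth_on n U (\<lambda>x. f x * g x)"
  by (simp add: smooth_on_def C_on_mult)

lemma smooth_on_diff:
  assumes "openin (Euclidean_space n) U" "smooth_on n U f" "smooth_on n U g"
  shows "smooth_on n U (\<lambda>x. f x - g x)"
  using smooth_on_add[OF assms(1,2) smooth_on_mult[OF assms(1) smooth_on_const[of n U "-1"] assms(3)]] by simp

lemma smooth_on_sum:
  "openin (Euclidean_space n) U \<Longrightarrow> (\<And>a. a \<in> A \<Longrightarrow> smooth_on n U (f a)) \<Longrightarrow> smooth_on n U (\<lambda>x. \<Sum>a\<in>A. f a x)"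
  by (simp add: smooth_on_def C_on_sum)

lemma smooth_on_sin:
  assumes "openin (Euclidean_space n) U" "smooth_on n U f"
  shows "smooth_on n U (\<lambda>x. sin (f x))"
proof -
  have "smooth_on n U (\<lambda>x. cos (f x - pi / 2))"
    by (intro smooth_on_cos smooth_on_diff smooth_on_const assms)
  then show ?thesis by (simp add: cos_diff)
qed

text \<open>
  In polar coordinates the spiral has radius \<open>r t = 1 + 2 arctan (exp t)\<close>.  Since \<open>r' t = sech t\<close>, unit
  speed means that the angle has derivative \<open>- tanh t / r t\<close>, up to sign.  The radius recovers the parameter.
\<close>

lemma bounded_spiral:
  obtains p q r p' q' :: "real \<Rightarrow> real" where
    "\<And>n U f. openin (Euclidean_space n) U \<Longrightarrow> smooth_on n U f \<Longrightarrow> smooth_on n U (\<lambda>x. p (f x))"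
    "\<And>n U f. openin (Euclidean_space n) U \<Longrightarrow> smooth_on n U f \<Longrightarrow> smooth_on n U (\<lambda>x. q (f x))"
    "\<And>t. DERIV p t :> p' t" "\<And>t. DERIV q t :> q' t" "\<And>t. (p' t)\<^sup>2 + (q' t)\<^sup>2 = 1"
    "\<And>t. (p t)\<^sup>2 + (q t)\<^sup>2 = (r t)\<^sup>2" "strict_mono r" "\<And>t. 0 < r t" "\<And>t. r t < 5"
proof -
  define r where "r t = 1 + 2 * arctan (exp t)" for t
  \<comment> \<open>\<open>a\<close> is sech and \<open>b\<close> is - tanh, written with
    \<open>exp\<close> so that their smoothness follows from the closure rules.\<close>
  define a where "a t = 2 * exp t * inverse (1 + exp t * exp t)" for t :: real
  define b where "b t = (1 - exp t * exp t) * inverse (1 + exp t * exp t)" for t :: real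
  have pos: "1 + exp t * exp t \<noteq> 0" for t :: real
    using mult_pos_pos[OF exp_gt_zero exp_gt_zero, of t t] by linarith
  have ab: "(a t)\<^sup>2 + (b t)\<^sup>2 = 1" for t
    using pos[of t] by (simp add: a_def b_def power2_eq_square divide_simps) (simp add: algebra_simps)
  \<comment> \<open>As \<open>arctan\<close> of a positive number lies between 0 and
    \<open>pi / 2\<close>, the radius lies between 1 and \<open>1 + pi\<close>, and
    \<open>pi < 4\<close>.\<close>
  have r: "0 < r t" "r t < 5" for t
    using arctan_ubound[of "exp t"] pi_less_4 by (auto simp: r_def add_pos_pos)
  have dr: "DERIV r t :> a t" for t
    unfolding r_def a_def using pos[of t]
    by (auto intro!: derivative_eq_intros simp: power2_eq_square divide_inverse)
  have "strict_mono r" unfolding r_def strict_mono_def by (simp add: arctan_less_iff)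
  have "isCont (\<lambda>t. b t * inverse (r t)) t" for t
    unfolding b_def using pos[of t] r(1)[of t] DERIV_isCont[OF dr] by (intro continuous_intros) auto
  \<comment> \<open>The angle is only known to exist, as an antiderivative of a continuous
    function.\<close>
  then have "\<exists>F. \<forall>t. -\<infinity> < ereal t \<longrightarrow> ereal t < \<infinity> \<longrightarrow> (F has_vector_derivative b t * inverse (r t)) (at t)"
    by (intro einterval_antiderivative) auto
  then obtain \<theta> where \<theta>: "\<And>t. DERIV \<theta> t :> b t * inverse (r t)"
    by (auto simp: has_real_derivative_iff_has_vector_derivative)
  show ?thesis
  proof (rule that[of "\<lambda>t. r t * cos (\<theta> t)" "\<lambda>t. r t * sin (\<theta> t)"
        "\<lambda>t. a t * cos (\<theta> t) - b t * sin (\<theta> t)" "\<lambda>t. a t * sin (\<theta> t) + b t * cos (\<theta> t)" r])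
    fix n U and f :: "(nat \<Rightarrow> real) \<Rightarrow> real"
    assume U: "openin (Euclidean_space n) U" and f: "smooth_on n U f"
    have sa: "smooth_on n U (\<lambda>x. a (f x))" and sb: "smooth_on n U (\<lambda>x. b (f x))"
      unfolding a_def b_def
      by (intro smooth_on_mult smooth_on_inverse smooth_on_diff smooth_on_add smooth_on_const smooth_on_exp U f pos)+
    have sr: "smooth_on n U (\<lambda>x. r (f x))"
      by (rule smooth_on_compose_antiderivative[OF U f sa dr])
    have "smooth_on n U (\<lambda>x. \<theta> (f x))"
      by (rule smooth_on_compose_antiderivative[OF U f _ \<theta>])
        (intro smooth_on_mult smooth_on_inverse U sb sr, use r in \<open>auto simp: less_imp_neq[symmetric]\<close>)
    with U sr show "smooth_on n U (\<lambda>x. r (f x) * cos (\<theta> (f x)))" "smooth_on n U (\<lambda>x. r (f x) * sin (\<theta> (f x)))"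
      by (auto intro!: smooth_on_mult smooth_on_cos smooth_on_sin)
  next
    fix t
    have rt: "r t \<noteq> 0" using r(1)[of t] by simp
    show "DERIV (\<lambda>t. r t * cos (\<theta> t)) t :> a t * cos (\<theta> t) - b t * sin (\<theta> t)"
      using rt by (auto intro!: derivative_eq_intros dr \<theta>)
    show "DERIV (\<lambda>t. r t * sin (\<theta> t)) t :> a t * sin (\<theta> t) + b t * cos (\<theta> t)"
      using rt by (auto intro!: derivative_eq_intros dr \<theta>)
    have alg: "(A * C - B * S)\<^sup>2 + (A * S + B * C)\<^sup>2 = (A\<^sup>2 + B\<^sup>2) * (S\<^sup>2 + C\<^sup>2)" for A B C S :: real
      by (simp add: power2_eq_square algebra_simps)
    have "(a t * cos (\<theta> t) - b t * sin (\<theta> t))\<^sup>2 + (a t * sin (\<theta> t) + b t * cos (\<theta> t))\<^sup>2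
        = ((a t)\<^sup>2 + (b t)\<^sup>2) * ((sin (\<theta> t))\<^sup>2 + (cos (\<theta> t))\<^sup>2)"
      by (rule alg)
    then show "(a t * cos (\<theta> t) - b t * sin (\<theta> t))\<^sup>2 + (a t * sin (\<theta> t) + b t * cos (\<theta> t))\<^sup>2 = 1"
      by (simp add: ab)
    have "(r t * cos (\<theta> t))\<^sup>2 + (r t * sin (\<theta> t))\<^sup>2 = (r t)\<^sup>2 * ((sin (\<theta> t))\<^sup>2 + (cos (\<theta> t))\<^sup>2)"
      by (simp only: power_mult_distrib distrib_left add.commute)
    then show "(r t * cos (\<theta> t))\<^sup>2 + (r t * sin (\<theta> t))\<^sup>2 = (r t)\<^sup>2" by simp
  qed (use r \<open>strict_mono r\<close> in auto)
qed


section \<open>Isometries of Euclidean space\<close>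

lemma euclid_dist_sym: "euclid_dist m x y = euclid_dist m y x"
  unfolding euclid_dist_def L2_set_def by (simp add: power2_commute)

lemma euclid_dist_triangle: "euclid_dist m x z \<le> euclid_dist m x y + euclid_dist m y z"
  using L2_set_triangle_ineq[of "\<lambda>i. x i - y i" "\<lambda>i. y i - z i" "{..<m}"] by (simp add: euclid_dist_def)

lemma euclid_dist_nonneg: "0 \<le> euclid_dist m x y"
  by (simp add: euclid_dist_def)

lemma euclid_dist_sq: "(euclid_dist m x y)\<^sup>2 = (\<Sum>i<m. (x i - y i)\<^sup>2)"
  by (simp add: euclid_dist_def L2_set_def sum_nonneg)

lemma euclid_dist_same [simp]: "euclid_dist m x x = 0"
  by (simp add: euclid_dist_def L2_set_def)

lemma euclid_dist_eq_0: "x \<in> Rn m \<Longrightarrow> y \<in> Rn m \<Longrightarrow> euclid_dist m x y = 0 \<longleftrightarrow> x = y"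
proof -
  assume *: "x \<in> Rn m" "y \<in> Rn m"
  have "euclid_dist m x y = 0 \<longleftrightarrow> (\<forall>i<m. x i = y i)"
    unfolding euclid_dist_def by (subst L2_set_eq_0_iff) auto
  also have "\<dots> \<longleftrightarrow> (\<forall>i. x i = y i)"
    using * unfolding mem_Rn by (metis leI)
  finally show ?thesis by (simp add: fun_eq_iff)
qed

lemma coord_le_euclid_dist: "i < m \<Longrightarrow> \<bar>x i - y i\<bar> \<le> euclid_dist m x y"
  unfolding euclid_dist_def using member_le_L2_set[of "{..<m}" i "\<lambda>i. \<bar>x i - y i\<bar>"] by (simp add: L2_set_def)

lemma euclid_dist_le: "(\<And>i. i < m \<Longrightarrow> \<bar>x i - y i\<bar> \<le> d) \<Longrightarrow> euclid_dist m x y \<le> real m * d"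
  unfolding euclid_dist_def
  by (rule order_trans[OF L2_set_le_sum_abs]) (use sum_bounded_above[of "{..<m}" "\<lambda>i. \<bar>x i - y i\<bar>" d] in auto)

lemma zero_in_Rn [simp]: "(\<lambda>i. 0) \<in> Rn m"
  by (simp add: mem_Rn)

text \<open>After subtraction of the image of the origin, the map \<open>F\<close> preserves norms
  and distances, hence inner products by polarisation. It sends the standard basis to an orthonormal
  system and is determined by it.\<close>

lemma isometry_affine:
  assumes f: "\<And>y. y \<in> Rn m \<Longrightarrow> f y \<in> Rn m"
    and d: "\<And>x y. x \<in> Rn m \<Longrightarrow> y \<in> Rn m \<Longrightarrow> euclid_dist m (f x) (f y) = euclid_dist m x y"
  obtains A b where "\<And>y k. y \<in> Rn m \<Longrightarrow> k < m \<Longrightarrow> f y k = b k + (\<Sum>l<m. A k l * y l)"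
    "\<And>i j. i < m \<Longrightarrow> j < m \<Longrightarrow> (\<Sum>k<m. A k i * A k j) = (if i = j then 1 else 0)"
proof -
  define e where "e l = (\<lambda>i. if i = l then 1 else (0::real))" for l :: nat
  define F where "F y k = f y k - f (\<lambda>i. 0) k" for y k
  have e: "e l \<in> Rn m" if "l < m" for l using that by (auto simp: e_def mem_Rn)
  have sq: "(\<Sum>k<m. (F x k - F y k)\<^sup>2) = (\<Sum>k<m. (x k - y k)\<^sup>2)" if "x \<in> Rn m" "y \<in> Rn m" for x y
    using d[OF that] euclid_dist_sq[of m "f x" "f y"] euclid_dist_sq[of m x y] by (simp add: F_def)
  have F0: "F (\<lambda>i. 0) = (\<lambda>k. 0)" by (simp add: F_def fun_eq_iff)
  have sq0: "(\<Sum>k<m. (F x k)\<^sup>2) = (\<Sum>k<m. (x k)\<^sup>2)" if "x \<in> Rn m" for x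
    using sq[OF that zero_in_Rn] by (simp add: F0)
  have polar: "(\<Sum>k<m. (x k - y k)\<^sup>2) = (\<Sum>k<m. (x k)\<^sup>2) + (\<Sum>k<m. (y k)\<^sup>2) - 2 * (\<Sum>k<m. x k * y k)" for x y :: "nat \<Rightarrow> real"
    by (simp add: power2_diff sum.distrib sum_subtractf sum_distrib_left mult.assoc)
  have ip: "(\<Sum>k<m. F x k * F y k) = (\<Sum>k<m. x k * y k)" if "x \<in> Rn m" "y \<in> Rn m" for x y
    using sq[OF that] sq0[OF that(1)] sq0[OF that(2)] polar[of "F x" "F y"] polar[of x y] by linarith
  have ipe: "(\<Sum>k<m. F x k * F (e l) k) = x l" if "x \<in> Rn m" "l < m" for x l
  proof -
    have "(\<Sum>k<m. x k * e l k) = (\<Sum>k<m. if k = l then x k else 0)" by (rule sum.cong) (auto simp: e_def)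
    then show ?thesis using that by (simp add: ip e)
  qed
  \<comment> \<open>The linear candidate for \<open>F\<close>. The norms of \<open>F y\<close> and
    \<open>z y\<close> and their inner product are all governed by \<open>|y|^2\<close>, so
    \<open>|F y - z y|^2\<close> expands to \<open>|y|^2 + |y|^2 - 2 |y|^2 = 0\<close>.\<close>
  define z where "z y k = (\<Sum>l<m. F (e l) k * y l)" for y k
  have Fz: "F y k = z y k" if y: "y \<in> Rn m" and k: "k < m" for y k
  proof -
    have *: "(\<Sum>k<m. F x k * z y k) = (\<Sum>l<m. x l * y l)" if "x \<in> Rn m" for x
    proof -
      have "(\<Sum>k<m. F x k * z y k) = (\<Sum>k<m. \<Sum>l<m. F x k * F (e l) k * y l)"
        by (simp add: z_def sum_distrib_left mult.assoc)
      also have "\<dots> = (\<Sum>l<m. (\<Sum>k<m. F x k * F (e l) k) * y l)"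
        by (subst sum.swap) (simp add: sum_distrib_right)
      also have "\<dots> = (\<Sum>l<m. x l * y l)" using that by (intro sum.cong) (auto simp: ipe)
      finally show ?thesis .
    qed
    have "(\<Sum>k<m. z y k * z y k) = (\<Sum>k<m. \<Sum>l<m. F (e l) k * z y k * y l)"
      by (rule sum.cong) (auto simp: z_def sum_distrib_left sum_distrib_right mult_ac)
    also have "\<dots> = (\<Sum>l<m. (\<Sum>k<m. F (e l) k * z y k) * y l)"
      by (subst sum.swap) (simp add: sum_distrib_right)
    also have "\<dots> = (\<Sum>l<m. (\<Sum>j<m. e l j * y j) * y l)"
      by (intro sum.cong arg_cong2[where f = "(*)"] * e) auto
    also have "\<dots> = (\<Sum>l<m. y l * y l)"
    proof (intro sum.cong arg_cong2[where f = "(*)"] refl)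
      fix l assume "l \<in> {..<m}"
      moreover have "(\<Sum>j<m. e l j * y j) = (\<Sum>j<m. if j = l then y j else 0)" by (rule sum.cong) (auto simp: e_def)
      ultimately show "(\<Sum>j<m. e l j * y j) = y l" by simp
    qed
    finally have "(\<Sum>k<m. (F y k - z y k)\<^sup>2) = 0"
      unfolding polar using *[OF y] sq0[OF y] by (simp add: power2_eq_square)
    then show ?thesis using k by (subst (asm) sum_nonneg_eq_0_iff) auto
  qed
  show ?thesis
  proof (rule that[of "f (\<lambda>i. 0)" "\<lambda>k l. F (e l) k"])
    show "f y k = f (\<lambda>i. 0) k + (\<Sum>l<m. F (e l) k * y l)" if "y \<in> Rn m" "k < m" for y k
      using Fz[OF that] by (simp add: F_def z_def)
    show "(\<Sum>k<m. F (e i) k * F (e j) k) = (if i = j then 1 else 0)" if "i < m" "j < m" for i j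
      using ipe[OF e[OF that(1)] that(2)] by (simp add: e_def)
  qed
qed


section \<open>Bieberbach groups as groups of Euclidean motions\<close>

text \<open>Discreteness and cocompactness are recorded through their metric consequences for the
  orbit of the origin: \<open>finite_near\<close> and \<open>cobounded\<close>. In this form they
  can be used without the topology on the group of motions.\<close>

locale euclid_action = group G for G (structure) +
  fixes m :: nat and \<rho> :: "'a \<Rightarrow> (nat \<Rightarrow> real) \<Rightarrow> nat \<Rightarrow> real"
  assumes mem: "g \<in> carrier G \<Longrightarrow> y \<in> Rn m \<Longrightarrow> \<rho> g y \<in> Rn m"
    and one: "y \<in> Rn m \<Longrightarrow> \<rho> \<one> y = y"
    and mult: "g \<in> carrier G \<Longrightarrow> h \<in> carrier G \<Longrightarrow> y \<in> Rn m \<Longrightarrow> \<rho> (g \<otimes> h) y = \<rho> g (\<rho> h y)"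
    and dist: "g \<in> carrier G \<Longrightarrow> x \<in> Rn m \<Longrightarrow> y \<in> Rn m \<Longrightarrow> euclid_dist m (\<rho> g x) (\<rho> g y) = euclid_dist m x y"
    and finite_near: "finite {g \<in> carrier G. euclid_dist m (\<rho> g (\<lambda>i. 0)) (\<lambda>i. 0) \<le> c}"
    and free: "g \<in> carrier G \<Longrightarrow> y \<in> Rn m \<Longrightarrow> \<rho> g y = y \<Longrightarrow> g = \<one>"
    and cobounded: "\<exists>R>0. \<forall>y\<in>Rn m. \<exists>g\<in>carrier G. euclid_dist m (\<rho> g (\<lambda>i. 0)) y < R"

text \<open>The orbits that meet \<open>f < k\<close> form an increasing open cover of the compact
  orbit space. \<open>f\<close> is any real function with the stated openness, continuous or not; it
  will be a distance, a proper function on \<open>M\<close> and a pointwise least constant.\<close>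

lemma cocompact_exhaustion:
  fixes f :: "'a \<Rightarrow> real"
  assumes "cocompact G X act"
    and refl: "\<And>x. x \<in> topspace X \<Longrightarrow> x \<in> orbit G act x"
    and op: "\<And>k::nat. openin X {x \<in> topspace X. \<exists>g\<in>carrier G. f (act g x) < real k}"
  obtains k :: nat where "\<And>x. x \<in> topspace X \<Longrightarrow> \<exists>g\<in>carrier G. f (act g x) < real k"
proof -
  define W where "W k = {q \<in> orbits G (topspace X) act. \<exists>y\<in>q. f y < real k}" for k :: nat
  have mem_W: "orbit G act x \<in> W k \<longleftrightarrow> (\<exists>g\<in>carrier G. f (act g x) < real k)" if "x \<in> topspace X" for x k
    using that by (auto simp: W_def orbits_def orbit_def)
  have "openin (orbit_topology G X act) (W k)" for k
  proof -
    have "{x \<in> topspace X. orbit G act x \<in> W k} = {x \<in> topspace X. \<exists>g\<in>carrier G. f (act g x) < real k}"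
      using mem_W by blast
    then show ?thesis unfolding openin_orbit_topology using op[of k] by (auto simp: W_def)
  qed
  have "\<exists>F. finite F \<and> F \<subseteq> range W \<and> topspace (orbit_topology G X act) \<subseteq> \<Union>F"
  proof (rule compactinD)
    show "compactin (orbit_topology G X act) (topspace (orbit_topology G X act))"
      using assms(1) by (simp add: cocompact_def compact_space_def)
    show "openin (orbit_topology G X act) U" if "U \<in> range W" for U
      using that \<open>\<And>k. openin (orbit_topology G X act) (W k)\<close> by blast
    show "topspace (orbit_topology G X act) \<subseteq> \<Union>(range W)"
    proof
      fix q assume q: "q \<in> topspace (orbit_topology G X act)"
      then have "q \<in> orbits G (topspace X) act" by (simp add: topspace_orbit_topology)
      then obtain x where x: "x \<in> topspace X" "q = orbit G act x" by (auto simp: orbits_def)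
      obtain k :: nat where "f x < real k" using reals_Archimedean2 by blast
      then have "q \<in> W k"
        using refl[OF x(1)] x(2) \<open>q \<in> orbits G (topspace X) act\<close> by (auto simp: W_def)
      then show "q \<in> \<Union>(range W)" by blast
    qed
  qed
  then obtain F where F: "finite F" "F \<subseteq> range W" "orbits G (topspace X) act \<subseteq> \<Union>F"
    by (auto simp: topspace_orbit_topology)
  obtain K where K: "finite K" "F = W ` K" using finite_subset_image[OF F(1,2)] by blast
  show ?thesis
  proof (rule that[of "Max (insert 0 K)"])
    fix x assume x: "x \<in> topspace X"
    then have "orbit G act x \<in> \<Union>F" using F(3) by (auto simp: orbits_def)
    then obtain j where j: "j \<in> K" "orbit G act x \<in> W j" using K(2) by blast
    have "real j \<le> real (Max (insert 0 K))" using j(1) K(1) by simp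
    then show "\<exists>g\<in>carrier G. f (act g x) < real (Max (insert 0 K))"
      using j(2) mem_W[OF x] by force
  qed
qed

text \<open>A basic neighbourhood of the identity for pointwise convergence tests finitely many
  points. Test points outside \<open>Rn m\<close> impose nothing, since all members of
  \<open>H\<close> agree there by extensionality.\<close>

lemma discrete_isometry_separation:
  assumes H: "discrete H" "(\<lambda>x\<in>Rn m. x) \<in> H" "H \<subseteq> extensional (Rn m)"
  obtains I d where "finite I" "I \<subseteq> Rn m" "d > 0"
    "\<And>h. h \<in> H \<Longrightarrow> (\<forall>x\<in>I. h x \<in> Rn m \<and> (\<forall>i<m. \<bar>h x i - x i\<bar> < d)) \<Longrightarrow> h = (\<lambda>x\<in>Rn m. x)"
proof -
  let ?e = "\<lambda>x\<in>Rn m. x"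
  obtain T where T: "open T" "T \<inter> H = {?e}"
    using H(1,2) unfolding discrete_def isolated_in_def by metis
  have "openin (product_topology (\<lambda>i. euclidean) UNIV) T"
    using T(1) by (simp add: euclidean_product_topology)
  moreover have "?e \<in> T" using T(2) by blast
  ultimately have "\<exists>X. ?e \<in> (\<Pi>\<^sub>E i\<in>UNIV. X i) \<and> (\<forall>i. openin euclidean (X i)) \<and>
      finite {i. X i \<noteq> topspace euclidean} \<and> (\<Pi>\<^sub>E i\<in>UNIV. X i) \<subseteq> T"
    by (rule product_topology_open_contains_basis)
  then obtain X where X: "?e \<in> (\<Pi>\<^sub>E i\<in>UNIV. X i)" "\<And>i. open (X i)" "finite {i. X i \<noteq> UNIV}"
    "(\<Pi>\<^sub>E i\<in>UNIV. X i) \<subseteq> T"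
    by (elim exE conjE) (simp only: open_openin topspace_euclidean)
  define I where "I = {i. X i \<noteq> UNIV} \<inter> Rn m"
  have I: "finite I" "I \<subseteq> Rn m" using X(3) by (auto simp only: I_def)
  have eX: "?e x \<in> X x" for x using X(1) by (simp only: PiE_UNIV_domain Pi_iff ball_UNIV)
  have "\<exists>d>0. \<forall>y\<in>Rn m. (\<forall>i<m. \<bar>y i - x i\<bar> < d) \<longrightarrow> y \<in> X x" if "x \<in> I" for x
  proof -
    have "openin (Euclidean_space m) (Rn m \<inter> X x)" unfolding openin_Euclidean_space using X(2) by blast
    moreover have "x \<in> Rn m" using that I(2) by blast
    then have "x \<in> Rn m \<inter> X x" using eX[of x] by simp
    ultimately show ?thesis unfolding openin_Euclidean_space_iff by blast
  qed
  then obtain d where d: "\<And>x. x \<in> I \<Longrightarrow> d x > (0::real)"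
    "\<And>x y. x \<in> I \<Longrightarrow> y \<in> Rn m \<Longrightarrow> (\<forall>i<m. \<bar>y i - x i\<bar> < d x) \<Longrightarrow> y \<in> X x" by metis
  show ?thesis
  proof (rule that[of I "Min (insert 1 (d ` I))"])
    show "0 < Min (insert 1 (d ` I))" using I(1) d(1) by auto
    fix h assume h: "h \<in> H" "\<forall>x\<in>I. h x \<in> Rn m \<and> (\<forall>i<m. \<bar>h x i - x i\<bar> < Min (insert 1 (d ` I)))"
    have "h x \<in> X x" for x
    proof -
      consider "x \<in> I" | "X x = UNIV" | "x \<notin> Rn m" unfolding I_def by blast
      then show ?thesis
      proof cases
        case 1
        then have "Min (insert 1 (d ` I)) \<le> d x" using I(1) by simp
        then show ?thesis using h(2) 1 d(2)[OF 1] by (meson less_le_trans)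
      next
        case 3
        then have "h x = ?e x" using h(1) H(3) by (auto simp: extensional_def)
        then show ?thesis using eX[of x] by simp
      qed simp
    qed
    then have "h \<in> T" using X(4) by (auto simp only: PiE_UNIV_domain Pi_iff ball_UNIV)
    then show "h = ?e" using T(2) h(1) by blast
  qed (rule I)+
qed

text \<open>Pigeonhole principle. Motions that displace the origin by at most \<open>c\<close> have
  bounded values on the finite test set, hence finitely many values after rounding. Two with the
  same rounding differ by a motion \<open>k\<close> so close to the identity on the test set that it
  is the identity.\<close>

lemma discrete_isometries_finite_near:
  assumes H: "discrete H" "(\<lambda>x\<in>Rn m. x) \<in> H" "H \<subseteq> extensional (Rn m)"
    and mem: "\<And>h x. h \<in> H \<Longrightarrow> x \<in> Rn m \<Longrightarrow> h x \<in> Rn m"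
    and d: "\<And>h x y. h \<in> H \<Longrightarrow> x \<in> Rn m \<Longrightarrow> y \<in> Rn m \<Longrightarrow> euclid_dist m (h x) (h y) = euclid_dist m x y"
    and quot: "\<And>h h'. h \<in> H \<Longrightarrow> h' \<in> H \<Longrightarrow> \<exists>k\<in>H. \<forall>x\<in>Rn m. h (k x) = h' x"
  shows "finite {h \<in> H. euclid_dist m (h (\<lambda>i. 0)) (\<lambda>i. 0) \<le> c}" (is "finite ?S")
proof (rule ccontr)
  assume inf: "infinite ?S"
  obtain I \<delta> where I: "finite I" "I \<subseteq> Rn m" "\<delta> > 0"
    "\<And>h. h \<in> H \<Longrightarrow> (\<forall>x\<in>I. h x \<in> Rn m \<and> (\<forall>i<m. \<bar>h x i - x i\<bar> < \<delta>)) \<Longrightarrow> h = (\<lambda>x\<in>Rn m. x)"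
    using discrete_isometry_separation[OF H] by metis
  \<comment> \<open>The rounding error \<open>\<mu>\<close> per coordinate costs at most
    \<open>m * \<mu>\<close> in distance; \<open>Suc m\<close> makes this smaller than
    \<open>\<delta>\<close> and avoids division by 0.\<close>
  define \<mu> where "\<mu> = \<delta> / real (Suc m)"
  have \<mu>: "\<mu> > 0" "real m * \<mu> < \<delta>" using I(3) by (auto simp: \<mu>_def field_simps)
  define code where "code h = (\<lambda>(x, i)\<in>I \<times> {..<m}. \<lfloor>h x i / \<mu>\<rfloor>)" for h :: "(nat \<Rightarrow> real) \<Rightarrow> nat \<Rightarrow> real"
  define B where "B x = euclid_dist m x (\<lambda>i. 0) + c" for x
  have "code ` ?S \<subseteq> (\<Pi>\<^sub>E (x, i)\<in>I \<times> {..<m}. {\<lfloor>- B x / \<mu>\<rfloor>..\<lfloor>B x / \<mu>\<rfloor>})"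
  proof (rule image_subsetI)
    fix h assume h: "h \<in> ?S"
    have "\<lfloor>- B x / \<mu>\<rfloor> \<le> \<lfloor>h x i / \<mu>\<rfloor> \<and> \<lfloor>h x i / \<mu>\<rfloor> \<le> \<lfloor>B x / \<mu>\<rfloor>" if x: "x \<in> I" "i < m" for x i
    proof -
      have "\<bar>h x i - (\<lambda>i. 0) i\<bar> \<le> euclid_dist m (h x) (\<lambda>i. 0)" using x(2) by (rule coord_le_euclid_dist)
      also have "\<dots> \<le> euclid_dist m (h x) (h (\<lambda>i. 0)) + euclid_dist m (h (\<lambda>i. 0)) (\<lambda>i. 0)"
        by (rule euclid_dist_triangle)
      also have "\<dots> \<le> B x" using h x I(2) by (auto simp: B_def d subset_iff)
      finally have "\<bar>h x i\<bar> \<le> B x" by simp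
      then show ?thesis using \<mu>(1) by (intro conjI floor_mono divide_right_mono) auto
    qed
    then show "code h \<in> (\<Pi>\<^sub>E (x, i)\<in>I \<times> {..<m}. {\<lfloor>- B x / \<mu>\<rfloor>..\<lfloor>B x / \<mu>\<rfloor>})"
      by (auto simp: code_def)
  qed
  moreover have "finite (\<Pi>\<^sub>E (x, i)\<in>I \<times> {..<m}. {\<lfloor>- B x / \<mu>\<rfloor>..\<lfloor>B x / \<mu>\<rfloor>})"
    using I(1) by (intro finite_PiE) auto
  ultimately have "finite (code ` ?S)" by (rule finite_subset)
  then have "\<not> inj_on code ?S" using inf finite_imageD by blast
  then obtain h h' where h: "h \<in> H" "h' \<in> H" "h \<noteq> h'" "code h = code h'"
    unfolding inj_on_def by blast
  obtain k where k: "k \<in> H" "\<And>x. x \<in> Rn m \<Longrightarrow> h (k x) = h' x" using quot[OF h(1,2)] by blast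
  have "k x \<in> Rn m \<and> (\<forall>i<m. \<bar>k x i - x i\<bar> < \<delta>)" if x: "x \<in> I" for x
  proof -
    have xR: "x \<in> Rn m" using x I(2) by blast
    have "\<bar>h' x i - h x i\<bar> \<le> \<mu>" if i: "i < m" for i
    proof -
      have "\<lfloor>h x i / \<mu>\<rfloor> = \<lfloor>h' x i / \<mu>\<rfloor>"
        using fun_cong[OF h(4), of "(x, i)"] x i by (simp add: code_def)
      then have "\<bar>h' x i / \<mu> - h x i / \<mu>\<bar> \<le> 1" by linarith
      then have "\<bar>(h' x i - h x i) / \<mu>\<bar> \<le> 1" by (simp add: diff_divide_distrib)
      then show ?thesis using \<mu>(1) by (simp add: abs_divide)
    qed
    then have "euclid_dist m (h' x) (h x) \<le> real m * \<mu>" by (rule euclid_dist_le)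
    then have "euclid_dist m (k x) x < \<delta>"
      using d[OF h(1) mem[OF k(1) xR] xR] k(2)[OF xR] \<mu>(2) by simp
    then show ?thesis using mem[OF k(1) xR] coord_le_euclid_dist[of _ m "k x" x] by (meson le_less_trans)
  qed
  then have "k = (\<lambda>x\<in>Rn m. x)" using I(4)[OF k(1)] by blast
  then have "h x = h' x" if "x \<in> Rn m" for x using k(2)[OF that] that by simp
  then have "h = h'" using extensionalityI[of h "Rn m" h'] H(3) h by blast
  then show False using h(3) by blast
qed

lemma bieberbach_euclid_action:
  fixes G (structure)
  assumes "bieberbach_group G"
  obtains m \<rho> where "euclid_action G m \<rho>"
proof -
  obtain m H where G: "group G" and H: "subgroup H (euclid_isom_group m)" "discrete H"
    and tf: "torsion_free ((euclid_isom_group m)\<lparr>carrier := H\<rparr>)"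
    and cc: "cocompact ((euclid_isom_group m)\<lparr>carrier := H\<rparr>) (Euclidean_space m) (\<lambda>h. h)"
    and iso: "G \<cong> (euclid_isom_group m)\<lparr>carrier := H\<rparr>"
    using assms unfolding bieberbach_group_def by blast
  interpret group G by (rule G)
  let ?K = "(euclid_isom_group m)\<lparr>carrier := H\<rparr>"
  obtain \<rho> where \<rho>: "\<rho> \<in> iso G ?K" using iso by (auto simp: is_iso_def)
  have HB: "H \<subseteq> Bij (Rn m)"
    and Hd: "\<And>h x y. h \<in> H \<Longrightarrow> x \<in> Rn m \<Longrightarrow> y \<in> Rn m \<Longrightarrow> euclid_dist m (h x) (h y) = euclid_dist m x y"
    using subgroup.subset[OF H(1)] by (auto simp: euclid_isom_group_def)
  have Hm: "h x \<in> Rn m" if "h \<in> H" "x \<in> Rn m" for h x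
    using Bij_imp_funcset[of h "Rn m"] that HB by blast
  have mult_K: "h \<otimes>\<^bsub>?K\<^esub> h' = compose (Rn m) h h'" if "h \<in> H" "h' \<in> H" for h h'
    using that HB by (auto simp: euclid_isom_group_def BijGroup_def)
  have one_K: "\<one>\<^bsub>?K\<^esub> = (\<lambda>x\<in>Rn m. x)"
    by (simp add: euclid_isom_group_def BijGroup_def)
  have \<rho>H: "\<rho> g \<in> H" if "g \<in> carrier G" for g
    using \<rho> that by (auto simp: iso_def hom_def)
  have \<rho>mult: "\<rho> (g \<otimes> h) = compose (Rn m) (\<rho> g) (\<rho> h)" if "g \<in> carrier G" "h \<in> carrier G" for g h
  proof -
    have "\<rho> (g \<otimes> h) = \<rho> g \<otimes>\<^bsub>?K\<^esub> \<rho> h" using \<rho> that by (auto simp: iso_def hom_def)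
    then show ?thesis using mult_K \<rho>H that by simp
  qed
  have \<rho>inj: "inj_on \<rho> (carrier G)" and \<rho>surj: "\<rho> ` carrier G = H"
    using \<rho> by (auto simp: iso_def bij_betw_def)
  \<comment> \<open>\<open>\<rho> \<one>\<close> is idempotent and injective, hence the identity on
    \<open>Rn m\<close>.\<close>
  have \<rho>one: "\<rho> \<one> = (\<lambda>x\<in>Rn m. x)"
  proof (rule extensionalityI)
    show "\<rho> \<one> \<in> extensional (Rn m)" using \<rho>H[OF one_closed] HB Bij_imp_extensional by blast
    fix x assume x: "x \<in> Rn m"
    have "\<rho> \<one> (\<rho> \<one> x) = \<rho> \<one> x"
      using fun_cong[OF \<rho>mult[OF one_closed one_closed], of x] x by (simp add: compose_def)
    moreover have "inj_on (\<rho> \<one>) (Rn m)" using \<rho>H[OF one_closed] HB by (auto simp: Bij_def bij_betw_def)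
    ultimately show "\<rho> \<one> x = (\<lambda>x\<in>Rn m. x) x"
      using x Hm[OF \<rho>H[OF one_closed] x] by (simp add: inj_on_def)
  qed simp
  have idH: "(\<lambda>x\<in>Rn m. x) \<in> H" using \<rho>H[OF one_closed] \<rho>one by simp
  have app: "\<rho> (g \<otimes> h) y = \<rho> g (\<rho> h y)" if "g \<in> carrier G" "h \<in> carrier G" "y \<in> Rn m" for g h y
    using \<rho>mult[OF that(1,2)] that(3) by (simp add: compose_def)
  have finH: "finite {h \<in> H. euclid_dist m (h (\<lambda>i. 0)) (\<lambda>i. 0) \<le> c}" for c
  proof (rule discrete_isometries_finite_near[OF H(2) idH])
    show "H \<subseteq> extensional (Rn m)" using HB Bij_imp_extensional by blast
    fix h h' assume "h \<in> H" "h' \<in> H"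
    then obtain g g' where g: "g \<in> carrier G" "g' \<in> carrier G" "h = \<rho> g" "h' = \<rho> g'" using \<rho>surj by blast
    have "\<rho> g (\<rho> (inv g \<otimes> g') x) = \<rho> g' x" if "x \<in> Rn m" for x
      using app[OF g(1) _ that, of "inv g \<otimes> g'"] g by (simp add: m_assoc[symmetric])
    then show "\<exists>k\<in>H. \<forall>x\<in>Rn m. h (k x) = h' x"
      using g \<rho>H[of "inv g \<otimes> g'"] by (intro bexI[of _ "\<rho> (inv g \<otimes> g')"]) auto
  qed (use Hm Hd in auto)
  have fin: "finite {g \<in> carrier G. euclid_dist m (\<rho> g (\<lambda>i. 0)) (\<lambda>i. 0) \<le> c}" for c
  proof (rule finite_imageD)
    show "finite (\<rho> ` {g \<in> carrier G. euclid_dist m (\<rho> g (\<lambda>i. 0)) (\<lambda>i. 0) \<le> c})"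
      using \<rho>H by (intro finite_subset[OF _ finH[of c]]) auto
    show "inj_on \<rho> {g \<in> carrier G. euclid_dist m (\<rho> g (\<lambda>i. 0)) (\<lambda>i. 0) \<le> c}"
      by (rule inj_on_subset[OF \<rho>inj]) auto
  qed
  have pow_K: "\<rho> (g [^] (k::nat)) = \<rho> g [^]\<^bsub>?K\<^esub> k" if "g \<in> carrier G" for g k
  proof (induction k)
    case 0
    show ?case using \<rho>one one_K by simp
  next
    case (Suc k)
    have "\<rho> (g [^] Suc k) = compose (Rn m) (\<rho> (g [^] k)) (\<rho> g)"
      using that by (simp add: \<rho>mult)
    also have "\<dots> = \<rho> (g [^] k) \<otimes>\<^bsub>?K\<^esub> \<rho> g"
      using that by (intro mult_K[symmetric] \<rho>H) auto
    finally show ?case using Suc by (simp add: nat_pow_def)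
  qed
  \<comment> \<open>If \<open>g\<close> fixes \<open>y\<close>, all its powers do and displace the
    origin by at most twice the norm of \<open>y\<close>. They form a finite set, so two powers
    coincide and \<open>g\<close> is torsion.\<close>
  have free: "g = \<one>" if g: "g \<in> carrier G" and y: "y \<in> Rn m" and gy: "\<rho> g y = y" for g y
  proof -
    have py: "\<rho> (g [^] (k::nat)) y = y" for k
      by (induction k) (use g y gy in \<open>auto simp: \<rho>one app\<close>)
    have "g [^] (k::nat) \<in> {g \<in> carrier G. euclid_dist m (\<rho> g (\<lambda>i. 0)) (\<lambda>i. 0) \<le> 2 * euclid_dist m y (\<lambda>i. 0)}" for k
    proof -
      have "euclid_dist m (\<rho> (g [^] k) (\<lambda>i. 0)) (\<lambda>i. 0) \<le>
          euclid_dist m (\<rho> (g [^] k) (\<lambda>i. 0)) (\<rho> (g [^] k) y) + euclid_dist m y (\<lambda>i. 0)"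
        using euclid_dist_triangle[of m _ _ y] py by metis
      also have "euclid_dist m (\<rho> (g [^] k) (\<lambda>i. 0)) (\<rho> (g [^] k) y) = euclid_dist m y (\<lambda>i. 0)"
        using Hd[OF \<rho>H] g y by (simp add: euclid_dist_sym[of m "\<lambda>i. 0"])
      finally show ?thesis using g by simp
    qed
    then have "range (\<lambda>k::nat. g [^] k) \<subseteq> {g \<in> carrier G. euclid_dist m (\<rho> g (\<lambda>i. 0)) (\<lambda>i. 0) \<le> 2 * euclid_dist m y (\<lambda>i. 0)}"
      by blast
    then have "finite (range (\<lambda>k::nat. g [^] k))" using fin finite_subset by blast
    then have "\<not> inj (\<lambda>k::nat. g [^] k)" using finite_imageD infinite_UNIV_nat by blast
    then obtain i j :: nat where ij: "i < j" "g [^] i = g [^] j" unfolding inj_def by (metis linorder_neqE_nat)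
    have "g [^] i \<otimes> g [^] (j - i) = g [^] (i + (j - i))" using g by (rule nat_pow_mult)
    also have "\<dots> = g [^] i \<otimes> \<one>" using ij g by simp
    finally have "g [^] i \<otimes> g [^] (j - i) = g [^] i \<otimes> \<one>" .
    then have "g [^] (j - i) = \<one>" using g by (simp del: r_one)
    then have "\<rho> g [^]\<^bsub>?K\<^esub> (j - i) = \<one>\<^bsub>?K\<^esub>" using pow_K[OF g] \<rho>one one_K by metis
    moreover have "\<rho> g \<in> carrier ?K" using \<rho>H[OF g] by simp
    ultimately have "\<rho> g = \<one>\<^bsub>?K\<^esub>" using tf ij(1) unfolding torsion_free_def by (metis zero_less_diff)
    then have "\<rho> g = \<rho> \<one>" using \<rho>one one_K by simp
    then show ?thesis using \<rho>inj g by (auto dest: inj_onD)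
  qed
  have "openin (Euclidean_space m) {x \<in> topspace (Euclidean_space m). \<exists>h\<in>carrier ?K. euclid_dist m (h x) (\<lambda>i. 0) < real k}" for k :: nat
    unfolding openin_Euclidean_space_iff
  proof (intro conjI ballI)
    fix x assume "x \<in> {x \<in> Rn m. \<exists>h\<in>carrier ?K. euclid_dist m (h x) (\<lambda>i. 0) < real k}"
    then obtain h where h: "h \<in> H" "euclid_dist m (h x) (\<lambda>i. 0) < real k" and x: "x \<in> Rn m" by auto
    define \<delta> where "\<delta> = (real k - euclid_dist m (h x) (\<lambda>i. 0)) / real (Suc m)"
    have \<delta>: "\<delta> > 0" "real m * \<delta> < real k - euclid_dist m (h x) (\<lambda>i. 0)" using h(2) by (auto simp: \<delta>_def field_simps)
    have "euclid_dist m (h y) (\<lambda>i. 0) < real k" if y: "y \<in> Rn m" "\<forall>i<m. \<bar>y i - x i\<bar> < \<delta>" for y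
    proof -
      have "euclid_dist m y x \<le> real m * \<delta>" using y(2) by (intro euclid_dist_le) auto
      then show ?thesis
        using euclid_dist_triangle[of m "h y" "\<lambda>i. 0" "h x"] Hd[OF h(1) y(1) x] \<delta>(2) by linarith
    qed
    then show "\<exists>\<delta>>0. \<forall>y\<in>Rn m. (\<forall>i<m. \<bar>y i - x i\<bar> < \<delta>) \<longrightarrow>
        y \<in> {x \<in> Rn m. \<exists>h\<in>carrier ?K. euclid_dist m (h x) (\<lambda>i. 0) < real k}"
      using \<delta>(1) h(1) by (intro exI[of _ \<delta>]) auto
  qed auto
  moreover have "x \<in> orbit ?K (\<lambda>h. h) x" if "x \<in> Rn m" for x
    using idH that by (auto simp: orbit_def intro!: exI[of _ "\<lambda>x\<in>Rn m. x"])
  ultimately obtain k :: nat where k: "\<And>x. x \<in> Rn m \<Longrightarrow> \<exists>h\<in>carrier ?K. euclid_dist m (h x) (\<lambda>i. 0) < real k"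
    using cocompact_exhaustion[OF cc, of "\<lambda>x. euclid_dist m x (\<lambda>i. 0)"] by blast
  \<comment> \<open>If \<open>g\<close> brings \<open>y\<close> close to the origin, its inverse
    brings the origin equally close to \<open>y\<close>. \<open>Suc\<close> only makes the radius
    visibly positive.\<close>
  have "\<exists>g\<in>carrier G. euclid_dist m (\<rho> g (\<lambda>i. 0)) y < real (Suc k)" if y: "y \<in> Rn m" for y
  proof -
    obtain g where g: "g \<in> carrier G" "euclid_dist m (\<rho> g y) (\<lambda>i. 0) < real k"
      using k[OF y] \<rho>surj by auto
    have "\<rho> g (\<rho> (inv g) (\<lambda>i. 0)) = (\<lambda>i. 0)"
      using app[OF g(1) inv_closed[OF g(1)] zero_in_Rn] g(1) by (simp add: \<rho>one)
    moreover have "\<rho> (inv g) (\<lambda>i. 0) \<in> Rn m" using Hm \<rho>H g(1) by simp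
    ultimately have "euclid_dist m (\<rho> (inv g) (\<lambda>i. 0)) y = euclid_dist m (\<lambda>i. 0) (\<rho> g y)"
      using Hd[OF \<rho>H[OF g(1)] _ y, of "\<rho> (inv g) (\<lambda>i. 0)"] by simp
    then show ?thesis using g euclid_dist_sym[of m "\<lambda>i. 0"] by (intro bexI[of _ "inv g"]) auto
  qed
  then have "\<exists>R>0. \<forall>y\<in>Rn m. \<exists>g\<in>carrier G. euclid_dist m (\<rho> g (\<lambda>i. 0)) y < R"
    by (intro exI[of _ "real (Suc k)"]) auto
  then have "euclid_action G m \<rho>"
    unfolding euclid_action_def euclid_action_axioms_def
    using G Hm Hd \<rho>H \<rho>one app fin free by auto
  then show ?thesis by (rule that)
qed

section \<open>The Euclidean dimension of the group is at most the dimension of the manifold\<close>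

lemma continuous_on_sum_squares: "continuous_on A (\<lambda>x::nat \<Rightarrow> real. \<Sum>i<m. (x i)\<^sup>2)"
  by (intro continuous_on_sum continuous_on_power continuous_on_coord)

lemma continuous_on_euclid_dist: "continuous_on A (\<lambda>x. euclid_dist m c x)"
  unfolding euclid_dist_def L2_set_def
  by (intro continuous_on_real_sqrt continuous_on_sum continuous_on_power continuous_on_diff
      continuous_on_const continuous_on_coord)

lemma compact_Euclidean_ball: "compact {y \<in> Rn n. (\<Sum>i<n. (y i)\<^sup>2) \<le> r}"
proof -
  let ?B = "{y \<in> Rn n. (\<Sum>i<n. (y i)\<^sup>2) \<le> r}" and ?C = "{y::nat \<Rightarrow> real. (\<Sum>i<n. (y i)\<^sup>2) \<le> r}"
  have "\<bar>y i\<bar> \<le> \<bar>r\<bar> + 1" if y: "y \<in> ?B" and i: "i < n" for y i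
  proof -
    have "(y i)\<^sup>2 \<le> (\<Sum>i<n. (y i)\<^sup>2)" using i by (intro member_le_sum) auto
    moreover have "(\<Sum>i<n. (y i)\<^sup>2) \<le> r" using y by blast
    ultimately have "(y i)\<^sup>2 \<le> \<bar>r\<bar> + 1" by linarith
    moreover have "\<bar>r\<bar> + 1 \<le> (\<bar>r\<bar> + 1)\<^sup>2" by (rule self_le_power) auto
    ultimately have "\<bar>y i\<bar>\<^sup>2 \<le> (\<bar>r\<bar> + 1)\<^sup>2" unfolding power2_abs by linarith
    then show ?thesis by (rule power2_le_imp_le) simp
  qed
  then have eq: "?B = {y \<in> Rn n. \<forall>i<n. \<bar>y i\<bar> \<le> \<bar>r\<bar> + 1} \<inter> ?C" by blast
  have "closed ?C" by (intro closed_Collect_le continuous_on_sum_squares continuous_on_const)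
  then show ?thesis unfolding eq by (rule compact_Int_closed[OF compact_Euclidean_box])
qed

lemma compact_imp_abs_bounded:
  fixes f :: "'b::topological_space \<Rightarrow> real"
  assumes "compact C" "continuous_on C f"
  obtains B where "\<And>z. z \<in> C \<Longrightarrow> \<bar>f z\<bar> \<le> B"
proof -
  have "bounded (f ` C)" using assms by (intro compact_imp_bounded compact_continuous_image)
  then obtain B where "\<forall>x\<in>f ` C. norm x \<le> B" unfolding bounded_iff by blast
  then show ?thesis by (intro that[of B]) simp
qed

lemma sum_squares_eq_0:
  assumes "x \<in> Rn m" "(\<Sum>i<m. (x i)\<^sup>2) = 0" shows "x = (\<lambda>i. 0)"
proof
  fix i
  have "\<forall>i\<in>{..<m}. (x i)\<^sup>2 = 0" using assms(2) by (subst (asm) sum_nonneg_eq_0_iff) auto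
  then show "x i = 0" using assms(1) unfolding mem_Rn by (cases "i < m") auto
qed

text \<open>
  If there were no zero, \<open>h\<close> would contract the unit sphere: first move \<open>x\<close> to the direction of \<open>h (r x)\<close> along a
  segment, which avoids the origin, and then shrink the radius.
\<close>

lemma near_identity_has_zero:
  fixes h :: "(nat \<Rightarrow> real) \<Rightarrow> nat \<Rightarrow> real"
  assumes r: "r > 0"
    and cont: "continuous_on {y \<in> Rn m. (\<Sum>i<m. (y i)\<^sup>2) \<le> r\<^sup>2} h"
    and mem: "\<And>y. y \<in> Rn m \<Longrightarrow> (\<Sum>i<m. (y i)\<^sup>2) \<le> r\<^sup>2 \<Longrightarrow> h y \<in> Rn m"
    and near: "\<And>y. y \<in> Rn m \<Longrightarrow> (\<Sum>i<m. (y i)\<^sup>2) \<le> r\<^sup>2 \<Longrightarrow> euclid_dist m (h y) y < r"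
  shows "\<exists>y\<in>Rn m. (\<Sum>i<m. (y i)\<^sup>2) \<le> r\<^sup>2 \<and> h y = (\<lambda>i. 0)"
proof (rule ccontr)
  let ?D = "{y \<in> Rn m. (\<Sum>i<m. (y i)\<^sup>2) \<le> r\<^sup>2}"
  assume "\<not> ?thesis"
  then have neg: "h y \<noteq> (\<lambda>i. 0)" if "y \<in> Rn m" "(\<Sum>i<m. (y i)\<^sup>2) \<le> r\<^sup>2" for y using that by blast
  have zD: "(\<lambda>i. 0) \<in> ?D" using r by simp
  \<comment> \<open>In dimension 0 there is no unit sphere, but then the origin is the only point
    and is a zero.\<close>
  have "m \<noteq> 0"
  proof
    assume "m = 0"
    then have "h (\<lambda>i. 0) = (\<lambda>i. 0)" using mem[OF zero_in_Rn] r unfolding mem_Rn by (auto simp: fun_eq_iff)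
    then show False using neg[of "\<lambda>i. 0"] r by simp
  qed
  then obtain p where p: "m = Suc p" by (cases m) auto
  define Sp where "Sp = {x \<in> Rn m. (\<Sum>i<m. (x i)\<^sup>2) = 1}"
  have Sp: "nsphere p = top_of_set Sp"
  proof -
    have "nsphere p = top_of_set {x. (\<Sum>i\<le>p. (x i)\<^sup>2) = 1 \<and> (\<forall>i>p. x i = 0)}"
      by (simp add: nsphere euclidean_product_topology)
    also have "{x. (\<Sum>i\<le>p. (x i)\<^sup>2) = 1 \<and> (\<forall>i>p. x i = 0)} = Sp"
      unfolding Sp_def p lessThan_Suc_atMost mem_Rn Suc_le_eq by blast
    finally show ?thesis .
  qed
  define nm where "nm v = (\<lambda>i. v i / sqrt (\<Sum>j<m. (v j)\<^sup>2))" for v :: "nat \<Rightarrow> real"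
  have nm_mem: "nm v \<in> Sp" if "v \<in> Rn m" "v \<noteq> (\<lambda>i. 0)" for v
  proof -
    have s: "(\<Sum>j<m. (v j)\<^sup>2) > 0"
      using sum_squares_eq_0[of v m] that sum_nonneg[of "{..<m}" "\<lambda>j. (v j)\<^sup>2"] by force
    then have "(\<Sum>i<m. (nm v i)\<^sup>2) = 1"
      by (simp add: nm_def power_divide sum_divide_distrib[symmetric])
    then show ?thesis using that(1) by (simp add: Sp_def mem_Rn nm_def)
  qed
  have nm_id: "nm x = x" if "x \<in> Sp" for x using that by (simp add: Sp_def nm_def)
  have nm_cont: "continuous_on A (\<lambda>x. nm (F x))"
    if F: "continuous_on A F" "\<And>x. x \<in> A \<Longrightarrow> F x \<in> Rn m \<and> F x \<noteq> (\<lambda>i. 0)" for A and F :: "real \<times> (nat \<Rightarrow> real) \<Rightarrow> nat \<Rightarrow> real"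
  proof (rule continuous_on_coordinatewise_then_product)
    fix i
    have c: "continuous_on A (\<lambda>x. F x j)" for j
      using continuous_on_compose2[OF continuous_on_coord[of UNIV j] F(1)] by simp
    have "sqrt (\<Sum>j<m. (F x j)\<^sup>2) \<noteq> 0" if "x \<in> A" for x
      using F(2)[OF that] sum_squares_eq_0[of "F x" m] by auto
    then show "continuous_on A (\<lambda>x. nm (F x) i)"
      unfolding nm_def
      by (intro continuous_on_divide continuous_on_real_sqrt continuous_on_sum continuous_on_power c) auto
  qed
  have scaled: "(\<lambda>i. c * x i) \<in> ?D" if "x \<in> Sp" "\<bar>c\<bar> \<le> r" for c x
  proof -
    have "c\<^sup>2 \<le> r\<^sup>2" using that(2) r abs_le_square_iff[of c r] by simp
    then show ?thesis using that(1) by (simp add: Sp_def mem_Rn power_mult_distrib sum_distrib_left[symmetric])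
  qed
  have hD: "h y \<in> Rn m" "h y \<noteq> (\<lambda>i. 0)" "euclid_dist m (h y) y < r" if "y \<in> ?D" for y
    using that mem[of y] neg[of y] near[of y] by blast+
  let ?I = "{0..1::real} \<times> Sp"
  have cs: "continuous_on ?I (\<lambda>z. snd z i)" for i
    by (rule continuous_on_compose2[OF continuous_on_coord[of UNIV i]]) (auto intro: continuous_intros)
  have ch: "continuous_on ?I (\<lambda>z. h (\<lambda>i. k (fst z) * snd z i))"
    if k: "continuous_on {0..1} k" "\<And>t. t \<in> {0..1} \<Longrightarrow> \<bar>k t\<bar> \<le> r" for k
  proof (rule continuous_on_compose2[OF cont])
    have "continuous_on ?I (\<lambda>z. k (fst z))"
      by (rule continuous_on_compose2[OF k(1)]) (auto intro: continuous_intros)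
    then show "continuous_on ?I (\<lambda>z i. k (fst z) * snd z i)"
      by (intro continuous_on_coordinatewise_then_product continuous_on_mult cs)
    show "(\<lambda>z i. k (fst z) * snd z i) ` ?I \<subseteq> ?D" using scaled k(2) by fastforce
  qed
  define F1 where "F1 = (\<lambda>z i. (1 - fst z) * (r * snd z i) + fst z * h (\<lambda>i. r * snd z i) i)"
  have F1: "F1 z \<in> Rn m \<and> F1 z \<noteq> (\<lambda>i. 0)" if zI: "z \<in> ?I" for z
  proof
    obtain t x where z: "z = (t, x)" "0 \<le> t" "t \<le> 1" "x \<in> Sp" using zI by auto
    have y: "(\<lambda>i. r * x i) \<in> ?D" using scaled[OF z(4), of r] r by simp
    show "F1 z \<in> Rn m" using z(4) hD(1)[OF y] by (simp add: F1_def z mem_Rn Sp_def)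
    show "F1 z \<noteq> (\<lambda>i. 0)"
    proof
      assume "F1 z = (\<lambda>i. 0)"
      then have "F1 z i = 0" for i by simp
      then have "(1 - t) * (r * x i) + t * h (\<lambda>i. r * x i) i = 0" for i by (simp add: F1_def z(1))
      then have e: "r * x i = t * (r * x i - h (\<lambda>i. r * x i) i)" for i by (simp add: algebra_simps)
      \<comment> \<open>A zero on the segment would force
        \<open>r = t |r x - h (r x)| < r\<close>.\<close>
      have "r\<^sup>2 = (\<Sum>i<m. (r * x i)\<^sup>2)"
        using z(4) by (simp add: Sp_def power_mult_distrib sum_distrib_left[symmetric])
      also have "\<dots> = (\<Sum>i<m. (t * (r * x i - h (\<lambda>i. r * x i) i))\<^sup>2)"
        by (intro sum.cong refl arg_cong[where f = "\<lambda>u. u\<^sup>2"] e)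
      also have "\<dots> = t\<^sup>2 * (euclid_dist m (h (\<lambda>i. r * x i)) (\<lambda>i. r * x i))\<^sup>2"
        unfolding euclid_dist_sq by (simp add: power_mult_distrib sum_distrib_left power2_commute)
      also have "\<dots> \<le> 1 * (euclid_dist m (h (\<lambda>i. r * x i)) (\<lambda>i. r * x i))\<^sup>2"
        using z by (intro mult_right_mono) (auto simp: power_le_one)
      also have "\<dots> < r\<^sup>2" using hD(3)[OF y] euclid_dist_nonneg by (simp add: power_strict_mono)
      finally show False by simp
    qed
  qed
  have "continuous_on ?I (\<lambda>z. h (\<lambda>i. r * snd z i))" using ch[of "\<lambda>_. r"] r by simp
  then have "continuous_on ?I (\<lambda>z. h (\<lambda>i. r * snd z i) i)" for i
    using continuous_on_compose2[OF continuous_on_coord[of UNIV i] _ subset_UNIV] by blast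
  moreover have "continuous_on ?I (\<lambda>z. fst z)" by (intro continuous_intros)
  ultimately have F1c: "continuous_on ?I F1"
    unfolding F1_def
    by (intro continuous_on_coordinatewise_then_product continuous_on_add continuous_on_mult
        continuous_on_diff continuous_on_const cs)
  have canonI: "homotopic_with (\<lambda>x. True) (top_of_set Sp) (top_of_set Sp) p q"
    if "continuous_on ?I k" "\<And>z. z \<in> ?I \<Longrightarrow> k z \<in> Sp" "\<And>x. x \<in> Sp \<Longrightarrow> k (0, x) = p x" "\<And>x. x \<in> Sp \<Longrightarrow> k (1, x) = q x"
    for k p q
  proof -
    have "k \<in> ?I \<rightarrow> Sp" using that(2) by blast
    then have "continuous_map (prod_topology (top_of_set {0..1}) (top_of_set Sp)) (top_of_set Sp) k"
      using that(1) by (simp add: Pi_iff image_subset_iff)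
    then show ?thesis
      using that(3,4) by (subst homotopic_with) (auto intro!: exI[of _ k])
  qed
  have rD: "(\<lambda>i. r * x i) \<in> ?D" if "x \<in> Sp" for x using scaled[OF that, of r] r by simp
  have "homotopic_with (\<lambda>x. True) (top_of_set Sp) (top_of_set Sp) id (\<lambda>x. nm (h (\<lambda>i. r * x i)))"
  proof (rule canonI)
    show "continuous_on ?I (\<lambda>z. nm (F1 z))" by (rule nm_cont[OF F1c F1])
    show "nm (F1 z) \<in> Sp" if "z \<in> ?I" for z using F1[OF that] nm_mem by blast
    show "nm (F1 (0, x)) = id x" if "x \<in> Sp" for x
    proof -
      have "nm (\<lambda>i. r * x i) = x"
        using r that by (simp add: nm_def power_mult_distrib sum_distrib_left[symmetric] Sp_def)
      then show ?thesis by (simp add: F1_def)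
    qed
    show "nm (F1 (1, x)) = nm (h (\<lambda>i. r * x i))" for x by (simp add: F1_def)
  qed
  moreover have "homotopic_with (\<lambda>x. True) (top_of_set Sp) (top_of_set Sp) (\<lambda>x. nm (h (\<lambda>i. r * x i))) (\<lambda>x. nm (h (\<lambda>i. 0)))"
  proof (rule canonI)
    have k: "\<bar>(1 - t) * r\<bar> \<le> r" if "t \<in> {0..1}" for t
      using that r by (simp add: abs_mult mult_left_le_one_le)
    have sD: "(\<lambda>i. ((1 - fst z) * r) * snd z i) \<in> ?D" if "z \<in> ?I" for z
    proof (rule scaled)
      show "snd z \<in> Sp" "\<bar>(1 - fst z) * r\<bar> \<le> r" using that k[of "fst z"] by auto
    qed
    have "continuous_on ?I (\<lambda>z. h (\<lambda>i. ((1 - fst z) * r) * snd z i))"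
    proof (rule ch[of "\<lambda>t. (1 - t) * r"])
      show "continuous_on {0..1} (\<lambda>t. (1 - t) * r)" by (intro continuous_intros)
    qed (rule k)
    then show "continuous_on ?I (\<lambda>z. nm (h (\<lambda>i. ((1 - fst z) * r) * snd z i)))"
      by (rule nm_cont) (use hD(1,2)[OF sD] in blast)
    show "nm (h (\<lambda>i. ((1 - fst z) * r) * snd z i)) \<in> Sp" if "z \<in> ?I" for z
      by (rule nm_mem[OF hD(1,2)[OF sD[OF that] ]])
  qed auto
  ultimately have "homotopic_with (\<lambda>x. True) (top_of_set Sp) (top_of_set Sp) id (\<lambda>x. nm (h (\<lambda>i. 0)))"
    by (rule homotopic_with_trans)
  then have "contractible_space (nsphere p)"
    unfolding Sp contractible_space_def by blast
  then show False using non_contractible_space_nsphere by blast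
qed

text \<open>Counting instead of measure: the cube contains \<open>p ^ m\<close> points with spacing
  \<open>1 / p\<close>. Their preimages lie in different cells of a mesh of size proportional to
  \<open>1 / p\<close>, and there are at most \<open>(c p) ^ n\<close> such cells.\<close>

lemma Lipschitz_image_not_cube:
  fixes f :: "(nat \<Rightarrow> real) \<Rightarrow> nat \<Rightarrow> real"
  assumes nm: "n < m" and L: "L \<ge> 0"
    and lip: "\<And>x y d k. k < m \<Longrightarrow> x \<in> Rn n \<Longrightarrow> y \<in> Rn n \<Longrightarrow> (\<forall>i<n. \<bar>x i\<bar> \<le> r) \<Longrightarrow> (\<forall>i<n. \<bar>y i\<bar> \<le> r) \<Longrightarrow>
       d \<ge> 0 \<Longrightarrow> (\<forall>i<n. \<bar>y i - x i\<bar> \<le> d) \<Longrightarrow> \<bar>f y k - f x k\<bar> \<le> L * d"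
  shows "\<not> {z \<in> Rn m. \<forall>k<m. 0 \<le> z k \<and> z k \<le> 1} \<subseteq> f ` {x \<in> Rn n. \<forall>i<n. \<bar>x i\<bar> \<le> r}"
proof
  assume sub: "{z \<in> Rn m. \<forall>k<m. 0 \<le> z k \<and> z k \<le> 1} \<subseteq> f ` {x \<in> Rn n. \<forall>i<n. \<bar>x i\<bar> \<le> r}"
  \<comment> \<open>With the mesh \<open>\<eta>\<close> below, one side of the box meets at most
    \<open>2 |r| / \<eta> + 2\<close> cells, which is at most \<open>c * p\<close>.\<close>
  define c where "c = 2 * \<bar>r\<bar> * (2 * (L + 1)) + 2"
  have c1: "c \<ge> 1" using L by (simp add: c_def)
  have count: "real p ^ m \<le> (c * real p) ^ n" if p: "p \<ge> 1" for p :: nat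
  proof -
    \<comment> \<open>Points in a common cell have images closer than the grid spacing, as
      \<open>L * \<eta> < 1 / p\<close>. The summand 1 in \<open>L + 1\<close> covers
      \<open>L = 0\<close>.\<close>
    define \<eta> where "\<eta> = 1 / (2 * (L + 1) * real p)"
    have \<eta>: "\<eta> > 0" "L * \<eta> < 1 / real p"
    proof -
      have p0: "real p > 0" and L1: "2 * (L + 1) > 0" using p L by auto
      then show "\<eta> > 0" unfolding \<eta>_def by (intro divide_pos_pos mult_pos_pos) auto
      have "L / (2 * (L + 1)) < 1" using L1 L by (subst divide_less_eq_1_pos) auto
      then have "L / (2 * (L + 1)) / real p < 1 / real p" using p0 by (rule divide_strict_right_mono)
      then show "L * \<eta> < 1 / real p" by (simp add: \<eta>_def)
    qed
    define grid where "grid j = (\<lambda>k. if k < m then real (j k) / real p else 0)" for j :: "nat \<Rightarrow> nat"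
    have "\<exists>x. x \<in> Rn n \<and> (\<forall>i<n. \<bar>x i\<bar> \<le> r) \<and> f x = grid j" if "j \<in> {..<m} \<rightarrow>\<^sub>E {..<p}" for j
    proof -
      have "real (j k) / real p \<le> 1" if "k < m" for k
        using \<open>j \<in> {..<m} \<rightarrow>\<^sub>E {..<p}\<close> that p by (auto simp: PiE_iff intro: less_imp_le)
      then have "grid j \<in> {z \<in> Rn m. \<forall>k<m. 0 \<le> z k \<and> z k \<le> 1}"
        by (simp add: grid_def mem_Rn)
      then have "grid j \<in> f ` {x \<in> Rn n. \<forall>i<n. \<bar>x i\<bar> \<le> r}" using sub by blast
      then obtain x where "grid j = f x" "x \<in> {x \<in> Rn n. \<forall>i<n. \<bar>x i\<bar> \<le> r}" by (rule imageE)
      then show ?thesis by (intro exI[of _ x]) simp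
    qed
    then have "\<forall>j. \<exists>x. j \<in> {..<m} \<rightarrow>\<^sub>E {..<p} \<longrightarrow> x \<in> Rn n \<and> (\<forall>i<n. \<bar>x i\<bar> \<le> r) \<and> f x = grid j" by blast
    from choice[OF this] obtain X where X: "\<And>j. j \<in> {..<m} \<rightarrow>\<^sub>E {..<p} \<Longrightarrow> X j \<in> Rn n"
      "\<And>j i. j \<in> {..<m} \<rightarrow>\<^sub>E {..<p} \<Longrightarrow> i < n \<Longrightarrow> \<bar>X j i\<bar> \<le> r"
      "\<And>j. j \<in> {..<m} \<rightarrow>\<^sub>E {..<p} \<Longrightarrow> f (X j) = grid j" by blast
    define code where "code j = (\<lambda>i\<in>{..<n}. \<lfloor>X j i / \<eta>\<rfloor>)" for j
    define Z where "Z = {\<lfloor>- r / \<eta>\<rfloor>..\<lfloor>r / \<eta>\<rfloor>}"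
    have "inj_on code ({..<m} \<rightarrow>\<^sub>E {..<p})"
    proof (rule inj_onI)
      fix j j' assume j: "j \<in> {..<m} \<rightarrow>\<^sub>E {..<p}" "j' \<in> {..<m} \<rightarrow>\<^sub>E {..<p}" and eq: "code j = code j'"
      have "\<bar>X j' i - X j i\<bar> \<le> \<eta>" if "i < n" for i
      proof -
        have "\<lfloor>X j i / \<eta>\<rfloor> = \<lfloor>X j' i / \<eta>\<rfloor>" using fun_cong[OF eq, of i] that by (simp add: code_def)
        then have "\<bar>X j' i / \<eta> - X j i / \<eta>\<bar> \<le> 1" by linarith
        then have "\<bar>(X j' i - X j i) / \<eta>\<bar> \<le> 1" by (simp add: diff_divide_distrib)
        then show ?thesis using \<eta>(1) by (simp add: abs_divide)
      qed
      then have "\<bar>f (X j') k - f (X j) k\<bar> \<le> L * \<eta>" if "k < m" for k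
        using that X j \<eta>(1) by (intro lip) auto
      then have "\<bar>real (j' k) / real p - real (j k) / real p\<bar> < 1 / real p" if "k < m" for k
        using that X(3) j \<eta>(2) unfolding grid_def by fastforce
      then have "\<bar>real (j' k) - real (j k)\<bar> < 1" if "k < m" for k
        using that p by (simp add: diff_divide_distrib[symmetric] abs_divide divide_less_cancel)
      then have "j k = j' k" if "k < m" for k using that by fastforce
      then show "j = j'" using j by (intro PiE_ext[OF j]) auto
    qed
    moreover have "code ` ({..<m} \<rightarrow>\<^sub>E {..<p}) \<subseteq> {..<n} \<rightarrow>\<^sub>E Z"
    proof (rule image_subsetI)
      fix j assume j: "j \<in> {..<m} \<rightarrow>\<^sub>E {..<p}"
      have "\<lfloor>X j i / \<eta>\<rfloor> \<in> Z" if i: "i < n" for i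
      proof -
        have "- r \<le> X j i" "X j i \<le> r" using X(2)[OF j i] by linarith+
        then show ?thesis using \<eta>(1) unfolding Z_def atLeastAtMost_iff
          by (intro conjI floor_mono divide_right_mono) auto
      qed
      then show "code j \<in> {..<n} \<rightarrow>\<^sub>E Z" by (simp add: code_def)
    qed
    ultimately have "card ({..<m} \<rightarrow>\<^sub>E {..<p}) \<le> card ({..<n} \<rightarrow>\<^sub>E Z)"
      by (intro card_inj_on_le) (auto simp: Z_def intro: finite_PiE)
    then have "p ^ m \<le> card Z ^ n" by (simp add: card_PiE)
    then have "real p ^ m \<le> real (card Z) ^ n" by (metis of_nat_le_iff of_nat_power)
    also have "\<dots> \<le> (c * real p) ^ n"
    proof (rule power_mono)
      have "\<bar>r\<bar> / \<eta> = \<bar>r\<bar> * (2 * (L + 1)) * real p" using L p by (simp add: \<eta>_def)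
      moreover have "real (card Z) \<le> \<bar>\<lfloor>r / \<eta>\<rfloor> - \<lfloor>- r / \<eta>\<rfloor> + 1\<bar>" by (simp add: Z_def)
      moreover have "\<bar>\<lfloor>r / \<eta>\<rfloor> - \<lfloor>- r / \<eta>\<rfloor> + 1\<bar> \<le> 2 * (\<bar>r\<bar> / \<eta>) + 2"
      proof -
        have "\<bar>r / \<eta>\<bar> = \<bar>r\<bar> / \<eta>" using \<eta>(1) by (simp add: abs_divide)
        moreover have "- r / \<eta> = - (r / \<eta>)" by simp
        ultimately show ?thesis by linarith
      qed
      ultimately have "real (card Z) \<le> 2 * (\<bar>r\<bar> * (2 * (L + 1)) * real p) + 2" by linarith
      also have "\<dots> \<le> c * real p" using p by (simp add: c_def algebra_simps)
      finally show "real (card Z) \<le> c * real p" .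
    qed simp
    finally show ?thesis .
  qed
  \<comment> \<open>Cancelling \<open>p ^ n\<close> leaves \<open>p ^ (m - n)\<close> bounded, which
    is absurd for large \<open>p\<close>.\<close>
  have "real p \<le> c ^ n" if p: "p \<ge> 1" for p :: nat
  proof -
    have "real p ^ n * real p ^ (m - n) = real p ^ m" using nm by (simp add: power_add[symmetric])
    also have "\<dots> \<le> real p ^ n * c ^ n" using count[OF p] by (simp add: power_mult_distrib mult.commute)
    finally have "real p ^ (m - n) \<le> c ^ n" using p by simp
    moreover have "real p ^ 1 \<le> real p ^ (m - n)" using p nm by (intro power_increasing) auto
    ultimately show ?thesis by (metis order_trans power_one_right)
  qed
  moreover obtain p :: nat where "c ^ n < real p" using reals_Archimedean2 by blast
  moreover have "p \<ge> 1"
    using \<open>c ^ n < real p\<close> c1 one_le_power[of c n] by (cases p) auto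
  ultimately show False by (meson not_le)
qed

text \<open>Made for the cone parameter: \<open>b\<close> may jump where \<open>t\<close> vanishes,
  but it stays bounded and is multiplied by something that tends to 0.\<close>

lemma continuous_on_mult_vanishing:
  fixes t b :: "(nat \<Rightarrow> real) \<Rightarrow> real"
  assumes t: "continuous_on D t" and B: "\<And>y. y \<in> D \<Longrightarrow> \<bar>b y\<bar> \<le> B"
    and b: "continuous_on {y \<in> D. t y \<noteq> 0} b"
  shows "continuous_on D (\<lambda>y. t y * b y)"
  unfolding continuous_on_def
proof
  fix y assume y: "y \<in> D"
  have ty: "(t \<longlongrightarrow> t y) (at y within D)" using t y by (simp add: continuous_on_def)
  show "((\<lambda>y. t y * b y) \<longlongrightarrow> t y * b y) (at y within D)"
  proof (cases "t y = 0")
    case True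
    have "((\<lambda>x. \<bar>t x\<bar> * B) \<longlongrightarrow> \<bar>t y\<bar> * B) (at y within D)" by (intro tendsto_intros ty)
    then have "((\<lambda>x. \<bar>t x\<bar> * B) \<longlongrightarrow> 0) (at y within D)" using True by simp
    moreover have "eventually (\<lambda>x. norm (t x * b x) \<le> \<bar>t x\<bar> * B) (at y within D)"
      unfolding eventually_at_filter by (rule always_eventually) (auto simp: abs_mult intro!: mult_left_mono B)
    ultimately show ?thesis using True by (simp add: Lim_null_comparison)
  next
    case False
    obtain T where T: "open T" "T \<inter> D = t -` (-{0}) \<inter> D"
      using t unfolding continuous_on_open_invariant by (metis open_Compl closed_singleton)
    have "y \<in> T" using T(2) False y by blast
    then have "at y within D = at y within {y \<in> D. t y \<noteq> 0}"
      using T by (intro at_within_nhd[of y T]) auto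
    moreover have "(b \<longlongrightarrow> b y) (at y within {y \<in> D. t y \<noteq> 0})"
      using b y False by (simp add: continuous_on_def)
    ultimately show ?thesis using ty by (intro tendsto_mult) auto
  qed
qed

text \<open>
  An iterated cone: the weights \<open>w\<close> are barycentric coordinates of a point in a simplex with vertices in
  the group, and coning off is done with the straight-line contraction conjugated by \<open>a g\<close>.
\<close>

primrec iterated_cone :: "('g \<Rightarrow> (nat \<Rightarrow> real) \<Rightarrow> nat \<Rightarrow> real) \<Rightarrow> ('g \<Rightarrow> 'g) \<Rightarrow> ('g \<Rightarrow> real) \<Rightarrow> 'g list \<Rightarrow> nat \<Rightarrow> real" where
  "iterated_cone a j w [] = (\<lambda>_. 0)"
| "iterated_cone a j w (g # l) =
     a g (\<lambda>i. sum_list (map w l) / (w g + sum_list (map w l)) * a (j g) (iterated_cone a j w l) i)"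

text \<open>A container for the values of all cones of depth at most \<open>k\<close> over vertices
  in \<open>S\<close>, whatever the weights; \<open>j\<close> stands for inversion. The parameter 0
  gives the apex \<open>a g 0\<close> and the parameter 1 gives back the point
  \<open>z\<close>.\<close>

primrec cone_hull :: "('g \<Rightarrow> (nat \<Rightarrow> real) \<Rightarrow> nat \<Rightarrow> real) \<Rightarrow> ('g \<Rightarrow> 'g) \<Rightarrow> 'g set \<Rightarrow> nat \<Rightarrow> (nat \<Rightarrow> real) set" where
  "cone_hull a j S 0 = {\<lambda>_. 0}"
| "cone_hull a j S (Suc k) = cone_hull a j S k \<union>
     (\<Union>g\<in>S. (\<lambda>(t, z). a g (\<lambda>i. t * a (j g) z i)) ` ({0..1} \<times> cone_hull a j S k))"

lemma cone_hull_mono: "k \<le> k' \<Longrightarrow> cone_hull a j S k \<subseteq> cone_hull a j S k'"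
  by (rule lift_Suc_mono_le) auto

section \<open>Iterated cones for a continuous action on Euclidean space\<close>

locale continuous_euclid_action = group G for G (structure) +
  fixes n :: nat and a :: "'a \<Rightarrow> (nat \<Rightarrow> real) \<Rightarrow> nat \<Rightarrow> real"
  assumes a_mem: "g \<in> carrier G \<Longrightarrow> y \<in> Rn n \<Longrightarrow> a g y \<in> Rn n"
    and a_one: "y \<in> Rn n \<Longrightarrow> a \<one> y = y"
    and a_mult: "g \<in> carrier G \<Longrightarrow> h \<in> carrier G \<Longrightarrow> y \<in> Rn n \<Longrightarrow> a (g \<otimes> h) y = a g (a h y)"
    and a_cont: "g \<in> carrier G \<Longrightarrow> continuous_on (Rn n) (a g)"
begin

abbreviation "cn \<equiv> iterated_cone a (\<lambda>g. inv g)"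
abbreviation "hull_set \<equiv> cone_hull a (\<lambda>g. inv g)"

lemma a_inv: "g \<in> carrier G \<Longrightarrow> y \<in> Rn n \<Longrightarrow> a (inv g) (a g y) = y" "g \<in> carrier G \<Longrightarrow> y \<in> Rn n \<Longrightarrow> a g (a (inv g) y) = y"
  using a_mult[of "inv g" g y] a_mult[of g "inv g" y] by (auto simp: a_one)

lemma scale_mem: "y \<in> Rn n \<Longrightarrow> (\<lambda>i. t * y i) \<in> Rn n"
  by (simp add: mem_Rn)

lemma cone_hull_Rn: "S \<subseteq> carrier G \<Longrightarrow> hull_set S k \<subseteq> Rn n"
proof (induction k)
  case (Suc k)
  have "a g (\<lambda>i. t * a (inv g) z i) \<in> Rn n" if "g \<in> S" "z \<in> hull_set S k" for g t z
    using Suc that by (intro a_mem scale_mem) auto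
  then show ?case using Suc by auto
qed simp

lemma compact_cone_hull:
  assumes "finite S" "S \<subseteq> carrier G"
  shows "compact (hull_set S k)"
proof (induction k)
  case (Suc k)
  have "compact ((\<lambda>(t, z). a g (\<lambda>i. t * a (inv g) z i)) ` ({0..1} \<times> hull_set S k))" if g: "g \<in> S" for g
  proof (rule compact_continuous_image)
    show "compact ({0..1::real} \<times> hull_set S k)" using Suc by (intro compact_Times) auto
    have gc: "g \<in> carrier G" "inv g \<in> carrier G" using g assms by auto
    let ?I = "{0..1::real} \<times> hull_set S k"
    have sR: "snd ` ?I \<subseteq> Rn n" using cone_hull_Rn[OF assms(2)] by auto
    have "continuous_on ?I (\<lambda>x. a (inv g) (snd x))"
      by (rule continuous_on_compose2[OF a_cont[OF gc(2)] _ sR]) (auto intro: continuous_intros)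
    then have "continuous_on ?I (\<lambda>x. a (inv g) (snd x) i)" for i
      using continuous_on_compose2[OF continuous_on_coord[of UNIV i]] by blast
    then have "continuous_on ?I (\<lambda>x i. fst x * a (inv g) (snd x) i)"
      by (intro continuous_on_coordinatewise_then_product continuous_on_mult continuous_on_fst continuous_on_id)
    moreover have "(\<lambda>x i. fst x * a (inv g) (snd x) i) ` ?I \<subseteq> Rn n"
      using sR gc by (auto intro!: scale_mem a_mem)
    ultimately have "continuous_on ?I (\<lambda>x. a g (\<lambda>i. fst x * a (inv g) (snd x) i))"
      by (rule continuous_on_compose2[OF a_cont[OF gc(1)]])
    then show "continuous_on ?I (\<lambda>(t, z). a g (\<lambda>i. t * a (inv g) z i))"
      by (simp add: case_prod_beta)
  qed
  then show ?case using Suc assms(1) by auto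
qed simp

lemma cone_in_hull:
  assumes "\<And>g. w g \<ge> 0" "set l \<subseteq> S"
  shows "cn w l \<in> hull_set S (length l)"
  using assms(2)
proof (induction l)
  case (Cons g l)
  let ?t = "sum_list (map w l) / (w g + sum_list (map w l))"
  have "sum_list (map w l) \<ge> 0" using assms(1) by (intro sum_list_nonneg) auto
  \<comment> \<open>Also when all the weights vanish, because then the quotient \<open>0 / 0\<close>
    is 0.\<close>
  then have "?t \<in> {0..1}" using assms(1)[of g] by (auto simp: divide_le_eq_1)
  moreover have "cn w l \<in> hull_set S (length l)" "g \<in> S" using Cons by auto
  ultimately have "cn w (g # l) \<in> (\<lambda>(t, z). a g (\<lambda>i. t * a (inv g) z i)) ` ({0..1} \<times> hull_set S (length l))"
    by (intro image_eqI[of _ _ "(?t, cn w l)"]) auto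
  then show ?case unfolding cone_hull.simps length_Cons using \<open>g \<in> S\<close> by blast
qed simp

lemma cone_mem: "(\<And>g. w g \<ge> 0) \<Longrightarrow> set l \<subseteq> carrier G \<Longrightarrow> cn w l \<in> Rn n"
  using cone_in_hull[of w l "carrier G"] cone_hull_Rn[of "carrier G"] by blast

text \<open>Vertices of weight zero do not matter, so only the vertices of positive weight determine the size.\<close>

lemma cone_in_translated_hull:
  assumes w: "\<And>g. w g \<ge> 0" and S: "S \<subseteq> carrier G" and \<gamma>: "\<gamma> \<in> carrier G"
    and l: "distinct l" "set l \<subseteq> carrier G" "sum_list (map w l) > 0"
    and sup: "\<And>g. g \<in> set l \<Longrightarrow> w g > 0 \<Longrightarrow> inv \<gamma> \<otimes> g \<in> S"
  shows "cn w l \<in> a \<gamma> ` hull_set S (card {g \<in> set l. w g > 0})"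
  using l sup
proof (induction l)
  case (Cons g l)
  have nn: "sum_list (map w l) \<ge> 0" using w by (intro sum_list_nonneg) auto
  have g: "g \<in> carrier G" using Cons by auto
  show ?case
  proof (cases "w g > 0")
    case False
    then have wg: "w g = 0" using w[of g] by simp
    then have "sum_list (map w l) > 0" using Cons.prems by simp
    \<comment> \<open>With \<open>w g = 0\<close> the cone parameter is 1, so the contraction does
      nothing and \<open>a g\<close> cancels against its inverse.\<close>
    then have "cn w (g # l) = cn w l"
      using wg a_inv(2)[OF g cone_mem[OF w]] Cons.prems by simp
    moreover have "{x \<in> set (g # l). w x > 0} = {x \<in> set l. w x > 0}" using wg by auto
    ultimately show ?thesis using Cons \<open>sum_list (map w l) > 0\<close> by simp
  next
    case True
    define s where "s = inv \<gamma> \<otimes> g"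
    have s: "s \<in> S" "s \<in> carrier G" using Cons.prems(4)[of g] True S unfolding s_def by auto
    have gs: "g = \<gamma> \<otimes> s" using g \<gamma> by (simp add: s_def m_assoc[symmetric])
    \<comment> \<open>Equivariance of one cone step: with \<open>g = \<gamma> \<otimes> s\<close>,
      the contraction towards the apex of \<open>g\<close> is the translate by
      \<open>\<gamma>\<close> of the contraction towards the apex of \<open>s\<close>, and
      \<open>s\<close> lies in \<open>S\<close>.\<close>
    have step: "a g (\<lambda>i. t * a (inv g) (a \<gamma> z) i) \<in> a \<gamma> ` hull_set S (Suc k)"
      if "t \<in> {0..1}" "z \<in> hull_set S k" for t z k
    proof -
      have z: "z \<in> Rn n" using cone_hull_Rn[OF S] that(2) by blast
      have "inv g \<otimes> \<gamma> = inv s" using s \<gamma> by (simp add: gs inv_mult_group m_assoc)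
      then have "a (inv g) (a \<gamma> z) = a (inv s) z"
        using a_mult[of "inv g" \<gamma> z] g \<gamma> z by simp
      then have "a g (\<lambda>i. t * a (inv g) (a \<gamma> z) i) = a \<gamma> (a s (\<lambda>i. t * a (inv s) z i))"
        using a_mult[OF \<gamma> s(2)] scale_mem[of "a (inv s) z" t] a_mem[of "inv s" z] s z by (simp add: gs)
      moreover have "a s (\<lambda>i. t * a (inv s) z i) \<in> hull_set S (Suc k)"
        using that s(1) by (force intro: image_eqI[of _ _ "(t, z)"])
      ultimately show ?thesis by blast
    qed
    have "{x \<in> set (g # l). w x > 0} = insert g {x \<in> set l. w x > 0}" using True by auto
    moreover have "g \<notin> {x \<in> set l. w x > 0}" using Cons.prems by auto
    ultimately have card: "card {x \<in> set (g # l). w x > 0} = Suc (card {x \<in> set l. w x > 0})" by simp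
    show ?thesis
    proof (cases "sum_list (map w l) = 0")
      case True
      have z: "(\<lambda>_. 0) \<in> hull_set S (card {x \<in> set l. w x > 0})"
        using cone_hull_mono[of 0 "card {x \<in> set l. w x > 0}" a "\<lambda>g. inv g" S] by auto
      have "cn w (g # l) = a g (\<lambda>i. 0 * a (inv g) (a \<gamma> (\<lambda>_. 0)) i)" using True by simp
      then show ?thesis using step[OF _ z, of 0] unfolding card by (simp only:) simp
    next
      case False
      then have pos: "sum_list (map w l) > 0" using nn by simp
      obtain z where z: "z \<in> hull_set S (card {x \<in> set l. w x > 0})" "cn w l = a \<gamma> z"
        using Cons.IH[OF _ _ pos] Cons.prems by auto
      have "sum_list (map w l) / (w g + sum_list (map w l)) \<in> {0..1}"
        using nn w[of g] by (auto simp: divide_le_eq_1)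
      from step[OF this z(1)] show ?thesis unfolding card by (simp only: iterated_cone.simps z(2))
    qed
  qed
qed simp

text \<open>The inner cone is not continuous where the weights of the tail vanish. Exactly there its
  coefficient tends to 0, and its values remain in a compact hull, so the product is
  continuous.\<close>

lemma continuous_on_cone:
  fixes W :: "'a \<Rightarrow> (nat \<Rightarrow> real) \<Rightarrow> real"
  assumes W: "\<And>g y. W g y \<ge> 0" and Wc: "\<And>g. continuous_on U (W g)" and l: "set l \<subseteq> carrier G"
  shows "continuous_on {y \<in> U. sum_list (map (\<lambda>g. W g y) l) > 0} (\<lambda>y. cn (\<lambda>g. W g y) l)"
  using l
proof (induction l)
  case (Cons g l)
  define s where "s y = sum_list (map (\<lambda>g. W g y) l)" for y
  have s0: "s y \<ge> 0" for y unfolding s_def using W by (intro sum_list_nonneg) auto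
  have g: "g \<in> carrier G" "inv g \<in> carrier G" "set l \<subseteq> carrier G" using Cons.prems by auto
  let ?D = "{y \<in> U. W g y + s y > 0}" and ?t = "\<lambda>y. s y / (W g y + s y)"
  have sc: "continuous_on U s"
  proof -
    have "continuous_on U (\<lambda>y. sum_list (map (\<lambda>g. W g y) k))" for k
      by (induction k) (auto intro!: continuous_intros Wc)
    then show ?thesis unfolding s_def .
  qed
  have tc: "continuous_on ?D ?t"
    by (intro continuous_on_divide continuous_on_add continuous_on_subset[OF sc] continuous_on_subset[OF Wc]) auto
  have mem: "a (inv g) (cn (\<lambda>g. W g y) l) \<in> Rn n" for y
    using W g by (intro a_mem cone_mem) auto
  have IH: "continuous_on {y \<in> U. s y > 0} (\<lambda>y. a (inv g) (cn (\<lambda>g. W g y) l))"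
    using Cons.IH[OF g(3)] unfolding s_def
    by (intro continuous_on_compose2[OF a_cont[OF g(2)]]) (auto intro: cone_mem[OF W g(3)])
  have "continuous_on ?D (\<lambda>y. ?t y * a (inv g) (cn (\<lambda>g. W g y) l) i)" for i
  proof -
    have "continuous_on (hull_set (set l) (length l)) (a (inv g))"
      by (rule continuous_on_subset[OF a_cont[OF g(2)] cone_hull_Rn[OF g(3)]])
    then have "continuous_on (hull_set (set l) (length l)) (\<lambda>z. a (inv g) z i)"
      using continuous_on_compose2[OF continuous_on_coord[of UNIV i]] by blast
    then obtain B where B: "\<And>z. z \<in> hull_set (set l) (length l) \<Longrightarrow> \<bar>a (inv g) z i\<bar> \<le> B"
      using compact_imp_abs_bounded[OF compact_cone_hull[OF _ g(3)]] by blast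
    show ?thesis
    proof (rule continuous_on_mult_vanishing[OF tc])
      show "\<bar>a (inv g) (cn (\<lambda>g. W g y) l) i\<bar> \<le> B" for y using W by (intro B cone_in_hull) auto
      show "continuous_on {y \<in> ?D. ?t y \<noteq> 0} (\<lambda>y. a (inv g) (cn (\<lambda>g. W g y) l) i)"
      proof (rule continuous_on_compose2[OF continuous_on_coord[of UNIV i] _ subset_UNIV])
        show "continuous_on {y \<in> ?D. ?t y \<noteq> 0} (\<lambda>y. a (inv g) (cn (\<lambda>g. W g y) l))"
          by (rule continuous_on_subset[OF IH]) (use s0 in \<open>auto simp: less_le\<close>)
      qed
    qed
  qed
  then have "continuous_on ?D (\<lambda>y i. ?t y * a (inv g) (cn (\<lambda>g. W g y) l) i)"
    by (rule continuous_on_coordinatewise_then_product)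
  moreover have "(\<lambda>y i. ?t y * a (inv g) (cn (\<lambda>g. W g y) l) i) ` ?D \<subseteq> Rn n"
    by (intro image_subsetI scale_mem mem)
  ultimately have "continuous_on ?D (\<lambda>y. a g (\<lambda>i. ?t y * a (inv g) (cn (\<lambda>g. W g y) l) i))"
    by (rule continuous_on_compose2[OF a_cont[OF g(1)]])
  then show ?case by (simp add: s_def)
qed simp

end

text \<open>If \<open>n < m\<close>, a coarse right inverse \<open>\<xi>\<close> of \<open>f\<close>
  is built on a ball. What matters is that \<open>f (\<xi> y)\<close> stays within
  \<open>B + R\<close> of \<open>y\<close> with \<open>B\<close> independent of the size of the
  ball; the radius can then be chosen afterwards so that the image covers a unit cube.\<close>

lemma dimension_le:
  fixes G (structure) and f :: "(nat \<Rightarrow> real) \<Rightarrow> nat \<Rightarrow> real"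
  assumes "euclid_action G m \<rho>" "continuous_euclid_action G n a"
    and f_mem: "\<And>y. y \<in> Rn n \<Longrightarrow> f y \<in> Rn m"
    and f_equiv: "\<And>g y. g \<in> carrier G \<Longrightarrow> y \<in> Rn n \<Longrightarrow> f (a g y) = \<rho> g (f y)"
    and f_C1: "\<And>k. k < m \<Longrightarrow> C_on n (Suc 0) (Rn n) (\<lambda>y. f y k)"
  shows "m \<le> n"
proof (rule ccontr)
  assume "\<not> m \<le> n"
  then have nm: "n < m" by simp
  interpret R: euclid_action G m \<rho> by (rule assms(1))
  interpret A: continuous_euclid_action G n a by (rule assms(2))
  let ?o = "\<lambda>i::nat. 0::real"
  have fc: "continuous_on (Rn n) f"
  proof (rule continuous_on_coordinatewise_then_product)
    fix k
    show "continuous_on (Rn n) (\<lambda>y. f y k)"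
    proof (cases "k < m")
      case True
      then show ?thesis using f_C1 C_on_imp_continuous by blast
    next
      case False
      then have "f y k = 0" if "y \<in> Rn n" for y using f_mem[OF that] by (simp add: mem_Rn)
      then show ?thesis using continuous_on_cong[of "Rn n" "Rn n" "\<lambda>y. f y k" "\<lambda>y. 0"] by simp
    qed
  qed
  obtain R where R: "R > 0" "\<And>y. y \<in> Rn m \<Longrightarrow> \<exists>g\<in>carrier G. euclid_dist m (\<rho> g ?o) y < R"
    using R.cobounded by blast
  \<comment> \<open>Tent functions around the points of the orbit of the origin; every point of
    \<open>Rn m\<close> lies in the support of one of them, by the choice of
    \<open>R\<close>.\<close>
  define W where "W g y = max 0 (R - euclid_dist m (\<rho> g ?o) y)" for g y
  have W0: "W g y \<ge> 0" for g y by (simp add: W_def)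
  have Wpos: "W g y > 0 \<longleftrightarrow> euclid_dist m (\<rho> g ?o) y < R" for g y by (auto simp: W_def)
  have Wc: "continuous_on U (W g)" for U g
    unfolding W_def by (intro continuous_on_max continuous_on_diff continuous_on_const continuous_on_euclid_dist)
  \<comment> \<open>Two elements with positive weight at a common point have orbit points less than
    \<open>2 * R\<close> apart, so their quotient lies in this finite set.\<close>
  define S where "S = {g \<in> carrier G. euclid_dist m (\<rho> g ?o) ?o \<le> 2 * R}"
  have S: "finite S" "S \<subseteq> carrier G" using R.finite_near by (auto simp: S_def)
  define C where "C = A.hull_set S (card S)"
  have C: "compact C" "C \<subseteq> Rn n"
    unfolding C_def using A.compact_cone_hull[OF S] A.cone_hull_Rn[OF S(2)] by auto
  have "continuous_on C (\<lambda>z. euclid_dist m ?o (f z))"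
    by (rule continuous_on_compose2[OF continuous_on_euclid_dist continuous_on_subset[OF fc C(2)] subset_UNIV])
  then obtain B where B: "\<And>z. z \<in> C \<Longrightarrow> \<bar>euclid_dist m ?o (f z)\<bar> \<le> B"
    using compact_imp_abs_bounded[OF C(1)] by blast
  \<comment> \<open>\<open>B + R\<close> will bound the displacement of \<open>f (\<xi> y)\<close>,
    \<open>m\<close> bounds the norm of a point of the unit cube, and 1 is slack.\<close>
  define r where "r = B + R + real m + 1"
  have "?o \<in> C" using cone_hull_mono[of 0 "card S" a "\<lambda>g. inv g" S] by (auto simp: C_def)
  then have B0: "B \<ge> 0" using B[of ?o] by linarith
  then have r0: "r > 0" using R(1) by (simp add: r_def)
  \<comment> \<open>Finitely many vertices that include one of positive weight at each point of the
    ball of radius \<open>r\<close>.\<close>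
  obtain l where l: "set l = {g \<in> carrier G. euclid_dist m (\<rho> g ?o) ?o \<le> r + R}" "distinct l"
    using finite_distinct_list[OF R.finite_near] by blast
  have lc: "set l \<subseteq> carrier G" using l by auto
  define D where "D = {y \<in> Rn m. (\<Sum>i<m. (y i)\<^sup>2) \<le> r\<^sup>2}"
  have D: "euclid_dist m ?o y \<le> r" if "y \<in> D" for y
  proof -
    have le: "(\<Sum>i<m. (y i)\<^sup>2) \<le> r\<^sup>2" using that unfolding D_def by blast
    have "(euclid_dist m ?o y)\<^sup>2 = (\<Sum>i<m. (y i)\<^sup>2)" by (subst euclid_dist_sq) simp
    also note le
    finally show ?thesis using r0 by (rule power2_le_imp_le[OF _ less_imp_le])
  qed
  have vertex: "\<exists>g\<in>set l. W g y > 0" if y: "y \<in> D" for y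
  proof -
    obtain g where g: "g \<in> carrier G" "euclid_dist m (\<rho> g ?o) y < R" using R(2) y by (auto simp: D_def)
    then have "euclid_dist m (\<rho> g ?o) ?o \<le> r + R"
      using euclid_dist_triangle[of m "\<rho> g ?o" ?o y] D[OF y] euclid_dist_sym[of m y ?o] by linarith
    then show ?thesis using g l Wpos by auto
  qed
  have Wsum: "sum_list (map (\<lambda>g. W g y) l) > 0" if "y \<in> D" for y
  proof -
    obtain g where "g \<in> set l" "W g y > 0" using vertex[OF \<open>y \<in> D\<close>] by blast
    then have "0 < (\<Sum>g\<in>set l. W g y)" using W0 by (intro sum_pos2[of _ g]) auto
    then show ?thesis using l(2) by (simp add: sum_list_distinct_conv_sum_set)
  qed
  define \<xi> where "\<xi> = (\<lambda>y. A.cn (\<lambda>g. W g y) l)"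
  have \<xi>c: "continuous_on D \<xi>"
    unfolding \<xi>_def
  proof (rule continuous_on_subset[OF A.continuous_on_cone[where W = W and U = D, OF W0 Wc lc]])
    show "D \<subseteq> {y \<in> D. 0 < sum_list (map (\<lambda>g. W g y) l)}" using Wsum by blast
  qed
  have \<xi>_mem: "\<xi> y \<in> Rn n" for y unfolding \<xi>_def by (rule A.cone_mem[OF W0 lc])
  have \<xi>_near: "euclid_dist m (f (\<xi> y)) y < B + R" if y: "y \<in> D" for y
  proof -
    have yR: "y \<in> Rn m" using y by (simp add: D_def)
    obtain \<gamma> where \<gamma>: "\<gamma> \<in> carrier G" "W \<gamma> y > 0" using vertex[OF y] lc by blast
    have supp: "inv \<gamma> \<otimes> g \<in> S" if g: "g \<in> set l" "W g y > 0" for g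
    proof -
      have gc: "g \<in> carrier G" using g lc by blast
      have "\<rho> \<gamma> (\<rho> (inv \<gamma> \<otimes> g) ?o) = \<rho> g ?o"
        using R.mult[of \<gamma> "inv \<gamma> \<otimes> g" ?o] \<gamma>(1) gc by (simp add: R.m_assoc[symmetric])
      then have "euclid_dist m (\<rho> (inv \<gamma> \<otimes> g) ?o) ?o = euclid_dist m (\<rho> g ?o) (\<rho> \<gamma> ?o)"
        using R.dist[OF \<gamma>(1) R.mem[of "inv \<gamma> \<otimes> g" ?o] zero_in_Rn] \<gamma>(1) gc by simp
      also have "\<dots> \<le> 2 * R"
        using euclid_dist_triangle[of m "\<rho> g ?o" "\<rho> \<gamma> ?o" y] euclid_dist_sym[of m y] g(2) \<gamma>(2) Wpos[of g y] Wpos[of \<gamma> y]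
        by auto
      finally show ?thesis using \<gamma>(1) gc by (simp add: S_def)
    qed
    \<comment> \<open>The number of active vertices bounds the depth of the hull. Translation by
      \<open>inv \<gamma>\<close> embeds them into \<open>S\<close>, so the depth is at most
      \<open>card S\<close>, no matter how long \<open>l\<close> is.\<close>
    have "card {g \<in> set l. W g y > 0} \<le> card S"
    proof (rule card_inj_on_le[OF _ _ S(1)])
      show "inj_on (\<lambda>g. inv \<gamma> \<otimes> g) {g \<in> set l. W g y > 0}"
      proof (rule inj_onI)
        fix g g' assume *: "g \<in> {g \<in> set l. W g y > 0}" "g' \<in> {g \<in> set l. W g y > 0}" "inv \<gamma> \<otimes> g = inv \<gamma> \<otimes> g'"
        then have "g \<in> carrier G" "g' \<in> carrier G" using lc by blast+
        then show "g = g'" using \<gamma>(1) *(3) by simp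
      qed
    qed (use supp in auto)
    then have "A.hull_set S (card {g \<in> set l. W g y > 0}) \<subseteq> C"
      unfolding C_def by (rule cone_hull_mono)
    moreover have "\<xi> y \<in> a \<gamma> ` A.hull_set S (card {g \<in> set l. W g y > 0})"
      unfolding \<xi>_def by (rule A.cone_in_translated_hull[OF W0 S(2) \<gamma>(1) l(2) lc Wsum[OF y] supp])
    ultimately obtain z where z: "z \<in> C" "\<xi> y = a \<gamma> z" by blast
    then have zR: "z \<in> Rn n" using C by blast
    \<comment> \<open>\<open>\<xi> y\<close> is the translate by \<open>\<gamma>\<close> of a point
      of the fixed compact set \<open>C\<close>, so equivariance reduces this to the bound
      \<open>B\<close> on \<open>C\<close>.\<close>
    have "euclid_dist m (f (\<xi> y)) (\<rho> \<gamma> ?o) \<le> B"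
      using R.dist[OF \<gamma>(1) f_mem[OF zR] zero_in_Rn] B[OF z(1)] f_equiv[OF \<gamma>(1) zR] z(2) euclid_dist_sym[of m ?o] by simp
    then show ?thesis
      using euclid_dist_triangle[of m "f (\<xi> y)" y "\<rho> \<gamma> ?o"] \<gamma>(2) Wpos by force
  qed
  have "compact D" unfolding D_def by (rule compact_Euclidean_ball)
  have "\<exists>b. \<forall>y\<in>D. \<bar>\<xi> y i\<bar> \<le> b" for i
  proof -
    have "continuous_on D (\<lambda>y. \<xi> y i)"
      using continuous_on_compose2[OF continuous_on_coord[of UNIV i] \<xi>c subset_UNIV] .
    then obtain B where "\<And>y. y \<in> D \<Longrightarrow> \<bar>\<xi> y i\<bar> \<le> B"
      by (rule compact_imp_abs_bounded[OF \<open>compact D\<close>]) blast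
    then show ?thesis by (intro exI[of _ B] ballI)
  qed
  then have "\<forall>i. \<exists>b. \<forall>y\<in>D. \<bar>\<xi> y i\<bar> \<le> b" by blast
  from choice[OF this] obtain b where b: "\<And>i y. y \<in> D \<Longrightarrow> \<bar>\<xi> y i\<bar> \<le> b i" by blast
  define q where "q = (\<Sum>i<n. \<bar>b i\<bar>)"
  have \<xi>_box: "\<xi> y \<in> {x \<in> Rn n. \<forall>i<n. \<bar>x i\<bar> \<le> q}" if "y \<in> D" for y
  proof -
    have "\<bar>\<xi> y i\<bar> \<le> q" if "i < n" for i
    proof -
      have "\<bar>b i\<bar> \<le> q" unfolding q_def using that by (intro member_le_sum) auto
      then show ?thesis using b[OF \<open>y \<in> D\<close>, of i] by linarith
    qed
    then show ?thesis using \<xi>_mem by simp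
  qed
  define P where "P k L \<longleftrightarrow> (\<forall>x y d. x \<in> Rn n \<longrightarrow> y \<in> Rn n \<longrightarrow> (\<forall>i<n. \<bar>x i\<bar> \<le> q) \<longrightarrow> (\<forall>i<n. \<bar>y i\<bar> \<le> q) \<longrightarrow>
     (\<forall>i<n. \<bar>y i - x i\<bar> \<le> d) \<longrightarrow> \<bar>f y k - f x k\<bar> \<le> L * d)" for k L
  have "\<exists>L\<ge>0. P k L" if "k < m" for k
  proof (rule C1_Lipschitz[OF f_C1[OF that], of q])
    fix L assume L: "0 \<le> L"
      "\<And>x y d. x \<in> Rn n \<Longrightarrow> y \<in> Rn n \<Longrightarrow> \<forall>i<n. \<bar>x i\<bar> \<le> q \<Longrightarrow> \<forall>i<n. \<bar>y i\<bar> \<le> q \<Longrightarrow>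
        \<forall>i<n. \<bar>y i - x i\<bar> \<le> d \<Longrightarrow> \<bar>f y k - f x k\<bar> \<le> L * d"
    have "P k L" unfolding P_def by (intro allI impI) (rule L(2))
    with L(1) show ?thesis by blast
  qed
  then have "\<forall>k. \<exists>L. k < m \<longrightarrow> 0 \<le> L \<and> P k L" by blast
  from choice[OF this] obtain L where L: "\<And>k. k < m \<Longrightarrow> L k \<ge> 0" "\<And>k. k < m \<Longrightarrow> P k (L k)" by blast
  define L' where "L' = (\<Sum>k<m. L k)"
  have L'0: "L' \<ge> 0" unfolding L'_def using L(1) by (intro sum_nonneg) auto
  have L'k: "L k \<le> L'" if "k < m" for k unfolding L'_def using that L(1) by (intro member_le_sum) auto
  have nv: "\<exists>x. x \<in> Rn n \<and> (\<forall>i<n. \<bar>x i\<bar> \<le> q) \<and> f x = z" if z: "z \<in> Rn m" "\<forall>k<m. 0 \<le> z k \<and> z k \<le> 1" for z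
  proof -
    \<comment> \<open>The value \<open>z\<close> is attained as a zero of
      \<open>f (\<xi> y) - z\<close>, still a perturbation of the identity by less than
      \<open>r\<close>.\<close>
    have "\<exists>y\<in>Rn m. (\<Sum>i<m. (y i)\<^sup>2) \<le> r\<^sup>2 \<and> (\<lambda>i. f (\<xi> y) i - z i) = ?o"
    proof (rule near_identity_has_zero[OF r0])
      have "continuous_on D (\<lambda>y. f (\<xi> y))"
        by (rule continuous_on_compose2[OF fc \<xi>c]) (use \<xi>_mem in auto)
      then have "continuous_on D (\<lambda>y. f (\<xi> y) i)" for i
        using continuous_on_compose2[OF continuous_on_coord[of UNIV i]] by blast
      then have "continuous_on D (\<lambda>y i. f (\<xi> y) i - z i)"
        by (intro continuous_on_coordinatewise_then_product continuous_on_diff continuous_on_const)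
      then show "continuous_on {y \<in> Rn m. (\<Sum>i<m. (y i)\<^sup>2) \<le> r\<^sup>2} (\<lambda>y i. f (\<xi> y) i - z i)"
        unfolding D_def .
      fix y assume "y \<in> Rn m" "(\<Sum>i<m. (y i)\<^sup>2) \<le> r\<^sup>2"
      then have y: "y \<in> D" by (simp add: D_def)
      show "(\<lambda>i. f (\<xi> y) i - z i) \<in> Rn m" using f_mem[OF \<xi>_mem[of y]] z(1) by (simp add: mem_Rn)
      have "euclid_dist m (\<lambda>i. f (\<xi> y) i - z i) (f (\<xi> y)) \<le> real m * 1"
        using z(2) by (intro euclid_dist_le) auto
      then show "euclid_dist m (\<lambda>i. f (\<xi> y) i - z i) y < r"
        using euclid_dist_triangle[of m "\<lambda>i. f (\<xi> y) i - z i" y "f (\<xi> y)"] \<xi>_near[OF y] by (simp add: r_def)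
    qed
    then obtain y where y: "y \<in> D" "(\<lambda>i. f (\<xi> y) i - z i) = ?o" by (auto simp: D_def)
    then have "f (\<xi> y) = z" by (simp add: fun_eq_iff)
    then show ?thesis using \<xi>_box[OF y(1)] by blast
  qed
  have "\<bar>f y k - f x k\<bar> \<le> L' * d"
    if "k < m" "x \<in> Rn n" "y \<in> Rn n" "\<forall>i<n. \<bar>x i\<bar> \<le> q" "\<forall>i<n. \<bar>y i\<bar> \<le> q" "d \<ge> 0" "\<forall>i<n. \<bar>y i - x i\<bar> \<le> d" for x y d k
  proof -
    have "\<bar>f y k - f x k\<bar> \<le> L k * d" using L(2)[OF that(1)] that(2-5,7) unfolding P_def by blast
    also have "\<dots> \<le> L' * d" using L'k[OF that(1)] that(6) by (rule mult_right_mono)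
    finally show ?thesis .
  qed
  then have "\<not> {z \<in> Rn m. \<forall>k<m. 0 \<le> z k \<and> z k \<le> 1} \<subseteq> f ` {x \<in> Rn n. \<forall>i<n. \<bar>x i\<bar> \<le> q}"
    by (rule Lipschitz_image_not_cube[OF nm L'0])
  moreover have "{z \<in> Rn m. \<forall>k<m. 0 \<le> z k \<and> z k \<le> 1} \<subseteq> f ` {x \<in> Rn n. \<forall>i<n. \<bar>x i\<bar> \<le> q}"
  proof
    fix z assume "z \<in> {z \<in> Rn m. \<forall>k<m. 0 \<le> z k \<and> z k \<le> 1}"
    then obtain x where "x \<in> Rn n" "\<forall>i<n. \<bar>x i\<bar> \<le> q" "f x = z" using nv[of z] by blast
    then show "z \<in> f ` {x \<in> Rn n. \<forall>i<n. \<bar>x i\<bar> \<le> q}" by (intro image_eqI[of _ _ x]) auto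
  qed
  ultimately show False by (rule notE)
qed

section \<open>Smooth functions on manifolds\<close>

definition smooth_fun :: "'a manifold \<Rightarrow> ('a \<Rightarrow> real) \<Rightarrow> bool" where
  "smooth_fun M f \<longleftrightarrow> (\<forall>c\<in>atlas M. smooth_on (mdim M) (snd c ` fst c) (\<lambda>y. f (chart_inv c y)))"

definition coord_deriv :: "'a chart \<Rightarrow> ('a \<Rightarrow> real) \<Rightarrow> 'a \<Rightarrow> nat \<Rightarrow> real" where
  "coord_deriv c f p i = partial_deriv i (\<lambda>y. f (chart_inv c y)) (snd c p)"

lemma jacobian_entry_eq: "jacobian_entry c d f p a i = coord_deriv c (\<lambda>q. snd d (f q) a) p i"
  by (simp add: jacobian_entry_def coord_deriv_def)

text \<open>The topological part of being a manifold, shared by \<open>M\<close> and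
  \<open>euclid n\<close>. Smooth compatibility of charts enters separately, as smoothness of the
  identity map.\<close>

locale charted =
  fixes M :: "'a manifold"
  assumes charts: "c \<in> atlas M \<Longrightarrow> is_chart (mdim M) (mtop M) c"
    and cover: "(\<Union>c\<in>atlas M. fst c) = topspace (mtop M)"
begin

lemma chart_sub: "c \<in> atlas M \<Longrightarrow> fst c \<subseteq> topspace (mtop M)"
  using cover by blast

lemma chart_open: "c \<in> atlas M \<Longrightarrow> openin (mtop M) (fst c)"
  using charts by (simp add: is_chart_def)

lemma chart_homeo: "c \<in> atlas M \<Longrightarrow> homeomorphic_map (subtopology (mtop M) (fst c))
       (subtopology (Euclidean_space (mdim M)) (snd c ` fst c)) (snd c)"
  using charts unfolding is_chart_def by blast

lemma chart_inj: "c \<in> atlas M \<Longrightarrow> inj_on (snd c) (fst c)"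
  using homeomorphic_imp_injective_map[OF chart_homeo] chart_sub
  by (simp add: Int_absorb1 topspace_subtopology)

lemma chart_inv_app: "c \<in> atlas M \<Longrightarrow> p \<in> fst c \<Longrightarrow> chart_inv c (snd c p) = p"
  unfolding chart_inv_def using chart_inj by (rule inv_into_f_f)

lemma chart_inv_mem: "y \<in> snd c ` A \<Longrightarrow> c \<in> atlas M \<Longrightarrow> A \<subseteq> fst c \<Longrightarrow> chart_inv c y \<in> A"
  using chart_inv_app by fastforce

lemma app_chart_inv: "y \<in> snd c ` fst c \<Longrightarrow> snd c (chart_inv c y) = y"
  unfolding chart_inv_def by (rule f_inv_into_f)

lemma chart_image_open:
  assumes c: "c \<in> atlas M" and W: "openin (mtop M) W"
  shows "openin (Euclidean_space (mdim M)) (snd c ` (fst c \<inter> W))"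
proof -
  have "openin (subtopology (mtop M) (fst c)) (fst c \<inter> W)"
    using W openin_subtopology_Int2 by blast
  then have "openin (subtopology (Euclidean_space (mdim M)) (snd c ` fst c)) (snd c ` (fst c \<inter> W))"
    using homeomorphic_imp_open_map[OF chart_homeo[OF c]] unfolding open_map_def by blast
  moreover have "openin (Euclidean_space (mdim M)) (snd c ` fst c)"
    using charts[OF c] by (simp add: is_chart_def)
  ultimately show ?thesis by (rule openin_trans_full)
qed

lemma chart_image_open': "c \<in> atlas M \<Longrightarrow> openin (Euclidean_space (mdim M)) (snd c ` fst c)"
  using charts by (simp add: is_chart_def)

lemma smooth_funD: "smooth_fun M f \<Longrightarrow> c \<in> atlas M \<Longrightarrow> smooth_on (mdim M) (snd c ` fst c) (\<lambda>y. f (chart_inv c y))"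
  by (simp add: smooth_fun_def)

lemma smooth_fun_const: "smooth_fun M (\<lambda>p. k)"
  by (simp add: smooth_fun_def smooth_on_const)

lemma smooth_fun_mult: "smooth_fun M f \<Longrightarrow> smooth_fun M g \<Longrightarrow> smooth_fun M (\<lambda>p. f p * g p)"
  by (simp add: smooth_fun_def smooth_on_mult chart_image_open')

lemma smooth_fun_diff: "smooth_fun M f \<Longrightarrow> smooth_fun M g \<Longrightarrow> smooth_fun M (\<lambda>p. f p - g p)"
  by (simp add: smooth_fun_def smooth_on_diff chart_image_open')

lemma smooth_fun_sum: "(\<And>a. a \<in> A \<Longrightarrow> smooth_fun M (f a)) \<Longrightarrow> smooth_fun M (\<lambda>p. \<Sum>a\<in>A. f a p)"
  by (simp add: smooth_fun_def smooth_on_sum chart_image_open')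

lemma smooth_fun_bump: "smooth_fun M f \<Longrightarrow> smooth_fun M (\<lambda>p. bump (f p))"
  by (simp add: smooth_fun_def smooth_on_bump chart_image_open')

lemma smooth_fun_inverse:
  assumes "smooth_fun M f" "\<And>p. p \<in> topspace (mtop M) \<Longrightarrow> f p \<noteq> 0"
  shows "smooth_fun M (\<lambda>p. inverse (f p))"
  unfolding smooth_fun_def
proof
  fix c assume c: "c \<in> atlas M"
  show "smooth_on (mdim M) (snd c ` fst c) (\<lambda>y. inverse (f (chart_inv c y)))"
  proof (rule smooth_on_inverse[OF chart_image_open'[OF c] smooth_funD[OF assms(1) c]])
    fix y assume "y \<in> snd c ` fst c"
    then have "chart_inv c y \<in> fst c" using c by (rule chart_inv_mem) simp
    then show "f (chart_inv c y) \<noteq> 0" using assms(2) chart_sub[OF c] by blast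
  qed
qed

lemma smooth_fun_local:
  assumes "\<And>p. p \<in> topspace (mtop M) \<Longrightarrow> \<exists>W g. openin (mtop M) W \<and> p \<in> W \<and> smooth_fun M g \<and> (\<forall>q\<in>W. f q = g q)"
  shows "smooth_fun M f"
  unfolding smooth_fun_def
proof
  fix c assume c: "c \<in> atlas M"
  show "smooth_on (mdim M) (snd c ` fst c) (\<lambda>y. f (chart_inv c y))"
  proof (rule smooth_on_local[OF chart_image_open'[OF c]])
    fix y assume y: "y \<in> snd c ` fst c"
    then obtain p where p: "p \<in> fst c" "y = snd c p" by blast
    then obtain W g where W: "openin (mtop M) W" "p \<in> W" "smooth_fun M g" "\<forall>q\<in>W. f q = g q"
      using assms chart_sub[OF c] by blast
    show "\<exists>V h. openin (Euclidean_space (mdim M)) V \<and> y \<in> V \<and> smooth_on (mdim M) V h \<and> (\<forall>z\<in>V. f (chart_inv c z) = h z)"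
    proof (intro exI conjI ballI)
      show "openin (Euclidean_space (mdim M)) (snd c ` (fst c \<inter> W))" by (rule chart_image_open[OF c W(1)])
      show "y \<in> snd c ` (fst c \<inter> W)" using p W(2) by blast
      show "smooth_on (mdim M) (snd c ` (fst c \<inter> W)) (\<lambda>y. g (chart_inv c y))"
        by (rule smooth_on_subset[OF smooth_funD[OF W(3) c]]) blast
      fix z assume "z \<in> snd c ` (fst c \<inter> W)"
      then have "chart_inv c z \<in> fst c \<inter> W" using c by (rule chart_inv_mem) blast
      then show "f (chart_inv c z) = g (chart_inv c z)" using W(4) by blast
    qed
  qed
qed

lemma smooth_fun_continuous:
  assumes "smooth_fun M f"
  shows "continuous_map (mtop M) euclideanreal f"
  unfolding continuous_map_def
proof (intro conjI allI impI)
  fix U assume U: "openin euclideanreal U"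
  have "openin (mtop M) {p \<in> fst c. f p \<in> U}" if c: "c \<in> atlas M" for c
  proof -
    let ?I = "snd c ` fst c"
    have "continuous_on ?I (\<lambda>y. f (chart_inv c y))"
      using smooth_funD[OF assms c] unfolding smooth_on_def by (metis C_on_imp_continuous)
    then obtain T where T: "open T" "T \<inter> ?I = (\<lambda>y. f (chart_inv c y)) -` U \<inter> ?I"
      using U unfolding continuous_on_open_invariant open_openin[symmetric] by blast
    obtain T' where T': "open T'" "?I = Rn (mdim M) \<inter> T'"
      using chart_image_open'[OF c] unfolding openin_Euclidean_space by blast
    have "openin (subtopology (Euclidean_space (mdim M)) ?I) (?I \<inter> T)"
    proof -
      have "openin (Euclidean_space (mdim M)) (?I \<inter> T)"
        unfolding openin_Euclidean_space using T(1) T' by (intro exI[of _ "T' \<inter> T"]) auto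
      then show ?thesis using openin_subtopology_Int2[of _ "?I \<inter> T" ?I] by (simp add: Int_assoc[symmetric])
    qed
    then have "openin (subtopology (mtop M) (fst c))
        {p \<in> topspace (subtopology (mtop M) (fst c)). snd c p \<in> ?I \<inter> T}"
      using homeomorphic_imp_continuous_map[OF chart_homeo[OF c]] unfolding continuous_map_def by blast
    moreover have "{p \<in> topspace (subtopology (mtop M) (fst c)). snd c p \<in> ?I \<inter> T} = {p \<in> fst c. f p \<in> U}"
    proof -
      have "snd c p \<in> ?I \<inter> T \<longleftrightarrow> f p \<in> U" if "p \<in> fst c" for p
      proof -
        have "snd c p \<in> T \<inter> ?I \<longleftrightarrow> snd c p \<in> (\<lambda>y. f (chart_inv c y)) -` U \<inter> ?I" unfolding T(2) ..
        then show ?thesis using that chart_inv_app[OF c that] by simp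
      qed
      then show ?thesis using chart_sub[OF c] by (auto simp: topspace_subtopology)
    qed
    ultimately show ?thesis using chart_open[OF c] by (metis openin_trans_full)
  qed
  then have "openin (mtop M) (\<Union>c\<in>atlas M. {p \<in> fst c. f p \<in> U})" by blast
  moreover have "(\<Union>c\<in>atlas M. {p \<in> fst c. f p \<in> U}) = {p \<in> topspace (mtop M). f p \<in> U}"
    using cover by blast
  ultimately show "openin (mtop M) {p \<in> topspace (mtop M). f p \<in> U}" by simp
qed simp

lemma smooth_fun_DERIV:
  assumes "smooth_fun M f" "c \<in> atlas M" "p \<in> fst c" "i < mdim M"
  shows "DERIV (\<lambda>t. f (chart_inv c ((snd c p)(i := t)))) (snd c p i) :> coord_deriv c f p i"
  unfolding coord_deriv_def
  by (rule smooth_on_DERIV[OF smooth_funD[OF assms(1,2)] _ assms(4)]) (use assms(3) in blast)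

lemma coord_deriv_eqI:
  "DERIV (\<lambda>t. f (chart_inv c ((snd c p)(i := t)))) (snd c p i) :> d \<Longrightarrow> coord_deriv c f p i = d"
  unfolding coord_deriv_def by (rule partial_deriv_eqI)

lemma coord_deriv_real_compose:
  assumes "smooth_fun M f" "c \<in> atlas M" "p \<in> fst c" "i < mdim M" "DERIV s (f p) :> s'"
  shows "coord_deriv c (\<lambda>q. s (f q)) p i = s' * coord_deriv c f p i"
proof (rule coord_deriv_eqI)
  have "DERIV s (f (chart_inv c ((snd c p)(i := snd c p i)))) :> s'"
    using assms(5) chart_inv_app[OF assms(2,3)] by simp
  from DERIV_chain2[OF this smooth_fun_DERIV[OF assms(1-4)]]
  show "DERIV (\<lambda>t. s (f (chart_inv c ((snd c p)(i := t))))) (snd c p i) :> s' * coord_deriv c f p i" .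
qed

lemma coord_deriv_affine:
  assumes "\<And>l. l \<in> A \<Longrightarrow> smooth_fun M (f l)" "c \<in> atlas M" "p \<in> fst c" "i < mdim M"
  shows "coord_deriv c (\<lambda>q. b + (\<Sum>l\<in>A. k l * f l q)) p i = (\<Sum>l\<in>A. k l * coord_deriv c (f l) p i)"
proof (rule coord_deriv_eqI)
  have "DERIV (\<lambda>t. \<Sum>l\<in>A. k l * f l (chart_inv c ((snd c p)(i := t)))) (snd c p i) :> (\<Sum>l\<in>A. k l * coord_deriv c (f l) p i)"
    by (intro DERIV_sum DERIV_cmult smooth_fun_DERIV assms)
  from DERIV_add[OF DERIV_const[of b] this]
  show "DERIV (\<lambda>t. b + (\<Sum>l\<in>A. k l * f l (chart_inv c ((snd c p)(i := t))))) (snd c p i) :> (\<Sum>l\<in>A. k l * coord_deriv c (f l) p i)"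
    by simp
qed

lemma coord_deriv_cong:
  assumes c: "c \<in> atlas M" and W: "openin (mtop M) W" "p \<in> W" "p \<in> fst c" and i: "i < mdim M"
    and eq: "\<And>q. q \<in> W \<Longrightarrow> q \<in> fst c \<Longrightarrow> f q = g q"
  shows "coord_deriv c f p i = coord_deriv c g p i"
  unfolding coord_deriv_def
proof (rule partial_deriv_cong[OF chart_image_open[OF c W(1)] _ i])
  show "snd c p \<in> snd c ` (fst c \<inter> W)" using W by blast
  fix y assume "y \<in> snd c ` (fst c \<inter> W)"
  then have "chart_inv c y \<in> fst c \<inter> W" using c by (rule chart_inv_mem) blast
  then show "f (chart_inv c y) = g (chart_inv c y)" using eq by blast
qed

lemma smooth_map_preimage_open:
  assumes "continuous_map (mtop M) Y f" "openin Y W" "c \<in> atlas M"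
  shows "openin (Euclidean_space (mdim M)) (snd c ` (fst c \<inter> f -` W))"
proof -
  have "fst c \<inter> f -` W = fst c \<inter> {p \<in> topspace (mtop M). f p \<in> W}" using chart_sub[OF assms(3)] by blast
  moreover have "openin (mtop M) {p \<in> topspace (mtop M). f p \<in> W}"
    using assms(1,2) unfolding continuous_map_def by blast
  ultimately show ?thesis using chart_image_open[OF assms(3)] by simp
qed

end

lemma smooth_manifold_charted: "smooth_manifold M \<Longrightarrow> charted M"
  unfolding smooth_manifold_def charted_def by blast

lemma charted_euclid: "charted (euclid n)"
proof
  fix c assume "c \<in> atlas (euclid n)"
  then have c: "c = (Rn n, \<lambda>x. x)" by (simp add: euclid_def)
  have "homeomorphic_map (Euclidean_space n) (Euclidean_space n) (\<lambda>x. x)"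
    using homeomorphic_map_id[of "Euclidean_space n"] by (simp add: id_def)
  then show "is_chart (mdim (euclid n)) (mtop (euclid n)) c"
    unfolding is_chart_def c by (simp add: euclid_def subtopology_topspace)
qed (simp add: euclid_def)

lemma chart_inv_euclid: "y \<in> Rn n \<Longrightarrow> chart_inv (Rn n, \<lambda>x. x) y = y"
  unfolding chart_inv_def fst_conv snd_conv using inv_into_f_f[of "\<lambda>x. x" "Rn n" y] by (simp only: inj_on_id2)

lemma smooth_fun_euclid:
  assumes "smooth_fun (euclid n) f" shows "smooth_on n (Rn n) f"
proof -
  have "smooth_on n (Rn n) (\<lambda>y. f (chart_inv (Rn n, \<lambda>x. x) y))"
    using assms by (simp only: smooth_fun_def euclid_def manifold.select_convs ball_simps image_ident fst_conv snd_conv simp_thms)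
  then show ?thesis
    using C_on_cong[of n "Rn n" "\<lambda>y. f (chart_inv (Rn n, \<lambda>x. x) y)" f] chart_inv_euclid
    unfolding smooth_on_def by (metis openin_topspace)
qed

context charted
begin

lemma smooth_map_euclid_iff:
  assumes mem: "\<And>p. p \<in> topspace (mtop M) \<Longrightarrow> f p \<in> Rn D"
  shows "smooth_map M (euclid D) f \<longleftrightarrow>
    continuous_map (mtop M) (Euclidean_space D) f \<and> (\<forall>a<D. smooth_fun M (\<lambda>p. f p a))"
proof -
  have "fst c \<inter> f -` Rn D = fst c" if "c \<in> atlas M" for c using mem chart_sub[OF that] by blast
  then show ?thesis
    unfolding smooth_map_def smooth_fun_def euclid_def by auto
qed

end

locale charted_map = M: charted M + N: charted N for M :: "'a manifold" and N :: "'b manifold" +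
  fixes f :: "'a \<Rightarrow> 'b"
  assumes smooth: "smooth_map M N f"
begin

lemma cont: "continuous_map (mtop M) (mtop N) f"
  using smooth by (simp add: smooth_map_def)

lemma coords_smooth:
  "c \<in> atlas M \<Longrightarrow> d \<in> atlas N \<Longrightarrow> a < mdim N \<Longrightarrow>
    smooth_on (mdim M) (snd c ` (fst c \<inter> f -` fst d)) (\<lambda>y. snd d (f (chart_inv c y)) a)"
  using smooth by (simp add: smooth_map_def)

lemma coords_mem:
  "y \<in> snd c ` (fst c \<inter> f -` fst d) \<Longrightarrow> c \<in> atlas M \<Longrightarrow> f (chart_inv c y) \<in> fst d"
  using M.chart_inv_mem[of y c "fst c \<inter> f -` fst d"] by blast

lemma smooth_fun_compose:
  assumes h: "smooth_fun N h"
  shows "smooth_fun M (\<lambda>p. h (f p))"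
  unfolding smooth_fun_def
proof
  fix c assume c: "c \<in> atlas M"
  show "smooth_on (mdim M) (snd c ` fst c) (\<lambda>y. h (f (chart_inv c y)))"
  proof (rule smooth_on_local[OF M.chart_image_open'[OF c]])
    fix y assume "y \<in> snd c ` fst c"
    then obtain p where p: "p \<in> fst c" "y = snd c p" by blast
    have "f p \<in> topspace (mtop N)" using cont p(1) M.chart_sub[OF c] unfolding continuous_map_def by blast
    then obtain d where d: "d \<in> atlas N" "f p \<in> fst d" using N.cover by blast
    let ?U = "snd c ` (fst c \<inter> f -` fst d)"
    have U: "openin (Euclidean_space (mdim M)) ?U"
      by (rule M.smooth_map_preimage_open[OF cont N.chart_open[OF d(1)] c])
    have "smooth_on (mdim M) ?U (\<lambda>y. h (chart_inv d (snd d (f (chart_inv c y)))))"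
    proof (rule smooth_on_compose[OF N.chart_image_open'[OF d(1)] U, of "\<lambda>y. snd d (f (chart_inv c y))" "\<lambda>z. h (chart_inv d z)"])
      show "snd d (f (chart_inv c y)) \<in> snd d ` fst d" if "y \<in> ?U" for y
        using coords_mem[OF that c] by blast
    qed (use coords_smooth[OF c d(1)] N.smooth_funD[OF h d(1)] in auto)
    moreover have "h (f (chart_inv c z)) = h (chart_inv d (snd d (f (chart_inv c z))))" if "z \<in> ?U" for z
      using N.chart_inv_app[OF d(1) coords_mem[OF that c]] by simp
    moreover have "y \<in> ?U" using p d(2) by blast
    ultimately show "\<exists>V g. openin (Euclidean_space (mdim M)) V \<and> y \<in> V \<and> smooth_on (mdim M) V g \<and> (\<forall>z\<in>V. h (f (chart_inv c z)) = g z)"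
      using U by blast
  qed
qed

lemma coord_deriv_compose:
  assumes h: "smooth_fun N h" and c: "c \<in> atlas M" "p \<in> fst c" and d: "d \<in> atlas N" "f p \<in> fst d" and i: "i < mdim M"
  shows "coord_deriv c (\<lambda>p. h (f p)) p i = (\<Sum>a<mdim N. coord_deriv d h (f p) a * jacobian_entry c d f p a i)"
proof -
  let ?U = "snd c ` (fst c \<inter> f -` fst d)" and ?F = "\<lambda>y. snd d (f (chart_inv c y))"
  have U: "openin (Euclidean_space (mdim M)) ?U"
    by (rule M.smooth_map_preimage_open[OF cont N.chart_open[OF d(1)] c(1)])
  have pU: "snd c p \<in> ?U" using c d by blast
  have "coord_deriv c (\<lambda>p. h (f p)) p i = partial_deriv i (\<lambda>y. h (chart_inv d (?F y))) (snd c p)"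
    unfolding coord_deriv_def
    by (rule partial_deriv_cong[OF U pU i]) (use N.chart_inv_app[OF d(1) coords_mem[OF _ c(1)]] in simp)
  also have "\<dots> = (\<Sum>a<mdim N. partial_deriv a (\<lambda>z. h (chart_inv d z)) (?F (snd c p)) * partial_deriv i (\<lambda>y. ?F y a) (snd c p))"
  proof (rule partial_deriv_compose[OF N.smooth_funD[OF h d(1)] N.chart_image_open'[OF d(1)] U pU i])
    show "?F (snd c p) \<in> snd d ` fst d" using coords_mem[OF pU c(1)] by blast
    show "?F y \<in> Rn (mdim N)" if "y \<in> ?U" for y
      using openin_subset[OF N.chart_image_open'[OF d(1)]] coords_mem[OF that c(1)] by blast
  qed (use coords_smooth[OF c(1) d(1)] in auto)
  also have "?F (snd c p) = snd d (f p)" using M.chart_inv_app[OF c] by simp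
  finally show ?thesis by (simp add: coord_deriv_def jacobian_entry_def)
qed

end


section \<open>The equivariant map to Euclidean space\<close>

lemma compactin_Euclidean_ball: "compactin (Euclidean_space n) {y \<in> Rn n. (\<Sum>i<n. (y i)\<^sup>2) \<le> r}"
proof -
  let ?B = "{y \<in> Rn n. (\<Sum>i<n. (y i)\<^sup>2) \<le> r}"
  have "compactin (powertop_real UNIV) ?B"
    using compact_Euclidean_ball by (simp only: euclidean_product_topology compactin_euclidean_iff)
  moreover have "?B \<subseteq> {x. \<forall>i\<ge>n. x i = 0}" unfolding mem_Rn by blast
  ultimately show ?thesis
    unfolding Euclidean_space_def[of n] compactin_subtopology topspace_subtopology by simp
qed

text \<open>The weighted mean of the points \<open>\<rho> g 0\<close>. The weights are translates of
  a single function, so acting on \<open>p\<close> permutes them, and an affine map commutes with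
  weighted means.\<close>

lemma equivariant_map_exists:
  fixes G (structure)
  assumes ch: "charted M" and F: "diffeomorphism M (euclid n) F"
    and ga: "group_action G (topspace (mtop M)) act"
    and sm: "\<And>g. g \<in> carrier G \<Longrightarrow> smooth_map M M (act g)"
    and pd: "properly_discontinuous G (mtop M) act" and cc: "cocompact G (mtop M) act"
    and ea: "euclid_action G m \<rho>"
  obtains \<phi> where "\<And>k. k < m \<Longrightarrow> smooth_fun M (\<lambda>p. \<phi> p k)"
    "\<And>p. \<phi> p \<in> Rn m"
    "\<And>g p. g \<in> carrier G \<Longrightarrow> p \<in> topspace (mtop M) \<Longrightarrow> \<phi> (act g p) = \<rho> g (\<phi> p)"
proof -
  interpret charted M by (rule ch)
  interpret R: euclid_action G m \<rho> by (rule ea)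
  interpret A: group_action G "topspace (mtop M)" act by (rule ga)
  let ?X = "topspace (mtop M)" and ?o = "\<lambda>i::nat. 0::real"
  have act_mem: "act g p \<in> ?X" if "g \<in> carrier G" "p \<in> ?X" for g p
    using A.element_image[OF that] by blast
  have act_mult: "act (g \<otimes> h) p = act g (act h p)" if "g \<in> carrier G" "h \<in> carrier G" "p \<in> ?X" for g h p
    using A.composition_rule[OF that(3,1,2)] .
  have act_one: "act \<one> p = p" if "p \<in> ?X" for p
    using fun_cong[OF A.id_eq_one, of p] that by simp
  have act_inv: "act (inv g) (act g p) = p" "act g (act (inv g) p) = p" if "g \<in> carrier G" "p \<in> ?X" for g p
    using act_mult[of "inv g" g p] act_mult[of g "inv g" p] act_one that by auto
  have Fs: "smooth_map M (euclid n) F" and Fb: "bij_betw F ?X (Rn n)"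
    and Gs: "smooth_map (euclid n) M (inv_into ?X F)"
    using F by (auto simp: diffeomorphism_def euclid_def)
  have Fm: "F p \<in> Rn n" if "p \<in> ?X" for p using Fb that by (auto simp: bij_betw_def)
  \<comment> \<open>A proper function: its sublevel sets are the preimages of closed balls, hence
    compact.\<close>
  define f where "f p = (\<Sum>a<n. (F p a)\<^sup>2)" for p
  have "smooth_fun M (\<lambda>p. F p a)" if "a < n" for a
    using Fs smooth_map_euclid_iff[of F n, OF Fm] that by blast
  then have fs: "smooth_fun M f"
    unfolding f_def power2_eq_square by (intro smooth_fun_sum smooth_fun_mult) auto
  have fc: "continuous_map (mtop M) euclideanreal f" by (rule smooth_fun_continuous[OF fs])
  have comp: "smooth_fun M (\<lambda>p. h (act g p))" if "smooth_fun M h" "g \<in> carrier G" for h g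
  proof -
    interpret charted_map M M "act g" by unfold_locales (rule sm[OF that(2)])
    show ?thesis by (rule smooth_fun_compose[OF that(1)])
  qed
  have "openin (mtop M) {x \<in> ?X. \<exists>g\<in>carrier G. f (act g x) < real k}" for k :: nat
  proof -
    have "openin (mtop M) {x \<in> ?X. f (act g x) \<in> {..<real k}}" if "g \<in> carrier G" for g
      using smooth_fun_continuous[OF comp[OF fs that]] unfolding continuous_map_def
      by (metis open_lessThan open_openin)
    then have "openin (mtop M) (\<Union>g\<in>carrier G. {x \<in> ?X. f (act g x) \<in> {..<real k}})" by blast
    moreover have "(\<Union>g\<in>carrier G. {x \<in> ?X. f (act g x) \<in> {..<real k}}) = {x \<in> ?X. \<exists>g\<in>carrier G. f (act g x) < real k}"
      by blast
    ultimately show ?thesis by simp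
  qed
  then obtain R :: nat where R: "\<And>x. x \<in> ?X \<Longrightarrow> \<exists>g\<in>carrier G. f (act g x) < real R"
    using cocompact_exhaustion[OF cc A.orbit_refl, of f] by blast
  \<comment> \<open>The weight of \<open>g\<close> at \<open>p\<close> is read off at
    \<open>act (inv g) p\<close>, so that \<open>w (h \<otimes> g) (act h p) = w g p\<close>. By the
    choice of \<open>R\<close>, at least one weight is positive at each point.\<close>
  define w where "w g p = bump (real R - f (act (inv g) p))" for g p
  have ws: "smooth_fun M (w g)" if "g \<in> carrier G" for g
    unfolding w_def using that by (intro smooth_fun_bump smooth_fun_diff smooth_fun_const comp[OF fs]) auto
  have w0: "w g p \<ge> 0" for g p by (simp add: w_def bump_def)
  have wpos: "w g p \<noteq> 0 \<longleftrightarrow> f (act (inv g) p) < real R" for g p by (auto simp: w_def bump_def)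
  define supp where "supp p = {g \<in> carrier G. w g p \<noteq> 0}" for p
  have locfin: "\<exists>W S. openin (mtop M) W \<and> p \<in> W \<and> finite S \<and> S \<subseteq> carrier G \<and> (\<forall>q\<in>W. supp q \<subseteq> S)" if p: "p \<in> ?X" for p
  proof -
    \<comment> \<open>Large enough for \<open>K\<close> to contain both the region
      \<open>f < R\<close>, where the untranslated weight is positive, and a neighbourhood of
      \<open>p\<close>. An element active near \<open>p\<close> then moves \<open>K\<close> so that
      it meets itself.\<close>
    define r where "r = real R + \<bar>f p\<bar> + 1"
    define K where "K = {q \<in> ?X. f q \<le> r}"
    define S where "S = {g \<in> carrier G. act g ` K \<inter> K \<noteq> {}}"
    define W where "W = {q \<in> ?X. f q \<in> {..<r}}"
    have "compactin (mtop M) K"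
    proof -
      let ?B = "{y \<in> Rn n. (\<Sum>i<n. (y i)\<^sup>2) \<le> r}"
      have "compactin (Euclidean_space n) ?B" by (rule compactin_Euclidean_ball)
      moreover have "continuous_map (Euclidean_space n) (mtop M) (inv_into ?X F)"
        using Gs by (simp add: smooth_map_def euclid_def)
      ultimately have "compactin (mtop M) (inv_into ?X F ` ?B)" by (rule image_compactin)
      moreover have "inv_into ?X F ` ?B = K"
      proof (intro subset_antisym subsetI)
        fix q assume "q \<in> inv_into ?X F ` ?B"
        then obtain y where y: "y \<in> Rn n" "(\<Sum>i<n. (y i)\<^sup>2) \<le> r" "q = inv_into ?X F y" by blast
        have "F q = y" "q \<in> ?X" using Fb y by (auto simp: bij_betw_def f_inv_into_f inv_into_into)
        then show "q \<in> K" using y by (simp add: K_def f_def)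
      next
        fix q assume q: "q \<in> K"
        then have "q = inv_into ?X F (F q)" using Fb by (simp add: K_def bij_betw_def inv_into_f_f)
        moreover have "F q \<in> ?B" using q Fm by (simp add: K_def f_def)
        ultimately show "q \<in> inv_into ?X F ` ?B" by blast
      qed
      ultimately show ?thesis by simp
    qed
    then have "finite S" using pd by (simp add: properly_discontinuous_def S_def)
    moreover have "openin (mtop M) W"
      using fc unfolding W_def continuous_map_def by (metis open_lessThan open_openin)
    moreover have "p \<in> W" using p by (simp add: W_def r_def)
    moreover have "supp q \<subseteq> S" if q: "q \<in> W" for q
    proof
      fix g assume g: "g \<in> supp q"
      then have gc: "g \<in> carrier G" and "f (act (inv g) q) < real R" using wpos by (auto simp: supp_def)
      then have "act (inv g) q \<in> K" using act_mem[of "inv g" q] q by (auto simp: K_def W_def r_def)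
      moreover have "act g (act (inv g) q) = q" using act_inv(2)[OF gc] q by (simp add: W_def)
      moreover have "q \<in> K" using q by (simp add: K_def W_def)
      ultimately have "q \<in> act g ` K \<inter> K" by (metis IntI imageI)
      then show "g \<in> S" using gc by (auto simp: S_def)
    qed
    ultimately show ?thesis by (intro exI[of _ W] exI[of _ S]) (auto simp: S_def)
  qed
  have fin: "finite (supp p)" if "p \<in> ?X" for p
    using locfin[OF that] finite_subset by blast
  \<comment> \<open>The unnormalised mean of the values \<open>c g\<close>; the constant 1 gives the
    total weight, by which \<open>\<phi>\<close> divides.\<close>
  define av where "av c p = (\<Sum>g\<in>supp p. w g p * c g)" for c p
  have avs: "smooth_fun M (av c)" for c
  proof (rule smooth_fun_local)
    fix p assume p: "p \<in> ?X"
    obtain W S where W: "openin (mtop M) W" "p \<in> W" and S: "finite S" "S \<subseteq> carrier G" "\<forall>q\<in>W. supp q \<subseteq> S"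
      using locfin[OF p] by (elim exE conjE) (rule that)
    have "smooth_fun M (\<lambda>q. \<Sum>g\<in>S. w g q * c g)"
      using S(2) by (intro smooth_fun_sum smooth_fun_mult smooth_fun_const ws) auto
    moreover have "av c q = (\<Sum>g\<in>S. w g q * c g)" if "q \<in> W" for q
      unfolding av_def using S that by (intro sum.mono_neutral_left) (auto simp: supp_def)
    ultimately show "\<exists>W g. openin (mtop M) W \<and> p \<in> W \<and> smooth_fun M g \<and> (\<forall>q\<in>W. av c q = g q)"
      using W by (intro exI[of _ W] exI[of _ "\<lambda>q. \<Sum>g\<in>S. w g q * c g"]) simp
  qed
  have av1: "av (\<lambda>_. 1) p > 0" if p: "p \<in> ?X" for p
  proof -
    obtain g where g: "g \<in> carrier G" "f (act g p) < real R" using R[OF p] by blast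
    then have "inv g \<in> supp p" using wpos[of "inv g" p] by (simp add: supp_def)
    then have "0 < w (inv g) p" "inv g \<in> supp p" using w0[of "inv g" p] by (auto simp: supp_def less_le)
    then show ?thesis unfolding av_def using fin[OF p] w0 by (intro sum_pos2[of _ "inv g"]) auto
  qed
  \<comment> \<open>Left multiplication by \<open>h\<close> maps the active elements at
    \<open>p\<close> bijectively to those at \<open>act h p\<close>.\<close>
  have av_act: "av c (act h p) = av (\<lambda>g. c (h \<otimes> g)) p" if h: "h \<in> carrier G" and p: "p \<in> ?X" for c h p
  proof -
    have wh: "w (h \<otimes> g) (act h p) = w g p" if g: "g \<in> carrier G" for g
    proof -
      have "act (inv (h \<otimes> g)) (act h p) = act (inv g) (act (inv h) (act h p))"
        using act_mult[of "inv g" "inv h" "act h p"] act_mem[OF h p] g h by (simp add: R.inv_mult_group)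
      then show ?thesis using act_inv(1)[OF h p] by (simp add: w_def)
    qed
    have "bij_betw (\<lambda>g. h \<otimes> g) (supp p) (supp (act h p))"
    proof (rule bij_betw_imageI)
      show "inj_on (\<lambda>g. h \<otimes> g) (supp p)"
      proof (rule inj_onI)
        fix g g' assume "g \<in> supp p" "g' \<in> supp p" "h \<otimes> g = h \<otimes> g'"
        then show "g = g'" using h by (simp add: supp_def)
      qed
      show "(\<lambda>g. h \<otimes> g) ` supp p = supp (act h p)"
      proof (intro subset_antisym subsetI)
        fix g assume g: "g \<in> supp (act h p)"
        then have gc: "inv h \<otimes> g \<in> carrier G" "g = h \<otimes> (inv h \<otimes> g)"
          using h by (auto simp: supp_def R.m_assoc[symmetric])
        then have "inv h \<otimes> g \<in> supp p" using wh[OF gc(1)] g by (simp add: supp_def)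
        then show "g \<in> (\<lambda>g. h \<otimes> g) ` supp p" using gc(2) by blast
      qed (use h wh in \<open>auto simp: supp_def\<close>)
    qed
    from sum.reindex_bij_betw[OF this, of "\<lambda>g. w g (act h p) * c g"]
    have "av c (act h p) = (\<Sum>g\<in>supp p. w (h \<otimes> g) (act h p) * c (h \<otimes> g))" by (simp add: av_def)
    also have "\<dots> = av (\<lambda>g. c (h \<otimes> g)) p"
      unfolding av_def by (intro sum.cong) (auto simp: wh supp_def)
    finally show ?thesis .
  qed
  \<comment> \<open>The default 0 from \<open>m\<close> on puts \<open>\<phi> p\<close> into
    \<open>Rn m\<close> for every \<open>p\<close>, even outside the manifold.\<close>
  define \<phi> where "\<phi> p k = (if k < m then av (\<lambda>g. \<rho> g ?o k) p * inverse (av (\<lambda>_. 1) p) else 0)" for p k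
  have \<phi>mem: "\<phi> p \<in> Rn m" for p by (simp add: \<phi>_def mem_Rn)
  show ?thesis
  proof (rule that[OF _ \<phi>mem])
    fix k assume k: "k < m"
    have "smooth_fun M (\<lambda>p. av (\<lambda>g. \<rho> g ?o k) p * inverse (av (\<lambda>_. 1) p))"
      using av1 by (intro smooth_fun_mult smooth_fun_inverse avs) force
    then show "smooth_fun M (\<lambda>p. \<phi> p k)" using k by (simp add: \<phi>_def)
  next
    fix h p assume h: "h \<in> carrier G" and p: "p \<in> ?X"
    obtain A b where A: "\<And>y k. y \<in> Rn m \<Longrightarrow> k < m \<Longrightarrow> \<rho> h y k = b k + (\<Sum>l<m. A k l * y l)"
      by (rule isometry_affine[of m "\<rho> h"]) (use R.mem[OF h] R.dist[OF h] in auto)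
    show "\<phi> (act h p) = \<rho> h (\<phi> p)"
    proof
      fix k
      show "\<phi> (act h p) k = \<rho> h (\<phi> p) k"
      proof (cases "k < m")
        case False
        then show ?thesis using R.mem[OF h \<phi>mem[of p]] by (simp add: \<phi>_def mem_Rn)
      next
        case True
        \<comment> \<open>The constant part \<open>b k\<close> picks up the total weight, which the
          normalisation cancels again.\<close>
        have "av (\<lambda>g. \<rho> (h \<otimes> g) ?o k) p = (\<Sum>g\<in>supp p. w g p * b k + (\<Sum>l<m. A k l * (w g p * \<rho> g ?o l)))"
          unfolding av_def
        proof (rule sum.cong)
          fix g assume "g \<in> supp p"
          then have g: "g \<in> carrier G" by (simp add: supp_def)
          have "\<rho> (h \<otimes> g) ?o k = b k + (\<Sum>l<m. A k l * \<rho> g ?o l)"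
            using R.mult[OF h g zero_in_Rn] A[OF R.mem[OF g zero_in_Rn] True] by simp
          then show "w g p * \<rho> (h \<otimes> g) ?o k = w g p * b k + (\<Sum>l<m. A k l * (w g p * \<rho> g ?o l))"
            by (simp add: distrib_left sum_distrib_left mult.left_commute)
        qed simp
        also have "\<dots> = b k * av (\<lambda>_. 1) p + (\<Sum>l<m. A k l * av (\<lambda>g. \<rho> g ?o l) p)"
          unfolding av_def sum.distrib by (subst sum.swap) (simp add: sum_distrib_left mult.commute)
        finally have "\<phi> (act h p) k = (b k * av (\<lambda>_. 1) p + (\<Sum>l<m. A k l * av (\<lambda>g. \<rho> g ?o l) p)) * inverse (av (\<lambda>_. 1) p)"
          using True by (simp add: \<phi>_def av_act[OF h p])
        also have "\<dots> = b k + (\<Sum>l<m. A k l * \<phi> p l)"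
          using av1[OF p] by (simp add: \<phi>_def distrib_right sum_distrib_right mult.assoc)
        finally show ?thesis using A[OF \<phi>mem True] by simp
      qed
    qed
  qed
qed

text \<open>The global diffeomorphism \<open>F\<close> transports the action and
  \<open>\<phi>\<close> to \<open>\<real>\<^sup>n\<close>, where \<open>dimension_le\<close>
  applies.\<close>

lemma euclid_action_dimension_le:
  fixes G (structure)
  assumes ch: "charted M" and F: "diffeomorphism M (euclid n) F"
    and ga: "group_action G (topspace (mtop M)) act"
    and sm: "\<And>g. g \<in> carrier G \<Longrightarrow> smooth_map M M (act g)"
    and ea: "euclid_action G m \<rho>"
    and \<phi>: "\<And>k. k < m \<Longrightarrow> smooth_fun M (\<lambda>p. \<phi> p k)" "\<And>p. \<phi> p \<in> Rn m"
    "\<And>g p. g \<in> carrier G \<Longrightarrow> p \<in> topspace (mtop M) \<Longrightarrow> \<phi> (act g p) = \<rho> g (\<phi> p)"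
  shows "m \<le> n"
proof -
  interpret charted M by (rule ch)
  interpret E: charted "euclid n" by (rule charted_euclid)
  interpret R: euclid_action G m \<rho> by (rule ea)
  interpret A: group_action G "topspace (mtop M)" act by (rule ga)
  let ?X = "topspace (mtop M)"
  define H where "H = inv_into ?X F"
  have Fs: "smooth_map M (euclid n) F" and Fb: "bij_betw F ?X (Rn n)" and Hs: "smooth_map (euclid n) M H"
    using F by (auto simp: diffeomorphism_def euclid_def H_def)
  have Fm: "F p \<in> Rn n" if "p \<in> ?X" for p using Fb that by (auto simp: bij_betw_def)
  have Hm: "H y \<in> ?X" and FH: "F (H y) = y" if "y \<in> Rn n" for y
    using Fb that by (auto simp: bij_betw_def f_inv_into_f inv_into_into H_def)
  have HF: "H (F p) = p" if "p \<in> ?X" for p using Fb that by (simp add: H_def bij_betw_def inv_into_f_f)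
  have act_mem: "act g p \<in> ?X" if "g \<in> carrier G" "p \<in> ?X" for g p
    using A.element_image[OF that] by blast
  interpret HM: charted_map "euclid n" M H by unfold_locales (rule Hs)
  have "continuous_euclid_action G n (\<lambda>g y. F (act g (H y)))"
  proof
    fix g y assume g: "g \<in> carrier G" and y: "y \<in> Rn n"
    show "F (act g (H y)) \<in> Rn n" by (intro Fm act_mem g Hm y)
    show "F (act (g \<otimes> h) (H y)) = F (act g (H (F (act h (H y)))))" if "h \<in> carrier G" for h
      using A.composition_rule[OF Hm[OF y] g that] HF[OF act_mem[OF that Hm[OF y]]] by simp
  next
    fix y assume y: "y \<in> Rn n"
    show "F (act \<one> (H y)) = y" using fun_cong[OF A.id_eq_one, of "H y"] Hm[OF y] FH[OF y] by simp
  next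
    fix g assume g: "g \<in> carrier G"
    have "continuous_map (Euclidean_space n) (mtop M) H" using HM.cont by (simp add: euclid_def)
    moreover have "continuous_map (mtop M) (mtop M) (act g)" using sm[OF g] by (simp add: smooth_map_def)
    moreover have "continuous_map (mtop M) (Euclidean_space n) F" using Fs by (simp add: smooth_map_def euclid_def)
    ultimately have "continuous_map (Euclidean_space n) (Euclidean_space n) (F \<circ> (act g \<circ> H))"
      by (intro continuous_map_compose)
    then have "continuous_map (subtopology (Euclidean_space n) UNIV) (Euclidean_space n) (\<lambda>y. F (act g (H y)))"
      by (simp add: o_def)
    then show "continuous_on (Rn n) (\<lambda>y. F (act g (H y)))"
      unfolding cm_Euclidean_space_iff_continuous_on by simp
  qed
  moreover have "C_on n (Suc 0) (Rn n) (\<lambda>y. \<phi> (H y) k)" if "k < m" for k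
    using smooth_fun_euclid[OF HM.smooth_fun_compose[OF \<phi>(1)[OF that]]] unfolding smooth_on_def by blast
  moreover have "\<phi> (H (F (act g (H y)))) = \<rho> g (\<phi> (H y))" if "g \<in> carrier G" "y \<in> Rn n" for g y
    using HF[OF act_mem[OF that(1) Hm[OF that(2)]]] \<phi>(3)[OF that(1) Hm[OF that(2)]] by simp
  ultimately show ?thesis
    using dimension_le[OF ea, of n "\<lambda>g y. F (act g (H y))" "\<lambda>y. \<phi> (H y)"] \<phi>(2) by blast
qed

section \<open>Comparison of quadratic forms\<close>

text \<open>The minimum over the compact unit sphere is positive, and homogeneity extends it to all
  vectors. For \<open>n = 0\<close> the sphere is empty and any constant will do.\<close>

lemma positive_definite_coercive:
  fixes A :: "nat \<Rightarrow> nat \<Rightarrow> real"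
  assumes pos: "\<And>v::nat \<Rightarrow> real. (\<exists>i<n. v i \<noteq> 0) \<Longrightarrow> (\<Sum>i<n. \<Sum>j<n. A i j * v i * v j) > 0"
  obtains \<kappa> where "\<kappa> > 0" "\<And>v. (\<Sum>i<n. \<Sum>j<n. A i j * v i * v j) \<ge> \<kappa> * (\<Sum>i<n. (v i)\<^sup>2)"
proof (cases "n = 0")
  case True
  then show ?thesis by (intro that[of 1]) auto
next
  case False
  define Q where "Q v = (\<Sum>i<n. \<Sum>j<n. A i j * v i * v j)" for v :: "nat \<Rightarrow> real"
  define S where "S = {v \<in> Rn n. (\<Sum>i<n. (v i)\<^sup>2) \<le> 1} \<inter> {v. 1 \<le> (\<Sum>i<n. (v i)\<^sup>2)}"
  have "compact {v \<in> Rn n. (\<Sum>i<n. (v i)\<^sup>2) \<le> 1}" by (rule compact_Euclidean_ball)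
  moreover have "closed {v::nat \<Rightarrow> real. 1 \<le> (\<Sum>i<n. (v i)\<^sup>2)}"
    by (intro closed_Collect_le continuous_on_sum_squares continuous_on_const)
  ultimately have "compact S" unfolding S_def by (rule compact_Int_closed)
  have S: "v \<in> Rn n \<and> (\<Sum>i<n. (v i)\<^sup>2) = 1" if "v \<in> S" for v
    using that unfolding S_def by (intro conjI antisym) blast+
  have SI: "v \<in> S" if "v \<in> Rn n" "(\<Sum>i<n. (v i)\<^sup>2) = 1" for v
    using that unfolding S_def by simp
  have "(\<lambda>i. if i = 0 then 1 else 0) \<in> S"
  proof (rule SI)
    show "(\<lambda>i. if i = 0 then 1 else 0) \<in> Rn n" using False by (simp add: mem_Rn)
    have "(\<Sum>i<n. (if i = 0 then 1 else 0 :: real)\<^sup>2) = (\<Sum>i<n. if i = 0 then 1 else 0)"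
      by (rule sum.cong) auto
    then show "(\<Sum>i<n. (if i = 0 then 1 else 0 :: real)\<^sup>2) = 1" using False by simp
  qed
  then have "S \<noteq> {}" by blast
  moreover have "continuous_on S Q"
    unfolding Q_def by (intro continuous_on_sum continuous_on_mult continuous_on_const continuous_on_coord)
  ultimately obtain v0 where v0: "v0 \<in> S" "\<And>v. v \<in> S \<Longrightarrow> Q v0 \<le> Q v"
    using continuous_attains_inf[OF \<open>compact S\<close>] by blast
  have "\<exists>i<n. v0 i \<noteq> 0"
  proof (rule ccontr)
    assume "\<not> ?thesis"
    then have "(\<Sum>i<n. (v0 i)\<^sup>2) = 0" by simp
    then show False using S[OF v0(1)] by simp
  qed
  then have Q0: "Q v0 > 0" unfolding Q_def by (rule pos)
  show ?thesis
  proof (rule that[OF Q0])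
    fix v :: "nat \<Rightarrow> real"
    define s where "s = (\<Sum>i<n. (v i)\<^sup>2)"
    have "Q v0 * s \<le> Q v"
    proof (cases "s = 0")
      case True
      then have "\<forall>i\<in>{..<n}. (v i)\<^sup>2 = 0" unfolding s_def by (subst (asm) sum_nonneg_eq_0_iff) auto
      then have "Q v = 0" unfolding Q_def by (intro sum.neutral ballI) auto
      then show ?thesis using True by simp
    next
      case False
      moreover have "s \<ge> 0" unfolding s_def by (intro sum_nonneg) auto
      ultimately have s: "s > 0" by simp
      define w where "w i = (if i < n then v i / sqrt s else 0)" for i
      have "w \<in> S"
      proof (rule SI)
        show "w \<in> Rn n" by (simp add: w_def mem_Rn)
        have "(\<Sum>i<n. (w i)\<^sup>2) = (\<Sum>i<n. (v i)\<^sup>2 / s)" using s by (intro sum.cong) (auto simp: w_def power_divide)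
        also have "\<dots> = s / s" by (simp add: s_def[symmetric] sum_divide_distrib[symmetric])
        finally show "(\<Sum>i<n. (w i)\<^sup>2) = 1" using s by simp
      qed
      then have "Q v0 \<le> Q w" by (rule v0(2))
      moreover have "Q w = Q v / s"
      proof -
        have "Q w = (\<Sum>i<n. \<Sum>j<n. A i j * v i * v j / s)"
          unfolding Q_def using s by (intro sum.cong) (auto simp: w_def)
        then show ?thesis by (simp add: Q_def sum_divide_distrib)
      qed
      ultimately show ?thesis using s by (simp add: field_simps)
    qed
    then show "(\<Sum>i<n. \<Sum>j<n. A i j * v i * v j) \<ge> Q v0 * (\<Sum>i<n. (v i)\<^sup>2)" by (simp add: Q_def s_def)
  qed
qed

lemma quadratic_form_bound:
  fixes A :: "nat \<Rightarrow> nat \<Rightarrow> real"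
  assumes "\<And>i j. i < n \<Longrightarrow> j < n \<Longrightarrow> \<bar>A i j\<bar> \<le> B"
  shows "\<bar>\<Sum>i<n. \<Sum>j<n. A i j * v i * v j\<bar> \<le> real n * real n * B * (\<Sum>i<n. (v i)\<^sup>2)"
proof -
  define s where "s = (\<Sum>i<n. (v i)\<^sup>2)"
  have sq: "\<bar>v i\<bar> \<le> sqrt s" if "i < n" for i
  proof (rule real_le_rsqrt)
    show "\<bar>v i\<bar>\<^sup>2 \<le> s" unfolding s_def power2_abs using that by (intro member_le_sum) auto
  qed
  have s0: "s \<ge> 0" unfolding s_def by (intro sum_nonneg) auto
  have "\<bar>A i j * v i * v j\<bar> \<le> B * s" if "i < n" "j < n" for i j
  proof -
    have "\<bar>A i j\<bar> * (\<bar>v i\<bar> * \<bar>v j\<bar>) \<le> B * (sqrt s * sqrt s)"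
      using that s0 assms[OF that] by (intro mult_mono sq) (auto intro: order_trans[OF abs_ge_zero])
    then show ?thesis using s0 by (simp add: abs_mult mult.assoc)
  qed
  then have "\<bar>\<Sum>i<n. \<Sum>j<n. A i j * v i * v j\<bar> \<le> (\<Sum>i<n. \<Sum>j<n. B * s)"
    by (intro order_trans[OF sum_abs] sum_mono order_trans[OF sum_abs]) auto
  then show ?thesis by (simp add: s_def mult.assoc)
qed


section \<open>The metric on the quotient\<close>

lemma flat_sum:
  "(\<Sum>a<D. \<Sum>b<D. J a * K b * flat_metric d q a b) = (\<Sum>a<D. J a * K a)"
  unfolding flat_metric_def by (simp add: if_distrib sum.delta cong: if_cong)

lemma smooth_manifold_id: "smooth_manifold M \<Longrightarrow> smooth_map M M (\<lambda>p. p)"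
  unfolding smooth_manifold_def smooth_map_def by (auto simp: vimage_def)

context euclid_action
begin

text \<open>Finitely many elements move \<open>y\<close> by less than 1, and by freeness each of
  them except the unit moves it by a positive amount.\<close>

lemma separation:
  assumes y: "y \<in> Rn m"
  obtains \<eta> where "\<eta> > 0" "\<And>g. g \<in> carrier G \<Longrightarrow> euclid_dist m (\<rho> g y) y < \<eta> \<Longrightarrow> g = \<one>"
proof -
  let ?o = "\<lambda>i::nat. 0::real"
  \<comment> \<open>If \<open>g\<close> moves \<open>y\<close> by less than 1, then going from the
    origin to \<open>y\<close> and back shows that it moves the origin by at most
    \<open>2 |y| + 1\<close>.\<close>
  define S where "S = {g \<in> carrier G. euclid_dist m (\<rho> g ?o) ?o \<le> 2 * euclid_dist m y ?o + 1}"
  have S: "finite S" unfolding S_def by (rule finite_near)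
  have in_S: "g \<in> S" if g: "g \<in> carrier G" "euclid_dist m (\<rho> g y) y < 1" for g
  proof -
    have "euclid_dist m (\<rho> g ?o) ?o \<le> euclid_dist m (\<rho> g ?o) (\<rho> g y) + (euclid_dist m (\<rho> g y) y + euclid_dist m y ?o)"
      using euclid_dist_triangle[of m "\<rho> g ?o" ?o "\<rho> g y"] euclid_dist_triangle[of m "\<rho> g y" ?o y] by linarith
    then have "euclid_dist m (\<rho> g ?o) ?o \<le> 2 * euclid_dist m y ?o + 1"
      using g(2) dist[OF g(1) zero_in_Rn y] euclid_dist_sym[of m ?o y] by linarith
    then show ?thesis using g(1) by (simp add: S_def)
  qed
  \<comment> \<open>The 1 takes care of the elements outside \<open>S\<close>, which move
    \<open>y\<close> by at least 1.\<close>
  define \<eta> where "\<eta> = Min (insert 1 ((\<lambda>g. euclid_dist m (\<rho> g y) y) ` (S - {\<one>})))"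
  have "euclid_dist m (\<rho> g y) y > 0" if "g \<in> S - {\<one>}" for g
  proof -
    have g: "g \<in> carrier G" "g \<noteq> \<one>" using that by (auto simp: S_def)
    then have "\<rho> g y \<noteq> y" using free[OF g(1) y] by blast
    then have "euclid_dist m (\<rho> g y) y \<noteq> 0" using euclid_dist_eq_0[OF mem[OF g(1) y] y] by blast
    then show ?thesis using euclid_dist_nonneg[of m "\<rho> g y" y] by linarith
  qed
  then have "\<eta> > 0" unfolding \<eta>_def using S by (subst Min_gr_iff) auto
  moreover have "g = \<one>" if g: "g \<in> carrier G" "euclid_dist m (\<rho> g y) y < \<eta>" for g
  proof (rule ccontr)
    assume "g \<noteq> \<one>"
    have "\<eta> \<le> 1" unfolding \<eta>_def using S by (intro Min_le) auto
    then have "g \<in> S - {\<one>}" using in_S[OF g(1)] g(2) \<open>g \<noteq> \<one>\<close> by simp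
    then have "\<eta> \<le> euclid_dist m (\<rho> g y) y" unfolding \<eta>_def using S by (intro Min_le) auto
    then show False using g(2) by linarith
  qed
  ultimately show ?thesis by (rule that)
qed

end

locale equivariant_setup = charted M + group_action G "topspace (mtop M)" act + R: euclid_action G m \<rho>
  for M :: "'a manifold" and G :: "('g, 'b) monoid_scheme" (structure) and act and m and \<rho> +
  fixes \<phi> :: "'a \<Rightarrow> nat \<Rightarrow> real"
  assumes id_smooth: "smooth_map M M (\<lambda>p. p)"
    and act_smooth: "g \<in> carrier G \<Longrightarrow> smooth_map M M (act g)"
    and cc: "cocompact G (mtop M) act"
    and \<phi>_smooth: "k < m \<Longrightarrow> smooth_fun M (\<lambda>p. \<phi> p k)"
    and \<phi>_mem: "\<phi> p \<in> Rn m"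
    and \<phi>_equiv: "g \<in> carrier G \<Longrightarrow> p \<in> topspace (mtop M) \<Longrightarrow> \<phi> (act g p) = \<rho> g (\<phi> p)"
begin

abbreviation "X \<equiv> topspace (mtop M)"
abbreviation "\<pi> \<equiv> orbit G act"

lemma act_mem: "g \<in> carrier G \<Longrightarrow> p \<in> X \<Longrightarrow> act g p \<in> X"
  using element_image by blast

lemma act_inv: "g \<in> carrier G \<Longrightarrow> p \<in> X \<Longrightarrow> act (inv g) (act g p) = p"
  using composition_rule[of p "inv g" g] fun_cong[OF id_eq_one, of p] by simp

lemma act_cont: "g \<in> carrier G \<Longrightarrow> continuous_map (mtop M) (mtop M) (act g)"
  using act_smooth by (simp add: smooth_map_def)

lemma orbit_eq_iff:
  assumes "p \<in> X" "q \<in> X"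
  shows "\<pi> p = \<pi> q \<longleftrightarrow> (\<exists>g\<in>carrier G. q = act g p)"
proof
  assume "\<pi> p = \<pi> q"
  then have "q \<in> \<pi> p" using orbit_refl[OF assms(2)] by simp
  then show "\<exists>g\<in>carrier G. q = act g p" by (auto simp: orbit_def)
next
  assume "\<exists>g\<in>carrier G. q = act g p"
  then obtain g where g: "g \<in> carrier G" "q = act g p" by blast
  have "act h q \<in> \<pi> p" if "h \<in> carrier G" for h
    using that g composition_rule[OF assms(1) that g(1)] unfolding orbit_def by (auto intro!: exI[of _ "h \<otimes> g"])
  moreover have "act h p \<in> \<pi> q" if "h \<in> carrier G" for h
  proof -
    have "act h p = act (h \<otimes> inv g) q"
      using composition_rule[OF assms(2) that R.inv_closed[OF g(1)]] act_inv[OF g(1) assms(1)] g(2) by simp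
    then show ?thesis using that g(1) unfolding orbit_def by (auto intro!: exI[of _ "h \<otimes> inv g"])
  qed
  ultimately show "\<pi> p = \<pi> q" unfolding orbit_def by blast
qed

lemma act_preimage_open: "g \<in> carrier G \<Longrightarrow> openin (mtop M) W \<Longrightarrow> openin (mtop M) {p \<in> X. act g p \<in> W}"
  using act_cont unfolding continuous_map_def by blast

lemma saturation_open:
  assumes "openin (mtop M) W"
  shows "openin (mtop M) {p \<in> X. \<exists>g\<in>carrier G. act g p \<in> W}"
proof -
  have "openin (mtop M) (\<Union>g\<in>carrier G. {p \<in> X. act g p \<in> W})" using act_preimage_open assms by blast
  moreover have "(\<Union>g\<in>carrier G. {p \<in> X. act g p \<in> W}) = {p \<in> X. \<exists>g\<in>carrier G. act g p \<in> W}" by blast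
  ultimately show ?thesis by simp
qed

text \<open>The preimage of the image of \<open>W\<close> under the projection is the union of the
  preimages of \<open>W\<close> under all group elements.\<close>

lemma orbit_image_open:
  assumes W: "openin (mtop M) W"
  shows "openin (orbit_topology G (mtop M) act) (\<pi> ` W)"
  unfolding openin_orbit_topology
proof
  have WX: "W \<subseteq> X" using W by (rule openin_subset)
  then show "\<pi> ` W \<subseteq> orbits G X act" by (auto simp: orbits_def)
  have "{p \<in> X. \<pi> p \<in> \<pi> ` W} = {p \<in> X. \<exists>g\<in>carrier G. act g p \<in> W}"
  proof -
    have "\<pi> p \<in> \<pi> ` W \<longleftrightarrow> (\<exists>g\<in>carrier G. act g p \<in> W)" if p: "p \<in> X" for p
    proof
      assume "\<pi> p \<in> \<pi> ` W"
      then obtain q where "q \<in> W" "\<pi> p = \<pi> q" by blast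
      then show "\<exists>g\<in>carrier G. act g p \<in> W" using orbit_eq_iff[OF p, of q] WX by blast
    next
      assume "\<exists>g\<in>carrier G. act g p \<in> W"
      then obtain g where g: "g \<in> carrier G" "act g p \<in> W" by blast
      have "\<pi> p = \<pi> (act g p)" using orbit_eq_iff[OF p act_mem[OF g(1) p]] g(1) by blast
      then show "\<pi> p \<in> \<pi> ` W" using g(2) by blast
    qed
    then show ?thesis by blast
  qed
  then show "openin (mtop M) {p \<in> X. \<pi> p \<in> \<pi> ` W}" using saturation_open[OF W] by simp
qed

lemma \<phi>_cont: "continuous_map (mtop M) (Euclidean_space m) \<phi>"
proof -
  have "continuous_map (mtop M) (Euclidean_space m) (\<lambda>p k. if k < m then \<phi> p k else 0)"
    unfolding continuous_map_componentwise_Euclidean_space using smooth_fun_continuous[OF \<phi>_smooth] by blast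
  moreover have "(\<lambda>p k. if k < m then \<phi> p k else 0) = \<phi>"
    using \<phi>_mem by (auto simp: fun_eq_iff mem_Rn)
  ultimately show ?thesis by simp
qed

lemma small_neighbourhood:
  assumes W: "openin (mtop M) W" "p \<in> W" and \<delta>: "\<delta> > 0"
  obtains V where "openin (mtop M) V" "p \<in> V" "V \<subseteq> W" "\<And>q. q \<in> V \<Longrightarrow> euclid_dist m (\<phi> q) (\<phi> p) < \<delta>"
proof -
  define e where "e = \<delta> / real (Suc m)"
  have e: "e > 0" "real m * e < \<delta>" using \<delta> by (auto simp: e_def field_simps)
  define B where "B = {y \<in> Rn m. \<forall>k<m. y k \<in> {\<phi> p k - e<..<\<phi> p k + e}}"
  have "openin (Euclidean_space m) B" unfolding B_def by (rule openin_Euclidean_space_box) auto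
  then have "openin (mtop M) {q \<in> X. \<phi> q \<in> B}" using \<phi>_cont unfolding continuous_map_def by blast
  then have "openin (mtop M) (W \<inter> {q \<in> X. \<phi> q \<in> B})" using W(1) by (rule openin_Int[rotated])
  moreover have "p \<in> W \<inter> {q \<in> X. \<phi> q \<in> B}"
    using W(2) openin_subset[OF W(1)] \<phi>_mem e(1) by (auto simp: B_def)
  moreover have "euclid_dist m (\<phi> q) (\<phi> p) < \<delta>" if "q \<in> W \<inter> {q \<in> X. \<phi> q \<in> B}" for q
  proof -
    have "\<bar>\<phi> q k - \<phi> p k\<bar> \<le> e" if "k < m" for k
    proof -
      have "\<phi> q k \<in> {\<phi> p k - e<..<\<phi> p k + e}" using \<open>q \<in> W \<inter> {q \<in> X. \<phi> q \<in> B}\<close> that unfolding B_def by blast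
      then show ?thesis unfolding greaterThanLessThan_iff by linarith
    qed
    then have "euclid_dist m (\<phi> q) (\<phi> p) \<le> real m * e" by (rule euclid_dist_le)
    then show ?thesis using e(2) by linarith
  qed
  ultimately show ?thesis by (intro that[of "W \<inter> {q \<in> X. \<phi> q \<in> B}"]) auto
qed

text \<open>Separation is imported from the Euclidean side: if \<open>q\<close> and
  \<open>act g q\<close> both have \<open>\<phi>\<close>-values within \<open>\<eta> / 2\<close> of
  \<open>\<phi> p\<close>, then \<open>\<rho> g\<close> moves \<open>\<phi> p\<close> by less than
  \<open>\<eta>\<close>, so \<open>g\<close> is the unit.\<close>

lemma evenly_covered:
  assumes W: "openin (mtop M) W" "p \<in> W"
  obtains V where "openin (mtop M) V" "p \<in> V" "V \<subseteq> W" "inj_on \<pi> V"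
proof -
  have pX: "p \<in> X" using openin_subset[OF W(1)] W(2) by blast
  obtain \<eta> where \<eta>: "\<eta> > 0" "\<And>g. g \<in> carrier G \<Longrightarrow> euclid_dist m (\<rho> g (\<phi> p)) (\<phi> p) < \<eta> \<Longrightarrow> g = \<one>"
    using R.separation[OF \<phi>_mem] by metis
  obtain V where V: "openin (mtop M) V" "p \<in> V" "V \<subseteq> W" "\<And>q. q \<in> V \<Longrightarrow> euclid_dist m (\<phi> q) (\<phi> p) < \<eta> / 2"
    using small_neighbourhood[OF W, of "\<eta> / 2"] \<eta>(1) by (metis half_gt_zero)
  have VX: "V \<subseteq> X" using V(1) by (rule openin_subset)
  have "inj_on \<pi> V"
  proof (rule inj_onI)
    fix q q' assume q: "q \<in> V" "q' \<in> V" "\<pi> q = \<pi> q'"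
    then obtain g where g: "g \<in> carrier G" "q' = act g q" using orbit_eq_iff[of q q'] VX by blast
    have "\<phi> q' = \<rho> g (\<phi> q)" using \<phi>_equiv[OF g(1)] g(2) q(1) VX by blast
    then have "euclid_dist m (\<rho> g (\<phi> p)) (\<phi> p) \<le> euclid_dist m (\<phi> p) (\<phi> q) + euclid_dist m (\<phi> q') (\<phi> p)"
      using euclid_dist_triangle[of m "\<rho> g (\<phi> p)" "\<phi> p" "\<phi> q'"] R.dist[OF g(1) \<phi>_mem \<phi>_mem, of p q] by simp
    then have "g = \<one>"
      using V(4)[OF q(1)] V(4)[OF q(2)] euclid_dist_sym[of m "\<phi> p" "\<phi> q"] by (intro \<eta>(2) g(1)) linarith
    then show "q = q'" using g(2) fun_cong[OF id_eq_one, of q] q(1) VX by auto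
  qed
  with V(1-3) show ?thesis by (rule that)
qed

subsection \<open>The pullback of the flat metric\<close>

definition P :: "'a tensor2" where
  "P c p i j = (\<Sum>k<m. coord_deriv c (\<lambda>q. \<phi> q k) p i * coord_deriv c (\<lambda>q. \<phi> q k) p j)"

text \<open>If \<open>f\<close> corresponds under \<open>\<phi>\<close> to an affine map with
  orthogonal linear part \<open>A\<close>, the derivatives of \<open>\<phi>\<close> are multiplied
  by \<open>A\<close>, which cancels in the sum of products. Both the change of charts and the group
  action are instances.\<close>

lemma pullback_P:
  assumes f: "smooth_map M M f"
    and A: "\<And>p k. p \<in> X \<Longrightarrow> k < m \<Longrightarrow> \<phi> (f p) k = b k + (\<Sum>l<m. A k l * \<phi> p l)"
    and orth: "\<And>i j. i < m \<Longrightarrow> j < m \<Longrightarrow> (\<Sum>k<m. A k i * A k j) = (if i = j then 1 else (0::real))"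
  shows "pullback_eq M P M P f"
  unfolding pullback_eq_def
proof (intro ballI allI impI)
  interpret F: charted_map M M f by unfold_locales (rule f)
  fix c d p i j assume c: "c \<in> atlas M" and d: "d \<in> atlas M" and p: "p \<in> fst c \<inter> f -` fst d"
    and i: "i < mdim M" and j: "j < mdim M"
  let ?D = "\<lambda>k i. coord_deriv c (\<lambda>q. \<phi> q k) p i" and ?E = "\<lambda>k a. coord_deriv d (\<lambda>q. \<phi> q k) (f p) a"
    and ?J = "\<lambda>a i. jacobian_entry c d f p a i"
  \<comment> \<open>The derivative of \<open>\<phi> (f q)\<close> is computed twice, by the chain
    rule through \<open>f\<close> and from the affine relation; comparing both gives the
    transformation law.\<close>
  have 1: "coord_deriv c (\<lambda>q. \<phi> (f q) k) p i = (\<Sum>a<mdim M. ?E k a * ?J a i)" if "k < m" "i < mdim M" for k i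
    using p by (intro F.coord_deriv_compose \<phi>_smooth c d that) auto
  have 2: "coord_deriv c (\<lambda>q. \<phi> (f q) k) p i = (\<Sum>l<m. A k l * ?D l i)" if "k < m" "i < mdim M" for k i
  proof -
    have "coord_deriv c (\<lambda>q. \<phi> (f q) k) p i = coord_deriv c (\<lambda>q. b k + (\<Sum>l<m. A k l * \<phi> q l)) p i"
      using p A that(1) chart_sub[OF c] by (intro coord_deriv_cong[OF c openin_topspace _ _ that(2)]) auto
    also have "\<dots> = (\<Sum>l<m. A k l * ?D l i)"
      using p by (intro coord_deriv_affine \<phi>_smooth c that) auto
    finally show ?thesis .
  qed
  have "(\<Sum>k<m. (\<Sum>l<m. A k l * ?D l i) * (\<Sum>l<m. A k l * ?D l j)) = (\<Sum>k<m. \<Sum>l<m. \<Sum>l'<m. A k l * A k l' * (?D l i * ?D l' j))"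
    by (simp add: sum_product mult_ac)
  also have "\<dots> = (\<Sum>l<m. \<Sum>l'<m. (\<Sum>k<m. A k l * A k l') * (?D l i * ?D l' j))"
    unfolding sum_distrib_right by (subst sum.swap, rule sum.cong[OF refl], subst sum.swap) simp
  also have "\<dots> = (\<Sum>l<m. \<Sum>l'<m. if l = l' then ?D l i * ?D l' j else 0)"
    by (intro sum.cong) (auto simp: orth)
  also have "\<dots> = P c p i j" by (simp add: P_def)
  finally have "P c p i j = (\<Sum>k<m. (\<Sum>a<mdim M. ?E k a * ?J a i) * (\<Sum>b<mdim M. ?E k b * ?J b j))"
    using 1 2 i j by simp
  also have "\<dots> = (\<Sum>k<m. \<Sum>a<mdim M. \<Sum>b<mdim M. ?J a i * ?J b j * (?E k a * ?E k b))"
    by (simp add: sum_product mult_ac)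
  also have "\<dots> = (\<Sum>a<mdim M. \<Sum>b<mdim M. ?J a i * ?J b j * P d (f p) a b)"
    unfolding P_def sum_distrib_left by (subst sum.swap, rule sum.cong[OF refl], subst sum.swap) simp
  finally show "P c p i j = (\<Sum>a<mdim M. \<Sum>b<mdim M. ?J a i * ?J b j * P d (f p) a b)" .
qed

text \<open>With the identity matrix this is the statement that \<open>P\<close> is a tensor
  field.\<close>

lemma pullback_P_id: "pullback_eq M P M P (\<lambda>p. p)"
proof (rule pullback_P[OF id_smooth, where b = "\<lambda>_. 0" and A = "\<lambda>k l. if k = l then 1 else 0"])
  show "\<phi> p k = 0 + (\<Sum>l<m. (if k = l then 1 else 0) * \<phi> p l)" if "k < m" for p k
  proof -
    have "(\<Sum>l<m. (if k = l then 1 else 0) * \<phi> p l) = (\<Sum>l<m. if k = l then \<phi> p l else 0)"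
      by (rule sum.cong) auto
    then show ?thesis using that by simp
  qed
  show "(\<Sum>k<m. (if k = i then 1 else 0) * (if k = j then 1 else 0)) = (if i = j then 1 else (0::real))"
    if "i < m" "j < m" for i j
  proof -
    have "(\<Sum>k<m. (if k = i then 1 else 0) * (if k = j then 1 else (0::real))) = (\<Sum>k<m. if k = i then (if i = j then 1 else 0) else 0)"
      by (rule sum.cong) auto
    then show ?thesis using that by simp
  qed
qed

lemma pullback_P_act:
  assumes g: "g \<in> carrier G"
  shows "pullback_eq M P M P (act g)"
proof -
  obtain A b where A: "\<And>y k. y \<in> Rn m \<Longrightarrow> k < m \<Longrightarrow> \<rho> g y k = b k + (\<Sum>l<m. A k l * y l)"
    "\<And>i j. i < m \<Longrightarrow> j < m \<Longrightarrow> (\<Sum>k<m. A k i * A k j) = (if i = j then 1 else 0)"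
    by (rule isometry_affine[of m "\<rho> g"]) (use R.mem[OF g] R.dist[OF g] in auto)
  show ?thesis
    by (rule pullback_P[OF act_smooth[OF g], where b = b and A = A])
      (use A \<phi>_mem \<phi>_equiv[OF g] in auto)
qed

lemma smooth_P:
  assumes c: "c \<in> atlas M" and i: "i < mdim M" and j: "j < mdim M"
  shows "smooth_on (mdim M) (snd c ` fst c) (\<lambda>y. P c (chart_inv c y) i j)"
proof -
  let ?I = "snd c ` fst c"
  have "smooth_on (mdim M) ?I (\<lambda>y. \<Sum>k<m. partial_deriv i (\<lambda>y. \<phi> (chart_inv c y) k) y * partial_deriv j (\<lambda>y. \<phi> (chart_inv c y) k) y)"
    using smooth_funD[OF \<phi>_smooth c] i j
    by (intro smooth_on_sum smooth_on_mult chart_image_open'[OF c] smooth_on_partial) auto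
  moreover have "P c (chart_inv c y) i j = (\<Sum>k<m. partial_deriv i (\<lambda>y. \<phi> (chart_inv c y) k) y * partial_deriv j (\<lambda>y. \<phi> (chart_inv c y) k) y)"
    if "y \<in> ?I" for y
    using app_chart_inv[OF that] by (simp add: P_def coord_deriv_def)
  ultimately show ?thesis
    by (intro smooth_on_local[OF chart_image_open'[OF c]]) (use chart_image_open'[OF c] in blast)
qed

end

section \<open>Domination of the pullback form by the metric\<close>

definition quad :: "'a manifold \<Rightarrow> 'a tensor2 \<Rightarrow> 'a chart \<Rightarrow> 'a \<Rightarrow> (nat \<Rightarrow> real) \<Rightarrow> real" where
  "quad M t c p v = (\<Sum>i<mdim M. \<Sum>j<mdim M. t c p i j * v i * v j)"

lemma quad_pullback:
  assumes t: "pullback_eq M t M t f" and "c \<in> atlas M" "d \<in> atlas M" "p \<in> fst c" "f p \<in> fst d"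
  shows "quad M t c p v = quad M t d (f p) (\<lambda>a. \<Sum>i<mdim M. jacobian_entry c d f p a i * v i)"
proof -
  let ?J = "\<lambda>a i. jacobian_entry c d f p a i" and ?n = "mdim M"
  have "quad M t c p v = (\<Sum>i<?n. \<Sum>j<?n. (\<Sum>a<?n. \<Sum>b<?n. ?J a i * ?J b j * t d (f p) a b) * v i * v j)"
    unfolding quad_def using assms by (intro sum.cong) (auto simp: pullback_eq_def)
  also have "\<dots> = (\<Sum>i<?n. \<Sum>j<?n. \<Sum>a<?n. \<Sum>b<?n. t d (f p) a b * (?J a i * v i) * (?J b j * v j))"
    by (intro sum.cong refl, simp only: sum_distrib_right, intro sum.cong refl, simp only: mult_ac)
  also have "\<dots> = (\<Sum>i<?n. \<Sum>a<?n. \<Sum>j<?n. \<Sum>b<?n. t d (f p) a b * (?J a i * v i) * (?J b j * v j))"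
    by (rule sum.cong[OF refl], rule sum.swap)
  also have "\<dots> = (\<Sum>a<?n. \<Sum>i<?n. \<Sum>b<?n. \<Sum>j<?n. t d (f p) a b * (?J a i * v i) * (?J b j * v j))"
    by (rule trans[OF sum.swap], rule sum.cong[OF refl], rule sum.cong[OF refl], rule sum.swap)
  also have "\<dots> = (\<Sum>a<?n. \<Sum>b<?n. \<Sum>i<?n. \<Sum>j<?n. t d (f p) a b * (?J a i * v i) * (?J b j * v j))"
    by (rule sum.cong[OF refl], rule sum.swap)
  also have "\<dots> = quad M t d (f p) (\<lambda>a. \<Sum>i<?n. ?J a i * v i)"
    unfolding quad_def
    by (intro sum.cong refl, simp add: sum_distrib_left sum_distrib_right mult.assoc, rule sum.swap)
  finally show ?thesis .
qed

locale invariant_metric = equivariant_setup M G act m \<rho> \<phi>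
  for M :: "'a manifold" and G :: "('g, 'b) monoid_scheme" (structure) and act and m and \<rho> and \<phi> +
  fixes \<g> :: "'a tensor2"
  assumes metric: "riemannian_metric M \<g>"
    and act_pullback: "h \<in> carrier G \<Longrightarrow> pullback_eq M \<g> M \<g> (act h)"
begin

definition dominated :: "real \<Rightarrow> 'a \<Rightarrow> bool" where
  "dominated C p \<longleftrightarrow> (\<forall>c\<in>atlas M. p \<in> fst c \<longrightarrow> (\<forall>v. quad M P c p v \<le> C * quad M \<g> c p v))"

lemma pullback_g_id: "pullback_eq M \<g> M \<g> (\<lambda>p. p)"
  using metric by (simp add: riemannian_metric_def)

lemma quad_g_pos: "c \<in> atlas M \<Longrightarrow> p \<in> fst c \<Longrightarrow> \<exists>i<mdim M. v i \<noteq> 0 \<Longrightarrow> quad M \<g> c p v > 0"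
  using metric unfolding riemannian_metric_def quad_def by blast

lemma quad_g_nonneg: assumes "c \<in> atlas M" "p \<in> fst c" shows "quad M \<g> c p v \<ge> 0"
proof (cases "\<exists>i<mdim M. v i \<noteq> 0")
  case True
  then show ?thesis using quad_g_pos[OF assms] less_imp_le by blast
next
  case False
  then show ?thesis unfolding quad_def by (intro sum_nonneg) auto
qed

lemma dominated_mono: "dominated C p \<Longrightarrow> C \<le> C' \<Longrightarrow> dominated C' p"
  unfolding dominated_def by (meson quad_g_nonneg mult_right_mono order_trans)

text \<open>Both sides are tensors, so a change of chart only substitutes the vector
  \<open>v\<close>, and one chart around \<open>p\<close> suffices.\<close>

lemma dominatedI:
  assumes "c \<in> atlas M" "p \<in> fst c" "\<And>v. quad M P c p v \<le> C * quad M \<g> c p v"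
  shows "dominated C p"
  unfolding dominated_def
proof (intro ballI impI allI)
  fix d v assume d: "d \<in> atlas M" "p \<in> fst d"
  show "quad M P d p v \<le> C * quad M \<g> d p v"
    using quad_pullback[OF pullback_P_id d(1) assms(1) d(2) assms(2)]
      quad_pullback[OF pullback_g_id d(1) assms(1) d(2) assms(2)] assms(3) by simp
qed

lemma dominated_act:
  assumes h: "h \<in> carrier G" and p: "p \<in> X" and "dominated C (act h p)"
  shows "dominated C p"
proof -
  obtain c where c: "c \<in> atlas M" "p \<in> fst c" using cover p by blast
  obtain d where d: "d \<in> atlas M" "act h p \<in> fst d" using cover act_mem[OF h p] by blast
  show ?thesis
  proof (rule dominatedI[OF c])
    fix v
    show "quad M P c p v \<le> C * quad M \<g> c p v"
      unfolding quad_pullback[OF pullback_P_act[OF h] c(1) d(1) c(2) d(2)]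
        quad_pullback[OF act_pullback[OF h] c(1) d(1) c(2) d(2)]
      using assms(3) d unfolding dominated_def by blast
  qed
qed

text \<open>At \<open>p\<close> the metric is coercive with some constant \<open>\<kappa>\<close>.
  Near \<open>p\<close> its entries vary so little that it stays coercive with
  \<open>\<kappa> / 2\<close>, while the entries of \<open>P\<close> stay bounded.\<close>

lemma locally_dominated:
  assumes p: "p \<in> X"
  shows "\<exists>W (k::nat). openin (mtop M) W \<and> p \<in> W \<and> (\<forall>q\<in>W. dominated (real k) q)"
proof -
  let ?n = "mdim M"
  obtain c where c: "c \<in> atlas M" "p \<in> fst c" using cover p by blast
  have pos: "\<exists>i<?n. v i \<noteq> 0 \<Longrightarrow> (\<Sum>i<?n. \<Sum>j<?n. \<g> c p i j * v i * v j) > 0" for v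
    using quad_g_pos[OF c] unfolding quad_def by blast
  obtain \<kappa> where \<kappa>: "\<kappa> > 0" "\<And>v. (\<Sum>i<?n. \<Sum>j<?n. \<g> c p i j * v i * v j) \<ge> \<kappa> * (\<Sum>i<?n. (v i)\<^sup>2)"
    by (rule positive_definite_coercive[of ?n "\<g> c p", OF pos], assumption) (rule that)
  \<comment> \<open>One continuous function that controls the variation of all entries of both
    tensors and vanishes at \<open>p\<close>.\<close>
  define e where "e y = (\<Sum>i<?n. \<Sum>j<?n. \<bar>\<g> c (chart_inv c y) i j - \<g> c p i j\<bar> + \<bar>P c (chart_inv c y) i j - P c p i j\<bar>)" for y
  let ?I = "snd c ` fst c"
  have gc: "continuous_on ?I (\<lambda>y. \<g> c (chart_inv c y) i j)" if "i < ?n" "j < ?n" for i j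
  proof -
    have "smooth_on ?n ?I (\<lambda>y. \<g> c (chart_inv c y) i j)" using metric c(1) that by (simp add: riemannian_metric_def)
    then show ?thesis unfolding smooth_on_def using C_on_imp_continuous by blast
  qed
  have Pc: "continuous_on ?I (\<lambda>y. P c (chart_inv c y) i j)" if "i < ?n" "j < ?n" for i j
    using smooth_P[OF c(1) that] unfolding smooth_on_def using C_on_imp_continuous by blast
  have "continuous_on ?I e"
    unfolding e_def
    by (intro continuous_on_sum continuous_on_add continuous_on_rabs continuous_on_diff continuous_on_const gc Pc) auto
  \<comment> \<open>A change of all entries by at most \<open>\<epsilon>\<close> changes the
    quadratic form by at most \<open>n^2 * \<epsilon>\<close> times the squared norm, so at most
    half of the coercivity is lost; the summand 1 covers \<open>n = 0\<close>.\<close>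
  define \<epsilon> where "\<epsilon> = \<kappa> / (2 * (real ?n * real ?n + 1))"
  have \<epsilon>0: "\<epsilon> > 0" using \<kappa>(1) unfolding \<epsilon>_def by (intro divide_pos_pos) (auto intro: add_nonneg_pos)
  have \<epsilon>: "real ?n * real ?n * \<epsilon> \<le> \<kappa> / 2"
  proof -
    have "real ?n * real ?n * \<epsilon> = (\<kappa> / 2) * (real ?n * real ?n / (real ?n * real ?n + 1))" by (simp add: \<epsilon>_def)
    also have "\<dots> \<le> (\<kappa> / 2) * 1"
      using \<kappa>(1) by (intro mult_left_mono) (auto simp: divide_le_eq_1 intro: add_nonneg_pos)
    finally show ?thesis by simp
  qed
  have "snd c p \<in> ?I" using c(2) by blast
  from continuous_on_Euclidean_boxD[OF \<open>continuous_on ?I e\<close> chart_image_open'[OF c(1)] this \<epsilon>0]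
  obtain \<delta> where \<delta>: "\<delta> > 0"
    "\<And>y. y \<in> Rn ?n \<Longrightarrow> (\<forall>i<?n. \<bar>y i - snd c p i\<bar> < \<delta>) \<Longrightarrow> y \<in> ?I \<and> \<bar>e y - e (snd c p)\<bar> < \<epsilon>" by blast
  have e0: "e (snd c p) = 0" unfolding e_def using chart_inv_app[OF c] by simp
  define V where "V = {y \<in> Rn ?n. \<forall>i<?n. y i \<in> {snd c p i - \<delta><..<snd c p i + \<delta>}}"
  have V: "openin (Euclidean_space ?n) V" unfolding V_def by (rule openin_Euclidean_space_box) auto
  have Ve: "e y < \<epsilon>" if "y \<in> V" for y
  proof -
    have "\<forall>i<?n. \<bar>y i - snd c p i\<bar> < \<delta>" using that unfolding V_def by (auto simp: abs_less_iff)
    moreover have "y \<in> Rn ?n" using that unfolding V_def by blast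
    ultimately have "\<bar>e y - e (snd c p)\<bar> < \<epsilon>" using \<delta>(2) by blast
    then show ?thesis using e0 by linarith
  qed
  define W where "W = {q \<in> fst c. snd c q \<in> V}"
  have "openin (mtop M) W"
  proof -
    have VI: "openin (subtopology (Euclidean_space ?n) ?I) (?I \<inter> V)"
      using V openin_subtopology_Int2 by blast
    have "openin (subtopology (mtop M) (fst c)) {q \<in> topspace (subtopology (mtop M) (fst c)). snd c q \<in> ?I \<inter> V}"
      using homeomorphic_imp_continuous_map[OF chart_homeo[OF c(1)]] VI unfolding continuous_map_def by blast
    moreover have "{q \<in> topspace (subtopology (mtop M) (fst c)). snd c q \<in> ?I \<inter> V} = W"
      using chart_sub[OF c(1)] unfolding W_def topspace_subtopology by blast
    ultimately show ?thesis using chart_open[OF c(1)] by (metis openin_trans_full)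
  qed
  moreover have "p \<in> W"
  proof -
    have "snd c p \<in> Rn ?n" using openin_subset[OF chart_image_open'[OF c(1)]] c(2) by blast
    then show ?thesis using c(2) \<delta>(1) by (simp add: W_def V_def)
  qed
  moreover have "\<exists>k::nat. \<forall>q\<in>W. dominated (real k) q"
  proof -
    \<comment> \<open>\<open>B\<close> bounds all entries of \<open>P\<close> on \<open>W\<close>,
      and \<open>k\<close> exceeds the ratio of the resulting upper bound for \<open>P\<close> to
      the lower bound \<open>\<kappa> / 2\<close> for the metric.\<close>
    define B where "B = (\<Sum>i<?n. \<Sum>j<?n. \<bar>P c p i j\<bar>) + \<epsilon>"
    obtain k :: nat where k: "real ?n * real ?n * B / (\<kappa> / 2) < real k" using reals_Archimedean2 by blast
    have "dominated (real k) q" if q: "q \<in> W" for q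
    proof (rule dominatedI[OF c(1)])
      show qc: "q \<in> fst c" using q by (simp add: W_def)
      fix v :: "nat \<Rightarrow> real"
      let ?s = "\<Sum>i<?n. (v i)\<^sup>2"
      have s0: "?s \<ge> 0" by (intro sum_nonneg) auto
      have eq: "\<bar>\<g> c q i j - \<g> c p i j\<bar> + \<bar>P c q i j - P c p i j\<bar> < \<epsilon>" if "i < ?n" "j < ?n" for i j
      proof -
        have "\<bar>\<g> c q i j - \<g> c p i j\<bar> + \<bar>P c q i j - P c p i j\<bar> \<le>
            (\<Sum>j<?n. \<bar>\<g> c q i j - \<g> c p i j\<bar> + \<bar>P c q i j - P c p i j\<bar>)"
          using that by (intro member_le_sum) auto
        also have "\<dots> \<le> e (snd c q)"
          unfolding e_def chart_inv_app[OF c(1) qc]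
          using that(1) by (intro member_le_sum[of i "{..<?n}" "\<lambda>i. \<Sum>j<?n. \<bar>\<g> c q i j - \<g> c p i j\<bar> + \<bar>P c q i j - P c p i j\<bar>"] sum_nonneg) auto
        also have "\<dots> < \<epsilon>" using q by (intro Ve) (simp add: W_def)
        finally show ?thesis .
      qed
      have "\<bar>\<Sum>i<?n. \<Sum>j<?n. (\<g> c q i j - \<g> c p i j) * v i * v j\<bar> \<le> real ?n * real ?n * \<epsilon> * ?s"
        using eq by (intro quadratic_form_bound) (smt (verit))
      also have "\<dots> \<le> \<kappa> / 2 * ?s" using \<epsilon> s0 by (rule mult_right_mono)
      finally have "\<bar>quad M \<g> c q v - (\<Sum>i<?n. \<Sum>j<?n. \<g> c p i j * v i * v j)\<bar> \<le> \<kappa> / 2 * ?s"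
        unfolding quad_def by (simp add: left_diff_distrib sum_subtractf)
      then have low: "\<kappa> / 2 * ?s \<le> quad M \<g> c q v" using \<kappa>(2)[of v] by linarith
      have "\<bar>P c q i j\<bar> \<le> B" if "i < ?n" "j < ?n" for i j
      proof -
        have "\<bar>P c p i j\<bar> \<le> (\<Sum>j<?n. \<bar>P c p i j\<bar>)" using that by (intro member_le_sum) auto
        also have "\<dots> \<le> (\<Sum>i<?n. \<Sum>j<?n. \<bar>P c p i j\<bar>)"
          using that(1) by (intro member_le_sum[of i "{..<?n}" "\<lambda>i. \<Sum>j<?n. \<bar>P c p i j\<bar>"] sum_nonneg) auto
        finally show ?thesis using eq[OF that] by (simp add: B_def)
      qed
      then have "\<bar>quad M P c q v\<bar> \<le> real ?n * real ?n * B * ?s"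
        unfolding quad_def by (rule quadratic_form_bound)
      then have "quad M P c q v \<le> real ?n * real ?n * B / (\<kappa> / 2) * (\<kappa> / 2 * ?s)" using \<kappa>(1) by simp
      also have "\<dots> \<le> real k * (\<kappa> / 2 * ?s)"
        using k \<kappa>(1) s0 by (intro mult_right_mono) auto
      also have "\<dots> \<le> real k * quad M \<g> c q v" using low by (intro mult_left_mono) auto
      finally show "quad M P c q v \<le> real k * quad M \<g> c q v" .
    qed
    then show ?thesis by blast
  qed
  ultimately show ?thesis by blast
qed

text \<open>The least constant that works on a neighbourhood need not depend continuously on the
  point, but its sublevel sets are open. So some bound holds at a point of every orbit, and
  invariance of both tensors spreads it over the orbit.\<close>

lemma globally_dominated:
  obtains C where "C > 0" "\<And>p. p \<in> X \<Longrightarrow> dominated C p"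
proof -
  define Q where "Q p k \<longleftrightarrow> (\<exists>W. openin (mtop M) W \<and> p \<in> W \<and> (\<forall>q\<in>W. dominated (real k) q))" for p and k :: nat
  define f where "f p = real (LEAST k. Q p k)" for p
  have Qf: "Q p (LEAST k. Q p k)" if "p \<in> X" for p
  proof -
    have "\<exists>k. Q p k" using locally_dominated[OF that] unfolding Q_def by blast
    then show ?thesis by (rule LeastI_ex)
  qed
  have "openin (mtop M) {p \<in> X. f p < real k}" for k
  proof (subst openin_subopen, intro ballI)
    fix p assume p: "p \<in> {p \<in> X. f p < real k}"
    then have "Q p (LEAST k. Q p k)" by (intro Qf) blast
    then obtain W where W: "openin (mtop M) W" "p \<in> W" "\<forall>q\<in>W. dominated (real (LEAST k. Q p k)) q"
      using Q_def[of p "LEAST k. Q p k"] by blast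
    \<comment> \<open>The neighbourhood \<open>W\<close> that serves \<open>p\<close> serves each of
      its points as well.\<close>
    have "f q \<le> f p" if "q \<in> W" for q
    proof -
      have "Q q (LEAST k. Q p k)" using Q_def[of q "LEAST k. Q p k"] W(1,3) that by blast
      then show ?thesis unfolding f_def of_nat_le_iff by (rule Least_le)
    qed
    then have "W \<subseteq> {p \<in> X. f p < real k}" using p openin_subset[OF W(1)] by force
    then show "\<exists>T. openin (mtop M) T \<and> p \<in> T \<and> T \<subseteq> {p \<in> X. f p < real k}" using W(1,2) by blast
  qed
  then have "openin (mtop M) {p \<in> X. \<exists>g\<in>carrier G. act g p \<in> {p \<in> X. f p < real k}}" for k
    by (rule saturation_open)
  moreover have "{p \<in> X. \<exists>g\<in>carrier G. act g p \<in> {p \<in> X. f p < real k}} = {p \<in> X. \<exists>g\<in>carrier G. f (act g p) < real k}" for k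
    using act_mem by blast
  ultimately have "openin (mtop M) {p \<in> X. \<exists>g\<in>carrier G. f (act g p) < real k}" for k :: nat by simp
  then obtain k :: nat where k: "\<And>p. p \<in> X \<Longrightarrow> \<exists>g\<in>carrier G. f (act g p) < real k"
    using cocompact_exhaustion[OF cc orbit_refl, of f] by blast
  have "dominated (real (Suc k)) p" if p: "p \<in> X" for p
  proof -
    obtain g where g: "g \<in> carrier G" "f (act g p) < real k" using k[OF p] by blast
    have "dominated (f (act g p)) (act g p)"
      using Qf[OF act_mem[OF g(1) p]] Q_def[of "act g p" "LEAST k. Q (act g p) k"] unfolding f_def by blast
    then have "dominated (real (Suc k)) (act g p)" by (rule dominated_mono) (use g(2) in simp)
    then show ?thesis by (rule dominated_act[OF g(1) p])
  qed
  then show ?thesis by (intro that[of "real (Suc k)"]) auto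
qed

lemma remainder_metric:
  obtains \<epsilon> where "\<epsilon> > 0" "riemannian_metric M (\<lambda>c p i j. \<g> c p i j - \<epsilon>\<^sup>2 * P c p i j)"
    "\<forall>h\<in>carrier G. pullback_eq M (\<lambda>c p i j. \<g> c p i j - \<epsilon>\<^sup>2 * P c p i j) M (\<lambda>c p i j. \<g> c p i j - \<epsilon>\<^sup>2 * P c p i j) (act h)"
proof -
  obtain C where C: "C > 0" "\<And>p. p \<in> X \<Longrightarrow> dominated C p" by (rule globally_dominated) (rule that)
  \<comment> \<open>Then \<open>\<epsilon>\<^sup>2 * C = 1 / 2\<close>, so at least half of the
    metric survives the subtraction.\<close>
  define \<epsilon> where "\<epsilon> = 1 / sqrt (2 * C)"
  have \<epsilon>: "\<epsilon> > 0" "\<epsilon>\<^sup>2 * C = 1 / 2" using C(1) by (auto simp: \<epsilon>_def power_divide)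
  define h where "h = (\<lambda>c p i j. \<g> c p i j - \<epsilon>\<^sup>2 * P c p i j)"
  have pb: "pullback_eq M h M h f" if "pullback_eq M \<g> M \<g> f" "pullback_eq M P M P f" for f
    unfolding pullback_eq_def
  proof (intro ballI allI impI)
    fix c d p i j assume *: "c \<in> atlas M" "d \<in> atlas M" "p \<in> fst c \<inter> f -` fst d" "i < mdim M" "j < mdim M"
    let ?J = "\<lambda>a b. jacobian_entry c d f p a i * jacobian_entry c d f p b j"
    have "h c p i j = (\<Sum>a<mdim M. \<Sum>b<mdim M. ?J a b * \<g> d (f p) a b) - \<epsilon>\<^sup>2 * (\<Sum>a<mdim M. \<Sum>b<mdim M. ?J a b * P d (f p) a b)"
      using that * unfolding pullback_eq_def h_def by simp
    also have "\<dots> = (\<Sum>a<mdim M. \<Sum>b<mdim M. ?J a b * h d (f p) a b)"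
      unfolding h_def by (simp add: right_diff_distrib sum_subtractf sum_distrib_left mult_ac)
    finally show "h c p i j = (\<Sum>a<mdim M. \<Sum>b<mdim M. ?J a b * h d (f p) a b)" .
  qed
  have "riemannian_metric M h"
    unfolding riemannian_metric_def
  proof (intro conjI ballI allI impI)
    show "pullback_eq M h M h (\<lambda>p. p)" by (rule pb[OF pullback_g_id pullback_P_id])
    fix c i j assume c: "c \<in> atlas M" and ij: "i < mdim M" "j < mdim M"
    have "smooth_on (mdim M) (snd c ` fst c) (\<lambda>y. \<g> c (chart_inv c y) i j)"
      using metric c ij by (simp add: riemannian_metric_def)
    then show "smooth_on (mdim M) (snd c ` fst c) (\<lambda>y. h c (chart_inv c y) i j)"
      unfolding h_def by (intro smooth_on_diff smooth_on_mult smooth_on_const smooth_P chart_image_open' c ij)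
  next
    fix c p i j assume "c \<in> atlas M" "p \<in> fst c" "i < mdim M" "j < mdim M"
    then have "\<g> c p i j = \<g> c p j i" using metric unfolding riemannian_metric_def by blast
    then show "h c p i j = h c p j i" by (simp add: h_def P_def mult.commute)
  next
    fix c p and v :: "nat \<Rightarrow> real" assume c: "c \<in> atlas M" "p \<in> fst c" and v: "\<exists>i<mdim M. v i \<noteq> 0"
    have "quad M P c p v \<le> C * quad M \<g> c p v" using C(2)[of p] c chart_sub unfolding dominated_def by blast
    then have "\<epsilon>\<^sup>2 * quad M P c p v \<le> \<epsilon>\<^sup>2 * (C * quad M \<g> c p v)" by (rule mult_left_mono) simp
    also have "\<dots> = (\<epsilon>\<^sup>2 * C) * quad M \<g> c p v" by simp
    finally have "\<epsilon>\<^sup>2 * quad M P c p v \<le> 1 / 2 * quad M \<g> c p v" unfolding \<epsilon>(2) .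
    then have "0 < quad M \<g> c p v - \<epsilon>\<^sup>2 * quad M P c p v" using quad_g_pos[OF c v] by linarith
    also have "\<dots> = (\<Sum>i<mdim M. \<Sum>j<mdim M. h c p i j * v i * v j)"
      unfolding quad_def h_def by (simp add: left_diff_distrib sum_subtractf sum_distrib_left mult.assoc)
    finally show "0 < (\<Sum>i<mdim M. \<Sum>j<mdim M. h c p i j * v i * v j)" .
  qed
  moreover have "pullback_eq M h M h (act g)" if "g \<in> carrier G" for g
    by (rule pb[OF act_pullback[OF that] pullback_P_act[OF that]])
  ultimately show ?thesis using that[OF \<epsilon>(1)] unfolding h_def by blast
qed

end

section \<open>Charts of the quotient and descent of invariant metrics\<close>

lemma partial_deriv_coord: "partial_deriv i (\<lambda>y. y a) y = (if a = i then 1 else 0)"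
  by (rule partial_deriv_eqI) (auto intro!: derivative_eq_intros)

context equivariant_setup
begin

abbreviation "quot \<equiv> quotient_manifold M G act"

definition qchart :: "'a chart \<Rightarrow> 'a set \<Rightarrow> 'a set chart" where
  "qchart c V = (\<pi> ` V, \<lambda>q. snd c (inv_into V \<pi> q))"

definition sheet :: "'a chart \<Rightarrow> 'a set \<Rightarrow> bool" where
  "sheet c V \<longleftrightarrow> c \<in> atlas M \<and> openin (mtop M) V \<and> V \<subseteq> fst c \<and> inj_on \<pi> V"

lemma sheetD:
  assumes "sheet c V"
  shows "c \<in> atlas M" "openin (mtop M) V" "V \<subseteq> fst c" "inj_on \<pi> V" "V \<subseteq> X"
  using assms openin_subset unfolding sheet_def by blast+

lemma quot_simps:
  "mdim quot = mdim M" "mtop quot = orbit_topology G (mtop M) act"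
  "atlas quot = {qchart c V | c V. sheet c V}"
  unfolding quotient_manifold_def qchart_def sheet_def by simp_all

lemma sheet_inv: "sheet c V \<Longrightarrow> p \<in> V \<Longrightarrow> inv_into V \<pi> (\<pi> p) = p"
  using sheetD(4) inv_into_f_f by metis

lemma fst_qchart: "fst (qchart c V) = \<pi> ` V"
  by (simp add: qchart_def)

lemma snd_qchart: "sheet c V \<Longrightarrow> p \<in> V \<Longrightarrow> snd (qchart c V) (\<pi> p) = snd c p"
  by (simp add: qchart_def sheet_inv)

lemma qchart_image: "sheet c V \<Longrightarrow> snd (qchart c V) ` fst (qchart c V) = snd c ` V"
  unfolding fst_qchart image_image by (rule image_cong[OF refl]) (rule snd_qchart)

lemma sheet_image_open: "sheet c V \<Longrightarrow> openin (Euclidean_space (mdim M)) (snd c ` V)"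
  using chart_image_open[of c V] sheetD[of c V] by (simp add: Int_absorb1)

lemma sheet_chart_inv:
  assumes "sheet c V" "y \<in> snd c ` V"
  shows "chart_inv c y \<in> V" "snd c (chart_inv c y) = y"
  using chart_inv_mem[OF assms(2) sheetD(1)[OF assms(1)] sheetD(3)[OF assms(1)]]
    app_chart_inv[of y c] assms(2) sheetD(3)[OF assms(1)] by blast+

lemma qchart_inv:
  assumes s: "sheet c V" and y: "y \<in> snd c ` V"
  shows "chart_inv (qchart c V) y = \<pi> (chart_inv c y)"
proof -
  let ?p = "chart_inv c y"
  have "inj_on (snd (qchart c V)) (fst (qchart c V))"
  proof (rule inj_onI)
    fix q q' assume "q \<in> fst (qchart c V)" "q' \<in> fst (qchart c V)" and eq: "snd (qchart c V) q = snd (qchart c V) q'"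
    then obtain p p' where p: "p \<in> V" "q = \<pi> p" "p' \<in> V" "q' = \<pi> p'" unfolding fst_qchart by blast
    have "snd c p = snd c p'" using eq p snd_qchart[OF s] by simp
    then have "p = p'" using chart_inj[OF sheetD(1)[OF s]] sheetD(3)[OF s] p by (meson inj_onD subsetD)
    then show "q = q'" using p by simp
  qed
  moreover have "\<pi> ?p \<in> fst (qchart c V)" using sheet_chart_inv(1)[OF s y] by (simp add: fst_qchart)
  ultimately have "chart_inv (qchart c V) (snd (qchart c V) (\<pi> ?p)) = \<pi> ?p"
    unfolding chart_inv_def[of "qchart c V"] by (rule inv_into_f_f)
  then show ?thesis using snd_qchart[OF s sheet_chart_inv(1)[OF s y]] sheet_chart_inv(2)[OF s y] by simp
qed

text \<open>Near \<open>p\<close>, the passage from one sheet to another over the same orbits is the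
  action of the single element \<open>g\<close> with \<open>act g p\<close> in the second sheet,
  since the projection is injective there.\<close>

lemma jacobian_qchart:
  assumes s1: "sheet c1 V1" and s2: "sheet c2 V2" and p: "p \<in> V1" and g: "g \<in> carrier G"
    and gp: "act g p \<in> V2" and i: "i < mdim M"
  shows "jacobian_entry (qchart c1 V1) (qchart c2 V2) (\<lambda>q. q) (\<pi> p) a i = jacobian_entry c1 c2 (act g) p a i"
proof -
  let ?W = "V1 \<inter> {p \<in> X. act g p \<in> V2}"
  have W: "openin (mtop M) ?W"
    using sheetD(2)[OF s1] act_preimage_open[OF g sheetD(2)[OF s2]] by (rule openin_Int)
  note U = chart_image_open[OF sheetD(1)[OF s1] W]
  have pU: "snd c1 p \<in> snd c1 ` (fst c1 \<inter> ?W)" using p gp sheetD(3,5)[OF s1] by blast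
  have "partial_deriv i (\<lambda>y. snd (qchart c2 V2) (chart_inv (qchart c1 V1) y) a) (snd c1 p)
      = partial_deriv i (\<lambda>y. snd c2 (act g (chart_inv c1 y)) a) (snd c1 p)"
  proof (rule partial_deriv_cong[OF U pU i])
    fix y assume "y \<in> snd c1 ` (fst c1 \<inter> ?W)"
    then obtain q where q: "q \<in> V1" "q \<in> X" "act g q \<in> V2" "y = snd c1 q" by blast
    have qc: "chart_inv c1 y = q" using chart_inv_app[OF sheetD(1)[OF s1]] q sheetD(3)[OF s1] by blast
    have "chart_inv (qchart c1 V1) y = \<pi> q" using qchart_inv[OF s1, of y] q(1,4) qc by simp
    also have "\<dots> = \<pi> (act g q)" using orbit_eq_iff[OF q(2) act_mem[OF g q(2)]] g by blast
    finally show "snd (qchart c2 V2) (chart_inv (qchart c1 V1) y) a = snd c2 (act g (chart_inv c1 y)) a"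
      using snd_qchart[OF s2 q(3)] qc by simp
  qed
  then show ?thesis unfolding jacobian_entry_def snd_qchart[OF s1 p] .
qed

lemma jacobian_qchart_self:
  assumes s: "sheet c V" and p: "p \<in> V" and i: "i < mdim M"
  shows "jacobian_entry (qchart c V) (qchart c V) (\<lambda>q. q) (\<pi> p) a i = (if a = i then 1 else 0)"
proof -
  have "partial_deriv i (\<lambda>y. snd (qchart c V) (chart_inv (qchart c V) y) a) (snd c p) = partial_deriv i (\<lambda>y. y a) (snd c p)"
  proof (rule partial_deriv_cong[OF sheet_image_open[OF s] _ i])
    show "snd c p \<in> snd c ` V" using p by blast
    fix y assume y: "y \<in> snd c ` V"
    show "snd (qchart c V) (chart_inv (qchart c V) y) a = y a"
      using qchart_inv[OF s y] snd_qchart[OF s sheet_chart_inv(1)[OF s y]] sheet_chart_inv(2)[OF s y] by simp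
  qed
  then show ?thesis unfolding jacobian_entry_def snd_qchart[OF s p] partial_deriv_coord .
qed

text \<open>A tensor is indexed by charts, but a chart of the quotient does not remember the pair
  \<open>(c, V)\<close> it came from. One pair is chosen here; independence of the choice is
  \<open>quot_metric_qchart\<close>.\<close>

definition sheet_of :: "'a set chart \<Rightarrow> 'a chart \<times> 'a set" where
  "sheet_of d = (SOME s. sheet (fst s) (snd s) \<and> d = qchart (fst s) (snd s))"

definition quot_metric :: "'a tensor2 \<Rightarrow> 'a set tensor2" where
  "quot_metric h d q i j = h (fst (sheet_of d)) (inv_into (snd (sheet_of d)) \<pi> q) i j"

lemma sheet_of:
  assumes "d \<in> atlas quot"
  shows "sheet (fst (sheet_of d)) (snd (sheet_of d))" "d = qchart (fst (sheet_of d)) (snd (sheet_of d))"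
proof -
  obtain c V where "sheet c V" "d = qchart c V" using assms unfolding quot_simps by blast
  then have "\<exists>s. sheet (fst s) (snd s) \<and> d = qchart (fst s) (snd s)" by (intro exI[of _ "(c, V)"]) simp
  then have "sheet (fst (sheet_of d)) (snd (sheet_of d)) \<and> d = qchart (fst (sheet_of d)) (snd (sheet_of d))"
    unfolding sheet_of_def by (rule someI_ex)
  then show "sheet (fst (sheet_of d)) (snd (sheet_of d))" "d = qchart (fst (sheet_of d)) (snd (sheet_of d))" by blast+
qed

context
  fixes h :: "'a tensor2"
  assumes metric_h: "riemannian_metric M h"
    and act_h: "\<forall>g\<in>carrier G. pullback_eq M h M h (act g)"
begin

text \<open>Invariance of \<open>h\<close> under the element that carries \<open>p1\<close> to
  \<open>p2\<close>, rewritten with the Jacobians of the quotient charts.\<close>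

lemma sheet_transform:
  assumes s1: "sheet c1 V1" and s2: "sheet c2 V2" and p1: "p1 \<in> V1" and p2: "p2 \<in> V2" and eq: "\<pi> p1 = \<pi> p2"
    and ij: "i < mdim M" "j < mdim M"
  shows "h c1 p1 i j = (\<Sum>a<mdim M. \<Sum>b<mdim M.
    jacobian_entry (qchart c1 V1) (qchart c2 V2) (\<lambda>q. q) (\<pi> p1) a i *
    jacobian_entry (qchart c1 V1) (qchart c2 V2) (\<lambda>q. q) (\<pi> p1) b j * h c2 p2 a b)"
proof -
  have "p1 \<in> X" "p2 \<in> X" using p1 p2 sheetD(5)[OF s1] sheetD(5)[OF s2] by blast+
  then obtain g where g: "g \<in> carrier G" "p2 = act g p1" using orbit_eq_iff eq by blast
  have J: "jacobian_entry (qchart c1 V1) (qchart c2 V2) (\<lambda>q. q) (\<pi> p1) a i = jacobian_entry c1 c2 (act g) p1 a i"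
    if "i < mdim M" for a i
    using jacobian_qchart[OF s1 s2 p1 g(1) _ that] p2 g(2) by blast
  have "p1 \<in> fst c1 \<inter> act g -` fst c2" using p1 p2 g(2) sheetD(3)[OF s1] sheetD(3)[OF s2] by blast
  then show ?thesis
    using bspec[OF act_h g(1)] sheetD(1)[OF s1] sheetD(1)[OF s2] ij unfolding pullback_eq_def J[OF ij(1)] J[OF ij(2)] g(2) by blast
qed

text \<open>The given pair and the chosen one induce the same quotient chart, so the Jacobian in
  \<open>sheet_transform\<close> is the identity matrix and the components agree.\<close>

lemma quot_metric_qchart:
  assumes s: "sheet c V" and p: "p \<in> V" and ij: "i < mdim M" "j < mdim M"
  shows "quot_metric h (qchart c V) (\<pi> p) i j = h c p i j"
proof -
  let ?d = "qchart c V"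
  have "?d \<in> atlas quot" unfolding quot_simps using s by blast
  note s' = sheet_of[OF this]
  let ?c = "fst (sheet_of ?d)" and ?V = "snd (sheet_of ?d)"
  have "fst ?d = fst (qchart ?c ?V)" using s'(2) by (rule arg_cong)
  then have "\<pi> ` V = \<pi> ` ?V" unfolding fst_qchart .
  \<comment> \<open>The chosen sheet may contain another point \<open>p'\<close> of the same orbit
    instead of \<open>p\<close>.\<close>
  then obtain p' where p': "p' \<in> ?V" "\<pi> p = \<pi> p'" using p by blast
  have "h c p i j = (\<Sum>a<mdim M. \<Sum>b<mdim M. (if a = i then 1 else 0) * (if b = j then 1 else 0) * h ?c p' a b)"
    using sheet_transform[OF s s'(1) p p'(1,2) ij] unfolding s'(2)[symmetric]
      jacobian_qchart_self[OF s p ij(1)] jacobian_qchart_self[OF s p ij(2)] .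
  also have "\<dots> = (\<Sum>a<mdim M. if a = i then \<Sum>b<mdim M. if b = j then h ?c p' a b else 0 else 0)"
  proof (rule sum.cong[OF refl])
    fix a
    have "(\<Sum>b<mdim M. (if a = i then 1 else 0) * (if b = j then 1 else 0) * h ?c p' a b)
        = (\<Sum>b<mdim M. if a = i then if b = j then h ?c p' a b else 0 else 0)"
      by (rule sum.cong) auto
    then show "(\<Sum>b<mdim M. (if a = i then 1 else 0) * (if b = j then 1 else 0) * h ?c p' a b)
        = (if a = i then \<Sum>b<mdim M. if b = j then h ?c p' a b else 0 else 0)" by simp
  qed
  also have "\<dots> = h ?c p' i j" using ij by simp
  also have "\<dots> = quot_metric h ?d (\<pi> p) i j"
    unfolding quot_metric_def p'(2) sheet_inv[OF s'(1) p'(1)] ..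
  finally show ?thesis by simp
qed

lemma quot_metric_riemannian: "riemannian_metric quot (quot_metric h)"
  unfolding riemannian_metric_def
proof (intro conjI ballI allI impI)
  show "pullback_eq quot (quot_metric h) quot (quot_metric h) (\<lambda>q. q)"
    unfolding pullback_eq_def
  proof (intro ballI allI impI)
    fix d1 d2 q i j assume d: "d1 \<in> atlas quot" "d2 \<in> atlas quot" and q: "q \<in> fst d1 \<inter> (\<lambda>q. q) -` fst d2"
      and "i < mdim quot" "j < mdim quot"
    then have ij: "i < mdim M" "j < mdim M" by (simp_all add: quot_simps)
    obtain c1 V1 where s1: "sheet c1 V1" "d1 = qchart c1 V1" using d(1) unfolding quot_simps by blast
    obtain c2 V2 where s2: "sheet c2 V2" "d2 = qchart c2 V2" using d(2) unfolding quot_simps by blast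
    obtain p1 where p1: "p1 \<in> V1" "q = \<pi> p1" using q unfolding s1(2) fst_qchart by blast
    obtain p2 where p2: "p2 \<in> V2" "q = \<pi> p2" using q unfolding s2(2) fst_qchart by blast
    have "quot_metric h d1 q i j = h c1 p1 i j"
      unfolding s1(2) p1(2) by (rule quot_metric_qchart[OF s1(1) p1(1) ij])
    also have "\<dots> = (\<Sum>a<mdim M. \<Sum>b<mdim M. jacobian_entry d1 d2 (\<lambda>q. q) q a i * jacobian_entry d1 d2 (\<lambda>q. q) q b j * h c2 p2 a b)"
      using sheet_transform[OF s1(1) s2(1) p1(1) p2(1) _ ij] p1(2) p2(2) unfolding s1(2)[symmetric] s2(2)[symmetric] by simp
    also have "\<dots> = (\<Sum>a<mdim M. \<Sum>b<mdim M. jacobian_entry d1 d2 (\<lambda>q. q) q a i * jacobian_entry d1 d2 (\<lambda>q. q) q b j * quot_metric h d2 q a b)"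
      by (intro sum.cong refl) (simp add: s2(2) p2 quot_metric_qchart[OF s2(1) p2(1)])
    finally show "quot_metric h d1 q i j = (\<Sum>a<mdim quot. \<Sum>b<mdim quot.
        jacobian_entry d1 d2 (\<lambda>q. q) q a i * jacobian_entry d1 d2 (\<lambda>q. q) q b j * quot_metric h d2 q a b)"
      by (simp add: quot_simps)
  qed
next
  fix d i j assume d: "d \<in> atlas quot" and "i < mdim quot" "j < mdim quot"
  then have ij: "i < mdim M" "j < mdim M" by (simp_all add: quot_simps)
  obtain c V where s: "sheet c V" "d = qchart c V" using d unfolding quot_simps by blast
  note c = sheetD(1)[OF s(1)]
  have "smooth_on (mdim M) (snd c ` V) (\<lambda>y. quot_metric h d (chart_inv d y) i j)"
  proof (rule smooth_on_local[OF sheet_image_open[OF s(1)]])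
    fix y assume "y \<in> snd c ` V"
    show "\<exists>U f. openin (Euclidean_space (mdim M)) U \<and> y \<in> U \<and> smooth_on (mdim M) U f \<and>
        (\<forall>z\<in>U. quot_metric h d (chart_inv d z) i j = f z)"
    proof (intro exI conjI ballI)
      show "openin (Euclidean_space (mdim M)) (snd c ` V)" by (rule sheet_image_open[OF s(1)])
      show "y \<in> snd c ` V" by fact
      have "smooth_on (mdim M) (snd c ` fst c) (\<lambda>y. h c (chart_inv c y) i j)"
        using metric_h c ij by (simp add: riemannian_metric_def)
      then show "smooth_on (mdim M) (snd c ` V) (\<lambda>y. h c (chart_inv c y) i j)"
        by (rule smooth_on_subset) (use sheetD(3)[OF s(1)] in blast)
      fix z assume z: "z \<in> snd c ` V"
      show "quot_metric h d (chart_inv d z) i j = h c (chart_inv c z) i j"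
        unfolding s(2) qchart_inv[OF s(1) z] by (rule quot_metric_qchart[OF s(1) sheet_chart_inv(1)[OF s(1) z] ij])
    qed
  qed
  then show "smooth_on (mdim quot) (snd d ` fst d) (\<lambda>y. quot_metric h d (chart_inv d y) i j)"
    unfolding quot_simps s(2) qchart_image[OF s(1)] .
next
  fix d q i j assume d: "d \<in> atlas quot" "q \<in> fst d" and "i < mdim quot" "j < mdim quot"
  then have ij: "i < mdim M" "j < mdim M" by (simp_all add: quot_simps)
  obtain c V where s: "sheet c V" "d = qchart c V" using d(1) unfolding quot_simps by blast
  obtain p where p: "p \<in> V" "q = \<pi> p" using d(2) unfolding s(2) fst_qchart by blast
  have "h c p i j = h c p j i"
    using metric_h sheetD(1,3)[OF s(1)] p(1) ij unfolding riemannian_metric_def by blast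
  then show "quot_metric h d q i j = quot_metric h d q j i"
    unfolding s(2) p(2) by (simp add: quot_metric_qchart[OF s(1) p(1)] ij)
next
  fix d q and v :: "nat \<Rightarrow> real" assume d: "d \<in> atlas quot" "q \<in> fst d" and v: "\<exists>i<mdim quot. v i \<noteq> 0"
  obtain c V where s: "sheet c V" "d = qchart c V" using d(1) unfolding quot_simps by blast
  obtain p where p: "p \<in> V" "q = \<pi> p" using d(2) unfolding s(2) fst_qchart by blast
  have "0 < (\<Sum>i<mdim M. \<Sum>j<mdim M. h c p i j * v i * v j)"
    using metric_h sheetD(1,3)[OF s(1)] p(1) v unfolding riemannian_metric_def quot_simps by blast
  also have "\<dots> = (\<Sum>i<mdim quot. \<Sum>j<mdim quot. quot_metric h d q i j * v i * v j)"
    unfolding s(2) p(2) quot_simps by (intro sum.cong refl) (simp add: quot_metric_qchart[OF s(1) p(1)])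
  finally show "0 < (\<Sum>i<mdim quot. \<Sum>j<mdim quot. quot_metric h d q i j * v i * v j)" .
qed

text \<open>In the charts \<open>c\<close> and \<open>qchart c V\<close> the projection is the
  identity, so the derivatives of \<open>v \<circ> \<pi>\<close> and of \<open>v\<close> coincide,
  and the metric induced by \<open>v \<circ> \<pi>\<close> is \<open>h\<close>.\<close>

lemma pullback_embedding:
  assumes v: "isometric_embedding quot (quot_metric h) N v"
  shows "continuous_map (mtop M) (Euclidean_space N) (\<lambda>p. v (\<pi> p))"
    and "a < N \<Longrightarrow> smooth_fun M (\<lambda>p. v (\<pi> p) a)"
    and "c \<in> atlas M \<Longrightarrow> p \<in> fst c \<Longrightarrow> i < mdim M \<Longrightarrow> j < mdim M \<Longrightarrow>
      h c p i j = (\<Sum>a<N. coord_deriv c (\<lambda>p. v (\<pi> p) a) p i * coord_deriv c (\<lambda>p. v (\<pi> p) a) p j)"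
proof -
  have sm: "smooth_map quot (euclid N) v" and pb: "pullback_eq quot (quot_metric h) (euclid N) flat_metric v"
    using v by (simp_all add: isometric_embedding_def smooth_embedding_def immersion_def)
  have vc: "continuous_map (orbit_topology G (mtop M) act) (Euclidean_space N) v"
    using sm by (simp add: smooth_map_def quot_simps euclid_def)
  have "continuous_map (mtop M) (orbit_topology G (mtop M) act) \<pi>"
    by (rule quotient_imp_continuous_map[OF quotient_map_orbit])
  from continuous_map_compose[OF this vc] show wc: "continuous_map (mtop M) (Euclidean_space N) (\<lambda>p. v (\<pi> p))"
    by (simp add: o_def)
  have wm: "v (\<pi> p) \<in> Rn N" if "p \<in> X" for p using wc that unfolding continuous_map_def by blast
  have smV: "smooth_on (mdim M) (snd c ` V) (\<lambda>y. v (chart_inv (qchart c V) y) a)" if s: "sheet c V" and a: "a < N" for c V a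
  proof -
    let ?d = "qchart c V"
    have "?d \<in> atlas quot" unfolding quot_simps using s by blast
    moreover have "(Rn N, \<lambda>x. x) \<in> atlas (euclid N)" by (simp add: euclid_def)
    moreover have "a < mdim (euclid N)" using a by (simp add: euclid_def)
    ultimately have "smooth_on (mdim quot) (snd ?d ` (fst ?d \<inter> v -` fst (Rn N, \<lambda>x::nat \<Rightarrow> real. x))) (\<lambda>y. snd (Rn N, \<lambda>x. x) (v (chart_inv ?d y)) a)"
      using sm unfolding smooth_map_def by blast
    moreover have "fst ?d \<inter> v -` Rn N = fst ?d"
      using wm sheetD(5)[OF s] unfolding fst_qchart by blast
    ultimately show ?thesis unfolding fst_conv snd_conv quot_simps by (simp only: qchart_image[OF s])
  qed
  show sw: "smooth_fun M (\<lambda>p. v (\<pi> p) a)" if a: "a < N" for a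
    unfolding smooth_fun_def
  proof
    fix c assume c: "c \<in> atlas M"
    show "smooth_on (mdim M) (snd c ` fst c) (\<lambda>y. v (\<pi> (chart_inv c y)) a)"
    proof (rule smooth_on_local[OF chart_image_open'[OF c]])
      fix y assume "y \<in> snd c ` fst c"
      then obtain p where p: "p \<in> fst c" "y = snd c p" by blast
      obtain V where V: "openin (mtop M) V" "p \<in> V" "V \<subseteq> fst c" "inj_on \<pi> V"
        using evenly_covered[OF chart_open[OF c] p(1)] by blast
      have s: "sheet c V" using V c by (simp add: sheet_def)
      show "\<exists>U f. openin (Euclidean_space (mdim M)) U \<and> y \<in> U \<and> smooth_on (mdim M) U f \<and> (\<forall>z\<in>U. v (\<pi> (chart_inv c z)) a = f z)"
      proof (intro exI conjI ballI)
        show "openin (Euclidean_space (mdim M)) (snd c ` V)" by (rule sheet_image_open[OF s])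
        show "y \<in> snd c ` V" using p(2) V(2) by blast
        show "smooth_on (mdim M) (snd c ` V) (\<lambda>y. v (chart_inv (qchart c V) y) a)" by (rule smV[OF s a])
        show "v (\<pi> (chart_inv c z)) a = v (chart_inv (qchart c V) z) a" if "z \<in> snd c ` V" for z
          by (simp add: qchart_inv[OF s that])
      qed
    qed
  qed
  assume c: "c \<in> atlas M" and p: "p \<in> fst c" and ij: "i < mdim M" "j < mdim M"
  obtain V where V: "openin (mtop M) V" "p \<in> V" "V \<subseteq> fst c" "inj_on \<pi> V"
    using evenly_covered[OF chart_open[OF c] p] by blast
  have s: "sheet c V" using V c by (simp add: sheet_def)
  let ?d = "qchart c V" and ?e = "(Rn N, \<lambda>x::nat \<Rightarrow> real. x)"
  have J: "jacobian_entry ?d ?e v (\<pi> p) a i = coord_deriv c (\<lambda>p. v (\<pi> p) a) p i" if i: "i < mdim M" for a i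
    unfolding jacobian_entry_def coord_deriv_def snd_qchart[OF s V(2)] snd_conv
  proof (rule partial_deriv_cong[OF sheet_image_open[OF s] _ i])
    show "snd c p \<in> snd c ` V" using V(2) by blast
    show "v (chart_inv ?d y) a = v (\<pi> (chart_inv c y)) a" if "y \<in> snd c ` V" for y
      by (simp add: qchart_inv[OF s that])
  qed
  have "?d \<in> atlas quot" unfolding quot_simps using s by blast
  moreover have "?e \<in> atlas (euclid N)" by (simp add: euclid_def)
  moreover have "\<pi> p \<in> fst ?d \<inter> v -` fst ?e" using wm[of p] V(2) sheetD(5)[OF s] by (auto simp: fst_qchart)
  ultimately have "quot_metric h ?d (\<pi> p) i j = (\<Sum>a<mdim (euclid N). \<Sum>b<mdim (euclid N).
      jacobian_entry ?d ?e v (\<pi> p) a i * jacobian_entry ?d ?e v (\<pi> p) b j * flat_metric ?e (v (\<pi> p)) a b)"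
    using pb ij unfolding pullback_eq_def quot_simps(1) by blast
  also have "mdim (euclid N) = N" by (simp add: euclid_def)
  finally show "h c p i j = (\<Sum>a<N. coord_deriv c (\<lambda>p. v (\<pi> p) a) p i * coord_deriv c (\<lambda>p. v (\<pi> p) a) p j)"
    unfolding flat_sum quot_metric_qchart[OF s V(2) ij] J[OF ij(1)] J[OF ij(2)] .
qed

end

end


section \<open>The bounded isometric embedding\<close>

text \<open>The third assumption is continuity of the inverse, point by point and without a formula
  for the inverse.\<close>

lemma embedding_mapI:
  assumes f: "continuous_map X Y f" and inj: "inj_on f (topspace X)"
    and open_nbhd: "\<And>W x. openin X W \<Longrightarrow> x \<in> W \<Longrightarrow>
      \<exists>T. openin Y T \<and> f x \<in> T \<and> (\<forall>x'\<in>topspace X. f x' \<in> T \<longrightarrow> x' \<in> W)"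
  shows "embedding_map X Y f"
  unfolding embedding_map_def
proof (rule bijective_open_imp_homeomorphic_map)
  show "continuous_map X (subtopology Y (f ` topspace X)) f"
    using f by (simp add: continuous_map_in_subtopology)
  show "f ` topspace X = topspace (subtopology Y (f ` topspace X))"
    using f unfolding continuous_map_def topspace_subtopology by blast
  show "open_map X (subtopology Y (f ` topspace X)) f"
    unfolding open_map_def
  proof (intro allI impI)
    fix W assume W: "openin X W"
    show "openin (subtopology Y (f ` topspace X)) (f ` W)"
    proof (subst openin_subopen, intro ballI)
      fix y assume "y \<in> f ` W"
      then obtain x where x: "x \<in> W" "y = f x" by blast
      obtain T where T: "openin Y T" "f x \<in> T" "\<forall>x'\<in>topspace X. f x' \<in> T \<longrightarrow> x' \<in> W"
        using open_nbhd[OF W x(1)] by blast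
      have "openin (subtopology Y (f ` topspace X)) (T \<inter> f ` topspace X)"
        unfolding openin_subtopology using T(1) by blast
      moreover have "y \<in> T \<inter> f ` topspace X" using T(2) x openin_subset[OF W] by blast
      moreover have "T \<inter> f ` topspace X \<subseteq> f ` W" using T(3) by blast
      ultimately show "\<exists>T. openin (subtopology Y (f ` topspace X)) T \<and> y \<in> T \<and> T \<subseteq> f ` W" by blast
    qed
  qed
qed (rule inj)

lemma embedding_mapD:
  assumes f: "embedding_map X Y f" and W: "openin X W"
  obtains T where "openin Y T" "\<And>x. x \<in> topspace X \<Longrightarrow> f x \<in> T \<longleftrightarrow> x \<in> W"
proof -
  have hm: "homeomorphic_map X (subtopology Y (f ` topspace X)) f" using f by (simp add: embedding_map_def)
  have "openin (subtopology Y (f ` topspace X)) (f ` W)"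
    using homeomorphic_imp_open_map[OF hm] W unfolding open_map_def by blast
  then obtain T where T: "openin Y T" "f ` W = T \<inter> f ` topspace X" unfolding openin_subtopology by blast
  have "inj_on f (topspace X)" by (rule homeomorphic_imp_injective_map[OF hm])
  then have "f x \<in> T \<longleftrightarrow> x \<in> W" if "x \<in> topspace X" for x
    using T(2) that openin_subset[OF W] by (metis IntD1 IntI image_eqI inj_on_image_mem_iff)
  with T(1) show ?thesis by (rule that)
qed

lemma sum_block_pairs:
  fixes f :: "nat \<Rightarrow> real"
  shows "(\<Sum>a<N + 2 * n. f a) = (\<Sum>a<N. f a) + (\<Sum>k<n. f (N + 2 * k) + f (N + 2 * k + 1))"
  by (induction n) (auto simp: algebra_simps)

context invariant_metric
begin

lemma bounded_isometric_embedding: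
  assumes mn: "m \<le> n"
    and nash: "\<And>h. riemannian_metric quot h \<Longrightarrow> \<exists>u. isometric_embedding quot h N u"
  shows "\<exists>u. isometric_embedding M \<g> (N + 2 * n) u \<and> euclid_bounded (N + 2 * n) (u ` X)"
proof -
  obtain \<epsilon> where \<epsilon>: "\<epsilon> > 0" and hm: "riemannian_metric M (\<lambda>c p i j. \<g> c p i j - \<epsilon>\<^sup>2 * P c p i j)"
    and ha: "\<forall>h\<in>carrier G. pullback_eq M (\<lambda>c p i j. \<g> c p i j - \<epsilon>\<^sup>2 * P c p i j) M (\<lambda>c p i j. \<g> c p i j - \<epsilon>\<^sup>2 * P c p i j) (act h)"
    by (rule remainder_metric) (rule that)
  define h where "h = (\<lambda>c p i j. \<g> c p i j - \<epsilon>\<^sup>2 * P c p i j)"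
  note hm = hm[folded h_def] and ha = ha[folded h_def]
  obtain v where v: "isometric_embedding quot (quot_metric h) N v"
    using nash[OF quot_metric_riemannian[OF hm ha]] by blast
  note vc = pullback_embedding(1)[OF hm ha v] and vs = pullback_embedding(2)[OF hm ha v]
    and vi = pullback_embedding(3)[OF hm ha v]
  have vm: "v (\<pi> p) \<in> Rn N" if "p \<in> X" for p using vc that unfolding continuous_map_def by blast
  obtain x y r x' y' :: "real \<Rightarrow> real" where
    sx: "\<And>n U f. openin (Euclidean_space n) U \<Longrightarrow> smooth_on n U f \<Longrightarrow> smooth_on n U (\<lambda>z. x (f z))" and
    sy: "\<And>n U f. openin (Euclidean_space n) U \<Longrightarrow> smooth_on n U f \<Longrightarrow> smooth_on n U (\<lambda>z. y (f z))" and
    dx: "\<And>t. DERIV x t :> x' t" and dy: "\<And>t. DERIV y t :> y' t" and unit: "\<And>t. (x' t)\<^sup>2 + (y' t)\<^sup>2 = 1" and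
    rad: "\<And>t. (x t)\<^sup>2 + (y t)\<^sup>2 = (r t)\<^sup>2" and mono: "strict_mono r" and r0: "\<And>t. 0 < r t" and r5: "\<And>t. r t < 5"
    by (rule bounded_spiral) (rule that)

  \<comment> \<open>Construction and smoothness of the map\<close>
  let ?D = "N + 2 * n"
  \<comment> \<open>Blocks: \<open>N\<close> coordinates from the quotient, \<open>m\<close> pairs
    of spiral coordinates scaled by \<open>\<epsilon>\<close>, and zeros in the remaining
    \<open>2 * (n - m)\<close> places.\<close>
  define u where "u p a = (if a < N then v (\<pi> p) a
    else if a < N + 2 * m then
      (if even (a - N) then \<epsilon> * x (\<phi> p ((a - N) div 2)) else \<epsilon> * y (\<phi> p ((a - N) div 2)))
    else 0)" for p a
  have u_v: "u p a = v (\<pi> p) a" if "a < N" for p a using that by (simp add: u_def)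
  have u_x: "u p (N + 2 * k) = \<epsilon> * x (\<phi> p k)" if "k < m" for p k using that by (simp add: u_def)
  have u_y: "u p (N + 2 * k + 1) = \<epsilon> * y (\<phi> p k)" if "k < m" for p k
  proof -
    have "N + 2 * k + 1 - N = 2 * k + 1" by simp
    moreover have "\<not> N + 2 * k + 1 < N" "N + 2 * k + 1 < N + 2 * m" using that by auto
    ultimately show ?thesis unfolding u_def by simp
  qed
  have u_0: "u p a = 0" if "a \<ge> N + 2 * m" for p a using that by (simp add: u_def)
  have um: "u p \<in> Rn ?D" for p using u_0 mn by (simp add: mem_Rn)
  have us: "smooth_fun M (\<lambda>p. u p a)" for a
  proof -
    have sxy: "smooth_fun M (\<lambda>p. \<epsilon> * x (\<phi> p k))" "smooth_fun M (\<lambda>p. \<epsilon> * y (\<phi> p k))" if "k < m" for k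
    proof -
      have "smooth_fun M (\<lambda>p. x (\<phi> p k))"
        unfolding smooth_fun_def by (rule ballI, rule sx[OF chart_image_open' smooth_funD[OF \<phi>_smooth[OF that]]])
      then show "smooth_fun M (\<lambda>p. \<epsilon> * x (\<phi> p k))" by (rule smooth_fun_mult[OF smooth_fun_const])
      have "smooth_fun M (\<lambda>p. y (\<phi> p k))"
        unfolding smooth_fun_def by (rule ballI, rule sy[OF chart_image_open' smooth_funD[OF \<phi>_smooth[OF that]]])
      then show "smooth_fun M (\<lambda>p. \<epsilon> * y (\<phi> p k))" by (rule smooth_fun_mult[OF smooth_fun_const])
    qed
    consider "a < N" | "a \<ge> N" "a < N + 2 * m" | "a \<ge> N + 2 * m" by linarith
    then show ?thesis
    proof cases
      case 1
      then show ?thesis using vs[OF 1] by (simp add: u_v)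
    next
      case 2
      then have k: "(a - N) div 2 < m" by auto
      show ?thesis
      proof (cases "even (a - N)")
        case True
        then show ?thesis using 2 sxy(1)[OF k] by (simp add: u_def)
      next
        case False
        then show ?thesis using 2 sxy(2)[OF k] by (simp add: u_def)
      qed
    next
      case 3
      then show ?thesis using smooth_fun_const[of 0] by (simp add: u_0)
    qed
  qed
  have uc: "continuous_map (mtop M) (Euclidean_space ?D) u"
  proof -
    have "continuous_map (mtop M) (Euclidean_space ?D) (\<lambda>p a. if a < ?D then u p a else 0)"
      unfolding continuous_map_componentwise_Euclidean_space using smooth_fun_continuous[OF us] by blast
    moreover have "(\<lambda>p a. if a < ?D then u p a else 0) = u"
      using um by (auto simp: fun_eq_iff mem_Rn)
    ultimately show ?thesis by simp
  qed
  have usm: "smooth_map M (euclid ?D) u"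
    using smooth_map_euclid_iff[of u ?D, OF um] uc us by blast

  \<comment> \<open>The induced metric\<close>
  have metric_u: "\<g> c p i j = (\<Sum>a<?D. coord_deriv c (\<lambda>p. u p a) p i * coord_deriv c (\<lambda>p. u p a) p j)"
    if c: "c \<in> atlas M" "p \<in> fst c" and ij: "i < mdim M" "j < mdim M" for c p i j
  proof -
    let ?d = "\<lambda>a i. coord_deriv c (\<lambda>p. u p a) p i" and ?f = "\<lambda>k i. coord_deriv c (\<lambda>p. \<phi> p k) p i"
    have dv: "?d a i = coord_deriv c (\<lambda>p. v (\<pi> p) a) p i" if "a < N" for a i using that by (simp add: u_v)
    have d1: "?d (N + 2 * k) i = \<epsilon> * x' (\<phi> p k) * ?f k i" if "k < m" "i < mdim M" for k i
      unfolding u_x[OF that(1)]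
      by (rule coord_deriv_real_compose[OF \<phi>_smooth[OF that(1)] c that(2) DERIV_cmult[OF dx]])
    have d2: "?d (N + 2 * k + 1) i = \<epsilon> * y' (\<phi> p k) * ?f k i" if "k < m" "i < mdim M" for k i
      unfolding u_y[OF that(1)]
      by (rule coord_deriv_real_compose[OF \<phi>_smooth[OF that(1)] c that(2) DERIV_cmult[OF dy]])
    have d0: "?d a i = 0" if "a \<ge> N + 2 * m" for a i
      unfolding u_0[OF that] coord_deriv_def partial_deriv_def by simp
    \<comment> \<open>Unit speed turns the two products of pair \<open>k\<close> into
      \<open>\<epsilon>\<^sup>2\<close> times the contribution of coordinate \<open>k\<close> to
      \<open>P\<close>; summed over \<open>k\<close> they restore what was subtracted from the
      metric.\<close>
    have pair: "?d (N + 2 * k) i * ?d (N + 2 * k) j + ?d (N + 2 * k + 1) i * ?d (N + 2 * k + 1) j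
        = (if k < m then \<epsilon>\<^sup>2 * (?f k i * ?f k j) else 0)" for k
    proof (cases "k < m")
      case True
      have "?d (N + 2 * k) i * ?d (N + 2 * k) j + ?d (N + 2 * k + 1) i * ?d (N + 2 * k + 1) j
          = \<epsilon>\<^sup>2 * ((x' (\<phi> p k))\<^sup>2 + (y' (\<phi> p k))\<^sup>2) * (?f k i * ?f k j)"
        unfolding d1[OF True ij(1)] d1[OF True ij(2)] d2[OF True ij(1)] d2[OF True ij(2)]
        by (simp only: power2_eq_square distrib_left distrib_right mult_ac)
      then show ?thesis using True unit by simp
    next
      case False
      then show ?thesis using d0[of "N + 2 * k"] d0[of "N + 2 * k + 1"] by simp
    qed
    have "(\<Sum>a<?D. ?d a i * ?d a j) = (\<Sum>a<N. ?d a i * ?d a j) + (\<Sum>k<n. if k < m then \<epsilon>\<^sup>2 * (?f k i * ?f k j) else 0)"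
      unfolding sum_block_pairs pair ..
    also have "(\<Sum>a<N. ?d a i * ?d a j) = h c p i j"
      unfolding vi[OF c ij] by (rule sum.cong) (simp_all add: dv)
    also have "(\<Sum>k<n. if k < m then \<epsilon>\<^sup>2 * (?f k i * ?f k j) else 0) = (\<Sum>k<m. \<epsilon>\<^sup>2 * (?f k i * ?f k j))"
      using mn by (intro sum.mono_neutral_cong_right) auto
    also have "\<dots> = \<epsilon>\<^sup>2 * P c p i j" by (simp add: P_def sum_distrib_left)
    finally show ?thesis by (simp add: h_def)
  qed
  have atlas_E: "atlas (euclid ?D) = {(Rn ?D, \<lambda>x. x)}" and mdim_E: "mdim (euclid ?D) = ?D" and mtop_E: "mtop (euclid ?D) = Euclidean_space ?D"
    by (simp_all add: euclid_def)
  have J: "jacobian_entry c e u p a i = coord_deriv c (\<lambda>p. u p a) p i" if "e \<in> atlas (euclid ?D)" for c e p a i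
    using that unfolding atlas_E jacobian_entry_eq by simp
  have pb: "pullback_eq M \<g> (euclid ?D) flat_metric u"
    unfolding pullback_eq_def mdim_E
  proof (intro ballI allI impI)
    fix c e p i j assume c: "c \<in> atlas M" and e: "e \<in> atlas (euclid ?D)" and p: "p \<in> fst c \<inter> u -` fst e"
      and ij: "i < mdim M" "j < mdim M"
    have "p \<in> fst c" using p by blast
    then show "\<g> c p i j = (\<Sum>a<?D. \<Sum>b<?D. jacobian_entry c e u p a i * jacobian_entry c e u p b j * flat_metric e (u p) a b)"
      unfolding flat_sum J[OF e] by (rule metric_u[OF c _ ij])
  qed

  \<comment> \<open>Immersion\<close>
  have imm: "immersion M (euclid ?D) u"
    unfolding immersion_def mdim_E
  proof (intro conjI usm ballI allI impI)
    fix c e p and w :: "nat \<Rightarrow> real" and i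
    assume c: "c \<in> atlas M" and e: "e \<in> atlas (euclid ?D)" and p: "p \<in> fst c \<inter> u -` fst e"
      and z: "\<forall>a<?D. (\<Sum>i<mdim M. jacobian_entry c e u p a i * w i) = 0" and i: "i < mdim M"
    let ?d = "\<lambda>a i. coord_deriv c (\<lambda>p. u p a) p i"
    have pc: "p \<in> fst c" using p by blast
    \<comment> \<open>An isometric map satisfies \<open>g(w, w) = |du(w)|^2\<close>, so a kernel
      vector has length zero and vanishes.\<close>
    have "quad M \<g> c p w = (\<Sum>i<mdim M. \<Sum>j<mdim M. \<Sum>a<?D. (?d a i * w i) * (?d a j * w j))"
      unfolding quad_def
      by (intro sum.cong refl) (simp add: metric_u[OF c pc] sum_distrib_left sum_distrib_right mult_ac)
    also have "\<dots> = (\<Sum>i<mdim M. \<Sum>a<?D. \<Sum>j<mdim M. (?d a i * w i) * (?d a j * w j))"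
      by (rule sum.cong[OF refl], rule sum.swap)
    also have "\<dots> = (\<Sum>a<?D. \<Sum>i<mdim M. \<Sum>j<mdim M. (?d a i * w i) * (?d a j * w j))"
      by (rule sum.swap)
    also have "\<dots> = (\<Sum>a<?D. (\<Sum>i<mdim M. ?d a i * w i) * (\<Sum>j<mdim M. ?d a j * w j))"
      by (simp only: sum_product)
    also have "\<dots> = 0" using z unfolding J[OF e] by (intro sum.neutral ballI) simp
    finally show "w i = 0" using quad_g_pos[OF c pc, of w] i by force
  qed

  \<comment> \<open>Continuity of the inverse\<close>
  have near: "\<exists>T. openin (Euclidean_space ?D) T \<and> u p \<in> T \<and> (\<forall>q\<in>X. u q \<in> T \<longrightarrow> q \<in> W)"
    if W: "openin (mtop M) W" "p \<in> W" for W p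
  proof -
    have pX: "p \<in> X" using W openin_subset by blast
    obtain \<eta> where \<eta>: "\<eta> > 0" "\<And>g. g \<in> carrier G \<Longrightarrow> euclid_dist m (\<rho> g (\<phi> p)) (\<phi> p) < \<eta> \<Longrightarrow> g = \<one>"
      by (rule R.separation[OF \<phi>_mem]) (rule that)
    obtain V where V: "openin (mtop M) V" "p \<in> V" "V \<subseteq> W" "\<And>q. q \<in> V \<Longrightarrow> euclid_dist m (\<phi> q) (\<phi> p) < \<eta> / 2"
      by (rule small_neighbourhood[OF W, of "\<eta> / 2"]) (use \<eta>(1) in simp, rule that)
    have VX: "V \<subseteq> X" using V(1) by (rule openin_subset)
    have ve: "embedding_map (orbit_topology G (mtop M) act) (Euclidean_space N) v"
      using v by (simp add: isometric_embedding_def smooth_embedding_def quot_simps euclid_def)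
    obtain T1 where T1: "openin (Euclidean_space N) T1"
      "\<And>q. q \<in> topspace (orbit_topology G (mtop M) act) \<Longrightarrow> v q \<in> T1 \<longleftrightarrow> q \<in> \<pi> ` V"
      by (rule embedding_mapD[OF ve orbit_image_open[OF V(1)]]) (rule that)
    have T1: "openin (Euclidean_space N) T1" "\<And>q. q \<in> X \<Longrightarrow> v (\<pi> q) \<in> T1 \<longleftrightarrow> \<pi> q \<in> \<pi> ` V"
      using T1 unfolding topspace_orbit_topology by (auto simp: orbits_def)
    \<comment> \<open>Errors of \<open>\<delta>\<close> in all coordinates add up to at most
      \<open>m * \<delta> < \<eta> / 2\<close>; the other half of \<open>\<eta>\<close> is used by
      \<open>V\<close>.\<close>
    define \<delta> where "\<delta> = \<eta> / (2 * real (Suc m))"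
    have \<delta>: "\<delta> > 0" "real m * \<delta> < \<eta> / 2" using \<eta>(1) by (auto simp: \<delta>_def field_simps)
    \<comment> \<open>The distance from the centre in the plane of pair \<open>k\<close>. On the
      image it is the radius of the spiral, a monotone function of
      \<open>\<phi> q k\<close>.\<close>
    define s where "s z k = sqrt ((z (N + 2 * k))\<^sup>2 + (z (N + 2 * k + 1))\<^sup>2)" for z :: "nat \<Rightarrow> real" and k
    have s_u: "s (u q) k = \<epsilon> * r (\<phi> q k)" if "k < m" for q k
    proof -
      have "(\<epsilon> * x (\<phi> q k))\<^sup>2 + (\<epsilon> * y (\<phi> q k))\<^sup>2 = (\<epsilon> * r (\<phi> q k))\<^sup>2"
        using rad[of "\<phi> q k"] by (simp add: power_mult_distrib distrib_left[symmetric])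
      then show ?thesis
        unfolding s_def u_x[OF that] u_y[OF that] using \<epsilon> r0[of "\<phi> q k"] by simp
    qed
    \<comment> \<open>Because \<open>r\<close> is strictly increasing, these radii describe exactly
      a box of half-width \<open>\<delta>\<close> around \<open>\<phi> p\<close>.\<close>
    define B where "B = {z \<in> Rn m. \<forall>k<m. z k \<in> {\<epsilon> * r (\<phi> p k - \<delta>)<..<\<epsilon> * r (\<phi> p k + \<delta>)}}"
    have Bo: "openin (Euclidean_space m) B" unfolding B_def by (rule openin_Euclidean_space_box) auto
    let ?tr = "\<lambda>z a. if a < N then z a else (0::real)" and ?sm = "\<lambda>z k. if k < m then s z k else (0::real)"
    have co: "continuous_map (Euclidean_space ?D) euclideanreal (\<lambda>z. z a)" for a
      unfolding continuous_map_Euclidean_space_iff by (rule continuous_on_coord)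
    have c1: "continuous_map (Euclidean_space ?D) (Euclidean_space N) ?tr"
      unfolding continuous_map_componentwise_Euclidean_space using co by blast
    have c2: "continuous_map (Euclidean_space ?D) (Euclidean_space m) ?sm"
      unfolding continuous_map_componentwise_Euclidean_space s_def
      unfolding continuous_map_Euclidean_space_iff
      by (intro allI impI continuous_on_real_sqrt continuous_on_add continuous_on_power continuous_on_coord)
    \<comment> \<open>The first condition says that \<open>q = act g w\<close> with \<open>w\<close>
      in \<open>V\<close>; the second says that \<open>\<phi> q\<close> is near
      \<open>\<phi> p\<close>. As \<open>\<phi> w\<close> is near \<open>\<phi> p\<close> too,
      \<open>\<rho> g\<close> moves \<open>\<phi> p\<close> by less than \<open>\<eta>\<close>, so
      \<open>g\<close> is the unit and \<open>q = w\<close>.\<close>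
    define T where "T = {z \<in> Rn ?D. ?tr z \<in> T1} \<inter> {z \<in> Rn ?D. ?sm z \<in> B}"
    have "openin (Euclidean_space ?D) T"
      unfolding T_def
      by (intro openin_Int openin_continuous_map_preimage[OF c1 T1(1)] openin_continuous_map_preimage[OF c2 Bo])
    moreover have tr_u: "?tr (u q) = v (\<pi> q)" if "q \<in> X" for q
      using vm[OF that] by (auto simp: u_v mem_Rn fun_eq_iff)
    have "u p \<in> T"
    proof -
      have "?tr (u p) \<in> T1" unfolding tr_u[OF pX] using T1(2)[OF pX] V(2) by blast
      moreover have "?sm (u p) \<in> B"
      proof -
        have "r (\<phi> p k - \<delta>) < r (\<phi> p k)" "r (\<phi> p k) < r (\<phi> p k + \<delta>)" for k
          using strict_monoD[OF mono] \<delta>(1) by simp_all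
        then show ?thesis using \<epsilon> s_u by (simp add: B_def mem_Rn)
      qed
      ultimately show ?thesis using um unfolding T_def by blast
    qed
    moreover have "q \<in> W" if q: "q \<in> X" "u q \<in> T" for q
    proof -
      have "\<pi> q \<in> \<pi> ` V" using q T1(2)[OF q(1)] tr_u[OF q(1)] unfolding T_def by simp
      then obtain w where w: "w \<in> V" "\<pi> w = \<pi> q" by auto
      have wX: "w \<in> X" using w(1) VX by blast
      obtain g where g: "g \<in> carrier G" "q = act g w" using orbit_eq_iff[OF wX q(1)] w(2) by blast
      have qB: "?sm (u q) \<in> B" using q(2) unfolding T_def by blast
      have "\<bar>\<phi> q k - \<phi> p k\<bar> \<le> \<delta>" if k: "k < m" for k
      proof -
        have "s (u q) k \<in> {\<epsilon> * r (\<phi> p k - \<delta>)<..<\<epsilon> * r (\<phi> p k + \<delta>)}"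
          using qB k unfolding B_def by auto
        then have "r (\<phi> p k - \<delta>) < r (\<phi> q k)" "r (\<phi> q k) < r (\<phi> p k + \<delta>)"
          using \<epsilon> unfolding s_u[OF k] by simp_all
        then have "\<phi> p k - \<delta> < \<phi> q k" "\<phi> q k < \<phi> p k + \<delta>"
          using strict_mono_less[OF mono] by blast+
        then show ?thesis by linarith
      qed
      then have "euclid_dist m (\<phi> q) (\<phi> p) \<le> real m * \<delta>" by (rule euclid_dist_le)
      moreover have "\<phi> q = \<rho> g (\<phi> w)" using \<phi>_equiv[OF g(1) wX] g(2) by simp
      moreover have "euclid_dist m (\<rho> g (\<phi> p)) (\<rho> g (\<phi> w)) < \<eta> / 2"
        using R.dist[OF g(1) \<phi>_mem \<phi>_mem, of p w] V(4)[OF w(1)] euclid_dist_sym[of m "\<phi> p" "\<phi> w"] by simp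
      ultimately have "euclid_dist m (\<rho> g (\<phi> p)) (\<phi> p) < \<eta>"
        using euclid_dist_triangle[of m "\<rho> g (\<phi> p)" "\<phi> p" "\<rho> g (\<phi> w)"] \<delta>(2) by simp
      then have "g = \<one>" by (rule \<eta>(2)[OF g(1)])
      then have "q = w" using g(2) fun_cong[OF id_eq_one, of w] wX by simp
      then show ?thesis using w(1) V(3) by blast
    qed
    ultimately show ?thesis by blast
  qed

  \<comment> \<open>Injectivity\<close>
  have "inj_on u X"
  proof (rule inj_onI)
    fix p q assume p: "p \<in> X" and q: "q \<in> X" and eq: "u p = u q"
    have "v (\<pi> p) = v (\<pi> q)"
    proof
      fix a
      show "v (\<pi> p) a = v (\<pi> q) a"
      proof (cases "a < N")
        case True
        then show ?thesis using fun_cong[OF eq, of a] by (simp add: u_v)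
      next
        case False
        then show ?thesis using vm[OF p] vm[OF q] by (simp add: mem_Rn)
      qed
    qed
    moreover have "inj_on v (orbits G X act)"
    proof -
      have "embedding_map (orbit_topology G (mtop M) act) (Euclidean_space N) v"
        using v by (simp add: isometric_embedding_def smooth_embedding_def quot_simps euclid_def)
      then have "inj_on v (topspace (orbit_topology G (mtop M) act))"
        unfolding embedding_map_def by (rule homeomorphic_imp_injective_map)
      then show ?thesis unfolding topspace_orbit_topology .
    qed
    moreover have "\<pi> p \<in> orbits G X act" "\<pi> q \<in> orbits G X act" using p q by (auto simp: orbits_def)
    ultimately have "\<pi> p = \<pi> q" by (meson inj_onD)
    then obtain g where g: "g \<in> carrier G" "q = act g p" using orbit_eq_iff[OF p q] by blast
    \<comment> \<open>The squared norm of each pair recovers the radius and hence the coordinate.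
      Then \<open>\<rho> g\<close> fixes \<open>\<phi> p\<close>, and the Euclidean action is
      free.\<close>
    have "\<phi> p k = \<phi> q k" if k: "k < m" for k
    proof -
      have "\<epsilon>\<^sup>2 * ((x (\<phi> p k))\<^sup>2 + (y (\<phi> p k))\<^sup>2) = \<epsilon>\<^sup>2 * ((x (\<phi> q k))\<^sup>2 + (y (\<phi> q k))\<^sup>2)"
        using fun_cong[OF eq, of "N + 2 * k"] fun_cong[OF eq, of "N + 2 * k + 1"] u_x[OF k] u_y[OF k] \<epsilon> by simp
      then have "(r (\<phi> p k))\<^sup>2 = (r (\<phi> q k))\<^sup>2" using \<epsilon> unfolding rad by simp
      then have "r (\<phi> p k) = r (\<phi> q k)" using r0[of "\<phi> p k"] r0[of "\<phi> q k"] by (simp add: power2_eq_iff_nonneg)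
      then show ?thesis using strict_mono_eq[OF mono] by blast
    qed
    then have "\<phi> p = \<phi> q" using \<phi>_mem[of p] \<phi>_mem[of q] unfolding mem_Rn by (intro ext) (metis leI)
    then have "\<rho> g (\<phi> p) = \<phi> p" using \<phi>_equiv[OF g(1) p] g(2) by simp
    then have "g = \<one>" by (rule R.free[OF g(1) \<phi>_mem])
    then show "p = q" using g(2) fun_cong[OF id_eq_one, of p] p by simp
  qed
  then have "embedding_map (mtop M) (mtop (euclid ?D)) u"
    unfolding mtop_E by (rule embedding_mapI[OF uc _ near])
  then have iso: "isometric_embedding M \<g> ?D u"
    unfolding isometric_embedding_def smooth_embedding_def using imm pb by blast

  \<comment> \<open>Boundedness\<close>
  have "\<exists>b. \<forall>p\<in>X. \<bar>v (\<pi> p) a\<bar> \<le> b" for a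
  proof -
    have "continuous_map (Euclidean_space N) euclideanreal (\<lambda>z. z a)"
      unfolding continuous_map_Euclidean_space_iff by (rule continuous_on_coord)
    moreover have "continuous_map (orbit_topology G (mtop M) act) (Euclidean_space N) v"
      using v by (simp add: isometric_embedding_def smooth_embedding_def immersion_def smooth_map_def quot_simps euclid_def)
    ultimately have "continuous_map (orbit_topology G (mtop M) act) euclideanreal ((\<lambda>z. z a) \<circ> v)"
      by (rule continuous_map_compose[rotated])
    then have "compactin euclideanreal (((\<lambda>z. z a) \<circ> v) ` orbits G X act)"
      using cc unfolding cocompact_def compact_space_def topspace_orbit_topology by (intro image_compactin)
    then have "bounded (((\<lambda>z. z a) \<circ> v) ` orbits G X act)" by (simp add: compact_imp_bounded)
    then obtain b where b: "\<forall>t\<in>((\<lambda>z. z a) \<circ> v) ` orbits G X act. norm t \<le> b" unfolding bounded_iff by blast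
    have "\<bar>v (\<pi> p) a\<bar> \<le> b" if "p \<in> X" for p
    proof -
      have "\<pi> p \<in> orbits G X act" using that by (auto simp: orbits_def)
      then show ?thesis using b by simp
    qed
    then show ?thesis by blast
  qed
  then have "\<forall>a. \<exists>b. \<forall>p\<in>X. \<bar>v (\<pi> p) a\<bar> \<le> b" by blast
  from choice[OF this] obtain b where b: "\<And>a p. p \<in> X \<Longrightarrow> \<bar>v (\<pi> p) a\<bar> \<le> b a" by blast
  \<comment> \<open>One bound for all coordinates: the first summand comes from compactness of the
    quotient, and the 5 is the bound for the radius of the spiral.\<close>
  define B where "B = (\<Sum>a<N. \<bar>b a\<bar>) + 5 * \<epsilon>"
  have xy: "\<bar>\<epsilon> * x t\<bar> \<le> 5 * \<epsilon>" "\<bar>\<epsilon> * y t\<bar> \<le> 5 * \<epsilon>" for t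
  proof -
    have "\<bar>x t\<bar>\<^sup>2 \<le> (r t)\<^sup>2" "\<bar>y t\<bar>\<^sup>2 \<le> (r t)\<^sup>2"
      unfolding power2_abs using rad[of t] zero_le_power2[of "x t"] zero_le_power2[of "y t"] by linarith+
    then have "\<bar>x t\<bar> \<le> r t" "\<bar>y t\<bar> \<le> r t" using r0[of t] by (auto intro: power2_le_imp_le)
    then have "\<bar>x t\<bar> \<le> 5" "\<bar>y t\<bar> \<le> 5" using r5[of t] by linarith+
    then show "\<bar>\<epsilon> * x t\<bar> \<le> 5 * \<epsilon>" "\<bar>\<epsilon> * y t\<bar> \<le> 5 * \<epsilon>" using \<epsilon> by (simp_all add: abs_mult)
  qed
  have Ba: "\<bar>u p a\<bar> \<le> B" if p: "p \<in> X" for p a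
  proof (cases "a < N")
    case True
    have "\<bar>b a\<bar> \<le> (\<Sum>a<N. \<bar>b a\<bar>)" using True by (intro member_le_sum) auto
    then show ?thesis using b[OF p, of a] \<epsilon> True by (simp add: u_v B_def)
  next
    case False
    have "\<bar>u p a\<bar> \<le> 5 * \<epsilon>" using False xy \<epsilon> by (simp add: u_def)
    moreover have "0 \<le> (\<Sum>a<N. \<bar>b a\<bar>)" by (intro sum_nonneg) auto
    ultimately show ?thesis unfolding B_def by linarith
  qed
  have "euclid_dist ?D (\<lambda>i. 0) (u p) \<le> real ?D * B" if "p \<in> X" for p
    using Ba[OF that] by (intro euclid_dist_le) simp
  then have "euclid_bounded ?D (u ` X)" unfolding euclid_bounded_def using um by blast
  with iso show ?thesis by blast
qed

end

theorem theorem1: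
  fixes M :: "'a manifold"
    and g :: "'a tensor2"
    and \<Gamma> :: "('g, 'b) monoid_scheme"
    and act :: "'g \<Rightarrow> 'a \<Rightarrow> 'a"
    and n N :: nat
  assumes "smooth_manifold M"
    and "riemannian_metric M g"
    and "\<exists>F. diffeomorphism M (euclid n) F"
    and "bieberbach_group \<Gamma>"
    and "group_action \<Gamma> (topspace (mtop M)) act"
    and "\<forall>\<gamma>\<in>carrier \<Gamma>. isometry M g (act \<gamma>)"
    and "free_action \<Gamma> (topspace (mtop M)) act"
    and "properly_discontinuous \<Gamma> (mtop M) act"
    and "cocompact \<Gamma> (mtop M) act"
    and "nash_dimension (quotient_manifold M \<Gamma> act) N"
  shows "\<exists>u. isometric_embedding M g (N + 2 * n) u \<and>
             euclid_bounded (N + 2 * n) (u ` topspace (mtop M))"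
proof -
  obtain F where F: "diffeomorphism M (euclid n) F" using assms(3) by blast
  obtain m \<rho> where ea: "euclid_action \<Gamma> m \<rho>" by (rule bieberbach_euclid_action[OF assms(4)])
  note ch = smooth_manifold_charted[OF assms(1)]
  have sm: "smooth_map M M (act \<gamma>)" and pb: "pullback_eq M g M g (act \<gamma>)" if "\<gamma> \<in> carrier \<Gamma>" for \<gamma>
    using assms(6) that by (auto simp: isometry_def diffeomorphism_def)
  obtain \<phi> where \<phi>: "\<And>k. k < m \<Longrightarrow> smooth_fun M (\<lambda>p. \<phi> p k)" "\<And>p. \<phi> p \<in> Rn m"
    "\<And>\<gamma> p. \<gamma> \<in> carrier \<Gamma> \<Longrightarrow> p \<in> topspace (mtop M) \<Longrightarrow> \<phi> (act \<gamma> p) = \<rho> \<gamma> (\<phi> p)"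
  proof (rule equivariant_map_exists[OF ch F assms(5) _ assms(8,9) ea])
    fix \<phi> assume "\<And>k. k < m \<Longrightarrow> smooth_fun M (\<lambda>p. \<phi> p k)" "\<And>p. \<phi> p \<in> Rn m"
      "\<And>\<gamma> p. \<gamma> \<in> carrier \<Gamma> \<Longrightarrow> p \<in> topspace (mtop M) \<Longrightarrow> \<phi> (act \<gamma> p) = \<rho> \<gamma> (\<phi> p)"
    then show thesis by (rule that[of \<phi>])
  qed (rule sm)
  \<comment> \<open>Here the dimension of the group meets that of the manifold: the
    \<open>2 * m\<close> spiral coordinates fit into \<open>2 * n\<close>.\<close>
  have mn: "m \<le> n" by (rule euclid_action_dimension_le[where \<phi> = \<phi>, OF ch F assms(5) sm ea \<phi>])
  have "equivariant_setup M \<Gamma> act m \<rho> \<phi>"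
    unfolding equivariant_setup_def equivariant_setup_axioms_def
    by (intro conjI allI impI ch assms(5,9) ea smooth_manifold_id[OF assms(1)] sm \<phi>)
  then have "invariant_metric M \<Gamma> act m \<rho> \<phi> g"
    unfolding invariant_metric_def invariant_metric_axioms_def using assms(2) pb by blast
  then interpret invariant_metric M \<Gamma> act m \<rho> \<phi> g .
  show ?thesis
    using bounded_isometric_embedding[OF mn] assms(10) unfolding nash_dimension_def by blast
qed

end
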